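(* Let $\Gamma$ be a nonelementary discrete subgroup of $\mathrm{Sp}(n,1)$ whose trace field is contained in $\mathbb R$. Then $\Gamma$ is conjugate (in $\mathrm{Sp}(n,1)$) to a subgroup of $\mathrm{Sp}(n-m)\oplus\mathrm{O}(m,1)$ for some $m\ge 2$, or to a subgroup of $\mathrm{Sp}(n-1)\oplus\mathrm{SU}(1,1)$.
   Context: $\mathbb H$ denotes the quaternions. $\mathrm{Sp}(n,1)=\{A\in\mathrm{GL}(n+1,\mathbb H): A^*I_{n,1}A=I_{n,1}\}$ with $A^*$ the conjugate transpose and $I_{n,1}=\mathrm{diag}(1,\dots,1,-1)$, acting on quaternionic hyperbolic space $\mathbf H^n_{\mathbb H}$; nonelementary means the limit set in $\partial\mathbf H^n_{\mathbb H}$ has more than two points. $\mathrm{Sp}(k)$ is the group of $k\times k$ quaternionic matrices preserving the standard positive definite form; $\mathrm{O}(m,1)$ is the group of real matrices preserving $\mathrm{diag}(1,\dots,1,-1)$; $\mathrm{SU}(1,1)$ is the group of complex $2\times 2$ matrices of determinant $1$ preserving $\mathrm{diag}(1,-1)$. $A\oplus B$ denotes block diagonal matrices with $A$ in the upper left and $B$ in the lower right block. The trace of a matrix is the sum of its diagonal entries; the trace field of $\Gamma$ is the skew field generated over $\mathbb Q$ by the traces of its elements. *)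

theory Defs
  imports "HOL-Analysis.Analysis"
begin

datatype quat = Quat (qRe: real) (qI: real) (qJ: real) (qK: real)

instantiation quat :: ring_1
begin
definition "0 = Quat 0 0 0 0"
definition "1 = Quat 1 0 0 0"
definition "p + q = Quat (qRe p + qRe q) (qI p + qI q) (qJ p + qJ q) (qK p + qK q)"
definition "p - q = Quat (qRe p - qRe q) (qI p - qI q) (qJ p - qJ q) (qK p - qK q)"
definition "- q = Quat (- qRe q) (- qI q) (- qJ q) (- qK q)"
definition "p * q = Quat
   (qRe p * qRe q - qI p * qI q - qJ p * qJ q - qK p * qK q)
   (qRe p * qI q + qI p * qRe q + qJ p * qK q - qK p * qJ q)
   (qRe p * qJ q - qI p * qK q + qJ p * qRe q + qK p * qI q)
   (qRe p * qK q + qI p * qJ q - qJ p * qI q + qK p * qRe q)"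
instance
  by standard (auto simp: zero_quat_def one_quat_def plus_quat_def minus_quat_def
      uminus_quat_def times_quat_def algebra_simps intro: quat.expand)
end

instantiation quat :: inverse
begin
definition "inverse q = (let d = (qRe q)\<^sup>2 + (qI q)\<^sup>2 + (qJ q)\<^sup>2 + (qK q)\<^sup>2 in
   Quat (qRe q / d) (- qI q / d) (- qJ q / d) (- qK q / d))"
definition "p div (q::quat) = p * inverse q"
instance ..
end

definition qcnj :: "quat \<Rightarrow> quat" where
  "qcnj q = Quat (qRe q) (- qI q) (- qJ q) (- qK q)"
definition qnorm :: "quat \<Rightarrow> real" where
  "qnorm q = sqrt ((qRe q)\<^sup>2 + (qI q)\<^sup>2 + (qJ q)\<^sup>2 + (qK q)\<^sup>2)"
definition qreal :: "real \<Rightarrow> quat" where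
  "qreal r = Quat r 0 0 0"
definition is_real_q :: "quat \<Rightarrow> bool" where
  "is_real_q q \<longleftrightarrow> qI q = 0 \<and> qJ q = 0 \<and> qK q = 0"
definition is_complex_q :: "quat \<Rightarrow> bool" where
  "is_complex_q q \<longleftrightarrow> qJ q = 0 \<and> qK q = 0"

text \<open>An \<open>N\<times>N\<close> quaternionic matrix is a function \<open>nat \<Rightarrow> nat \<Rightarrow> quat\<close>
  vanishing outside \<open>{0..<N}\<^sup>2\<close> (indices start at 0).\<close>
type_synonym qmatrix = "nat \<Rightarrow> nat \<Rightarrow> quat"

definition qmat :: "nat \<Rightarrow> qmatrix set" where
  "qmat N = {A. \<forall>i j. (N \<le> i \<or> N \<le> j) \<longrightarrow> A i j = 0}"

definition qmult :: "nat \<Rightarrow> qmatrix \<Rightarrow> qmatrix \<Rightarrow> qmatrix" where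
  "qmult N A B = (\<lambda>i j. if i < N \<and> j < N then (\<Sum>k<N. A i k * B k j) else 0)"

definition qid :: "nat \<Rightarrow> qmatrix" where
  "qid N = (\<lambda>i j. if i = j \<and> i < N then 1 else 0)"

definition qct :: "qmatrix \<Rightarrow> qmatrix" where
  "qct A = (\<lambda>i j. qcnj (A j i))"

definition qtrace :: "nat \<Rightarrow> qmatrix \<Rightarrow> quat" where
  "qtrace N A = (\<Sum>i<N. A i i)"

definition Iform :: "nat \<Rightarrow> qmatrix" where
  "Iform m = (\<lambda>i j. if i = j \<and> i < m then 1 else if i = j \<and> i = m then -1 else 0)"

definition qGL :: "nat \<Rightarrow> qmatrix set" where
  "qGL N = {A \<in> qmat N. \<exists>B \<in> qmat N. qmult N A B = qid N \<and> qmult N B A = qid N}"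

definition Sp_n1 :: "nat \<Rightarrow> qmatrix set" where
  "Sp_n1 n = {A \<in> qGL (n+1).
     qmult (n+1) (qmult (n+1) (qct A) (Iform n)) A = Iform n}"

definition Sp_k :: "nat \<Rightarrow> qmatrix set" where
  "Sp_k k = {A \<in> qmat k. qmult k (qct A) A = qid k}"

definition O_m1 :: "nat \<Rightarrow> qmatrix set" where
  "O_m1 m = {A \<in> qmat (m+1). (\<forall>i j. is_real_q (A i j)) \<and>
     qmult (m+1) (qmult (m+1) (qct A) (Iform m)) A = Iform m}"

definition SU11 :: "qmatrix set" where
  "SU11 = {A \<in> qmat 2. (\<forall>i j. is_complex_q (A i j)) \<and>
     A 0 0 * A 1 1 - A 0 1 * A 1 0 = 1 \<and>
     qmult 2 (qmult 2 (qct A) (Iform 1)) A = Iform 1}"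

definition block_sum :: "nat \<Rightarrow> nat \<Rightarrow> qmatrix set \<Rightarrow> qmatrix set \<Rightarrow> qmatrix set" where
  "block_sum k l P Q = {A \<in> qmat (k+l).
     (\<forall>i j. (i < k \<and> k \<le> j) \<or> (k \<le> i \<and> j < k) \<longrightarrow> A i j = 0) \<and>
     (\<lambda>i j. if i < k \<and> j < k then A i j else 0) \<in> P \<and>
     (\<lambda>i j. if i < l \<and> j < l then A (k+i) (k+j) else 0) \<in> Q}"

definition is_subgroup :: "nat \<Rightarrow> qmatrix set \<Rightarrow> qmatrix set \<Rightarrow> bool" where
  "is_subgroup N \<Gamma> G \<longleftrightarrow> \<Gamma> \<subseteq> G \<and> qid N \<in> \<Gamma> \<and>
     (\<forall>A\<in>\<Gamma>. \<forall>B\<in>\<Gamma>. qmult N A B \<in> \<Gamma>) \<and>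
     (\<forall>A\<in>\<Gamma>. \<exists>B\<in>\<Gamma>. qmult N A B = qid N \<and> qmult N B A = qid N)"

definition qmat_dist :: "nat \<Rightarrow> qmatrix \<Rightarrow> qmatrix \<Rightarrow> real" where
  "qmat_dist N A B = (\<Sum>i<N. \<Sum>j<N. qnorm (A i j - B i j))"

definition discrete_set :: "nat \<Rightarrow> qmatrix set \<Rightarrow> bool" where
  "discrete_set N \<Gamma> \<longleftrightarrow> (\<forall>A\<in>\<Gamma>. \<exists>e>0. \<forall>B\<in>\<Gamma>. qmat_dist N A B < e \<longrightarrow> B = A)"

text \<open>Ball model of \<open>\<bar>H\<^sup>n_\<bbbH> \<union> \<partial>H\<^sup>n_\<bbbH>\<close>: points \<open>z \<in> \<bbbH>\<^sup>n\<close> (vectors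
  \<open>nat \<Rightarrow> quat\<close> vanishing from index \<open>n\<close> on) with \<open>|z| \<le> 1\<close>, corresponding to the
  quaternionic line spanned by \<open>(z,1)\<close>; the boundary is \<open>|z| = 1\<close>.  \<open>A \<in> Sp(n,1)\<close>
  acts by \<open>z \<mapsto> w' w\<^sub>n\<^sup>-\<^sup>1\<close> where \<open>w = A(z,1)\<close>, \<open>w'\<close> its first \<open>n\<close> coordinates.\<close>
definition qvec_norm2 :: "nat \<Rightarrow> (nat \<Rightarrow> quat) \<Rightarrow> real" where
  "qvec_norm2 n z = (\<Sum>i<n. (qnorm (z i))\<^sup>2)"

definition hyp_act :: "nat \<Rightarrow> qmatrix \<Rightarrow> (nat \<Rightarrow> quat) \<Rightarrow> (nat \<Rightarrow> quat)" where
  "hyp_act n A z = (let v = (\<lambda>i. if i < n then z i else if i = n then 1 else 0);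
                       w = (\<lambda>i. \<Sum>k<n+1. A i k * v k)
                   in (\<lambda>i. if i < n then w i * inverse (w n) else 0))"

definition limit_set :: "nat \<Rightarrow> qmatrix set \<Rightarrow> (nat \<Rightarrow> quat) set" where
  "limit_set n \<Gamma> = {\<xi>. (\<forall>i\<ge>n. \<xi> i = 0) \<and> qvec_norm2 n \<xi> = 1 \<and>
     (\<exists>g :: nat \<Rightarrow> qmatrix. (\<forall>k. g k \<in> \<Gamma>) \<and>
        (\<lambda>k. \<Sum>i<n. qnorm (hyp_act n (g k) (\<lambda>_. 0) i - \<xi> i)) \<longlonglongrightarrow> 0)}"

definition nonelementary :: "nat \<Rightarrow> qmatrix set \<Rightarrow> bool" where
  "nonelementary n \<Gamma> \<longleftrightarrow> (\<exists>a b c. {a, b, c} \<subseteq> limit_set n \<Gamma> \<and> a \<noteq> b \<and> a \<noteq> c \<and> b \<noteq> c)"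

definition sub_skew_field :: "quat set \<Rightarrow> bool" where
  "sub_skew_field F \<longleftrightarrow> 0 \<in> F \<and> 1 \<in> F \<and> (\<forall>x\<in>F. \<forall>y\<in>F. x + y \<in> F \<and> x - y \<in> F \<and> x * y \<in> F) \<and>
     (\<forall>x\<in>F. x \<noteq> 0 \<longrightarrow> inverse x \<in> F)"

definition trace_field :: "nat \<Rightarrow> qmatrix set \<Rightarrow> quat set" where
  "trace_field N \<Gamma> = \<Inter>{F. sub_skew_field F \<and> qtrace N ` \<Gamma> \<subseteq> F}"

end

theory Submission
  imports Defs
begin

text \<open>Let \<open>\<A>\<close> be the closed real algebra spanned by \<open>\<Gamma>\<close>; traces of its elements are real, and
  it is invariant under the adjoint with respect to the form. Rescaled elements of \<open>\<Gamma>\<close> tending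
  to infinity converge to rank one matrices in \<open>\<A>\<close> with isotropic image, one for each limit
  point. As a discrete nonelementary group fixes no boundary point, \<open>\<A>\<close> contains some nonzero
  \<open>p d p\<^sup>* J\<close> with \<open>p\<close> isotropic. Then \<open>M = \<A> p\<close> is an invariant real subspace, and the form on
  \<open>M\<close> takes values in a real subspace \<open>F\<close> of the quaternions. The trace of \<open>u d v\<^sup>* J\<close> is
  \<open>\<Sum> \<epsilon>\<^sub>l u\<^sub>l d cnj v\<^sub>l\<close>; that these numbers are real forces \<open>F\<close> to be one-dimensional, by
  comparing norms in the sum. If \<open>F\<close> is real, then \<open>M\<close> is a real form of its quaternionic span and
  \<open>\<Gamma>\<close> acts on it through \<open>O(m,1)\<close>. Otherwise \<open>F\<close> is imaginary, the form restricted to \<open>M\<close> is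
  symplectic, and the signature forces \<open>dim M = 2\<close>, which gives \<open>SU(1,1)\<close>.\<close>

section \<open>Quaternions as a normed division algebra\<close>

text \<open>The quaternionic trace is neither cyclic nor invariant under conjugation, so the trace
  of \<open>u d v^* J\<close> is not determined by the form value of \<open>u\<close> and
  \<open>v\<close>. What survives is a test on the diagonal: for imaginary \<open>d\<close> the
  trace of \<open>u d u^* J\<close> is minus its own conjugate, so being real means being zero, that
  is, \<open>\<Sum> u_l d cnj u_l\<close> over \<open>l < n\<close> equals
  \<open>u_n d cnj u_n\<close>. Comparing norms, this is impossible for \<open>d \<noteq> 0\<close>
  when \<open>u\<close> is negative, and rigid when \<open>u\<close> is isotropic. The test requires
  \<open>u d u^* J\<close> to lie in the algebra for all \<open>u\<close> in \<open>M\<close>; this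
  is why an element with the same isotropic \<open>p\<close> at both ends is sought, and why
  adjoints enter. The final alternative is decided by the admissible coefficients \<open>d\<close>:
  they form a real space \<open>Q\<close> closed under conjugation, which contains 1 or is purely
  imaginary. Coefficients and form values control each other, since composing rank one elements
  gives \<open>Q F Q \<subseteq> Q\<close> and \<open>F Q F \<subseteq> F\<close>.\<close>

lemma quat_eq_iff: "x = y \<longleftrightarrow> qRe x = qRe y \<and> qI x = qI y \<and> qJ x = qJ y \<and> qK x = qK y"
  by (cases x; cases y) auto

lemma quat_sel [simp]:
  "qRe 0 = 0" "qI 0 = 0" "qJ 0 = 0" "qK 0 = 0"
  "qRe 1 = 1" "qI 1 = 0" "qJ 1 = 0" "qK 1 = 0"
  "qRe (x + y) = qRe x + qRe y" "qI (x + y) = qI x + qI y"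
  "qJ (x + y) = qJ x + qJ y" "qK (x + y) = qK x + qK y"
  "qRe (x - y) = qRe x - qRe y" "qI (x - y) = qI x - qI y"
  "qJ (x - y) = qJ x - qJ y" "qK (x - y) = qK x - qK y"
  "qRe (- x) = - qRe x" "qI (- x) = - qI x" "qJ (- x) = - qJ x" "qK (- x) = - qK x"
  "qRe (qcnj x) = qRe x" "qI (qcnj x) = - qI x" "qJ (qcnj x) = - qJ x" "qK (qcnj x) = - qK x"
  by (simp_all add: zero_quat_def one_quat_def plus_quat_def minus_quat_def uminus_quat_def qcnj_def)

lemma quat_mult_sel:
  "qRe (p * q) = qRe p * qRe q - qI p * qI q - qJ p * qJ q - qK p * qK q"
  "qI (p * q) = qRe p * qI q + qI p * qRe q + qJ p * qK q - qK p * qJ q"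
  "qJ (p * q) = qRe p * qJ q - qI p * qK q + qJ p * qRe q + qK p * qI q"
  "qK (p * q) = qRe p * qK q + qI p * qJ q - qJ p * qI q + qK p * qRe q"
  by (simp_all add: times_quat_def)

instantiation quat :: real_vector
begin
definition "scaleR r q = Quat (r * qRe q) (r * qI q) (r * qJ q) (r * qK q)"
instance
  by standard (auto simp: scaleR_quat_def quat_eq_iff algebra_simps)
end

lemma quat_scaleR_sel [simp]:
  "qRe (r *\<^sub>R x) = r * qRe x" "qI (r *\<^sub>R x) = r * qI x"
  "qJ (r *\<^sub>R x) = r * qJ x" "qK (r *\<^sub>R x) = r * qK x"
  by (simp_all add: scaleR_quat_def)

instantiation quat :: real_inner
begin
definition "inner p q = qRe p * qRe q + qI p * qI q + qJ p * qJ q + qK p * qK q"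
definition "norm (q::quat) = qnorm q"
definition "sgn (q::quat) = q /\<^sub>R norm q"
definition "dist (p::quat) q = norm (p - q)"
definition [code del]: "(uniformity :: (quat \<times> quat) filter) =
  (INF e\<in>{0 <..}. principal {(x, y). dist x y < e})"
definition [code del]: "open (U :: quat set) \<longleftrightarrow>
  (\<forall>x\<in>U. eventually (\<lambda>(x', y). x' = x \<longrightarrow> y \<in> U) uniformity)"
instance
proof
  fix x y z :: quat and a b r :: real
  show "inner x y = inner y x" by (simp add: inner_quat_def algebra_simps)
  show "inner (x + y) z = inner x z + inner y z" by (simp add: inner_quat_def algebra_simps)
  show "inner (r *\<^sub>R x) y = r * inner x y" by (simp add: inner_quat_def algebra_simps)
  show "0 \<le> inner x x" by (simp add: inner_quat_def)
  show "(inner x x = 0) = (x = 0)"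
    by (auto simp: inner_quat_def quat_eq_iff add_nonneg_eq_0_iff)
  show "norm x = sqrt (inner x x)"
    by (simp add: norm_quat_def qnorm_def inner_quat_def power2_eq_square)
qed (auto simp: sgn_quat_def dist_quat_def uniformity_quat_def open_quat_def)
end

text \<open>Being a Euclidean space supplies the class \<open>heine_borel\<close>, from which
  convergent subsequences of bounded matrices are extracted.\<close>

instantiation quat :: euclidean_space
begin
definition "Basis = {Quat 1 0 0 0, Quat 0 1 0 0, Quat 0 0 1 0, Quat 0 0 0 1}"
instance
proof
  show "(Basis :: quat set) \<noteq> {}" by (simp add: Basis_quat_def)
  show "finite (Basis :: quat set)" by (simp add: Basis_quat_def)
  fix u v x :: quat
  show "u \<in> Basis \<Longrightarrow> v \<in> Basis \<Longrightarrow> inner u v = (if u = v then 1 else 0)"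
    unfolding Basis_quat_def insert_iff empty_iff
    by (elim disjE FalseE) (simp_all add: inner_quat_def)
  show "(\<forall>u\<in>Basis. inner x u = 0) = (x = 0)"
    by (simp only: Basis_quat_def ball_simps) (simp add: inner_quat_def quat_eq_iff)
qed
end

lemma norm_quat_sq: "(norm x)\<^sup>2 = (qRe x)\<^sup>2 + (qI x)\<^sup>2 + (qJ x)\<^sup>2 + (qK x)\<^sup>2"
  by (simp add: norm_quat_def qnorm_def)

instance quat :: division_ring
proof
  fix a b :: quat
  assume "a \<noteq> 0"
  then have *: "(qRe a)\<^sup>2 + (qI a)\<^sup>2 + (qJ a)\<^sup>2 + (qK a)\<^sup>2 \<noteq> 0"
    by (metis norm_quat_sq norm_eq_zero power2_less_0 zero_eq_power2)
  define d where "d = (qRe a)\<^sup>2 + (qI a)\<^sup>2 + (qJ a)\<^sup>2 + (qK a)\<^sup>2"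
  have inv: "inverse a = (1 / d) *\<^sub>R qcnj a"
    by (simp add: inverse_quat_def Let_def quat_eq_iff d_def)
  have "a * qcnj a = Quat d 0 0 0" "qcnj a * a = Quat d 0 0 0"
    by (simp_all add: quat_eq_iff quat_mult_sel power2_eq_square algebra_simps d_def)
  moreover have "inverse a * a = (1 / d) *\<^sub>R (qcnj a * a)" "a * inverse a = (1 / d) *\<^sub>R (a * qcnj a)"
    by (simp_all only: inv) (simp_all add: quat_eq_iff quat_mult_sel algebra_simps add_divide_distrib)
  ultimately show "inverse a * a = 1" "a * inverse a = 1"
    using * by (simp_all add: quat_eq_iff d_def)
qed (simp_all add: divide_quat_def inverse_quat_def quat_eq_iff)

instance quat :: real_normed_div_algebra
proof
  fix x y :: quat and a :: real
  show "a *\<^sub>R x * y = a *\<^sub>R (x * y)" "x * a *\<^sub>R y = a *\<^sub>R (x * y)"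
    by (simp_all add: quat_eq_iff quat_mult_sel algebra_simps)
  have "(norm (x * y))\<^sup>2 = (norm x * norm y)\<^sup>2"
    unfolding power_mult_distrib norm_quat_sq by (simp add: quat_mult_sel power2_eq_square algebra_simps)
  then show "norm (x * y) = norm x * norm y"
    by (simp add: power2_eq_iff_nonneg)
qed

lemma of_real_quat_sel [simp]:
  "qRe (of_real r) = r" "qI (of_real r) = 0" "qJ (of_real r) = 0" "qK (of_real r) = 0"
  by (simp_all add: of_real_def)

lemma of_real_commute_quat: "of_real r * x = x * (of_real r :: quat)"
  by (simp add: quat_eq_iff quat_mult_sel)

lemma qcnj_simps [simp]:
  "qcnj 0 = 0" "qcnj 1 = 1" "qcnj (- x) = - qcnj x" "qcnj (of_real r) = of_real r"
  "qcnj (x + y) = qcnj x + qcnj y" "qcnj (x - y) = qcnj x - qcnj y"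
  "qcnj (x * y) = qcnj y * qcnj x" "qcnj (qcnj x) = x"
  by (simp_all add: quat_eq_iff quat_mult_sel algebra_simps)

lemma qcnj_sum: "qcnj (sum f S) = (\<Sum>i\<in>S. qcnj (f i))"
  by (induction S rule: infinite_finite_induct) auto

lemma norm_qcnj [simp]: "norm (qcnj x) = norm x"
  by (simp add: norm_quat_def qnorm_def)

lemma qcnj_eq_0_iff [simp]: "qcnj x = 0 \<longleftrightarrow> x = 0"
  by (simp add: quat_eq_iff)

lemma qcnj_mult_self: "qcnj x * x = of_real ((norm x)\<^sup>2)" "x * qcnj x = of_real ((norm x)\<^sup>2)"
  unfolding norm_quat_sq by (simp_all add: quat_eq_iff quat_mult_sel power2_eq_square algebra_simps)

lemma bounded_linear_qcnj: "bounded_linear qcnj"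
  by (rule bounded_linear_intro[of _ 1]) (simp_all add: quat_eq_iff)

lemmas tendsto_qcnj [tendsto_intros] = bounded_linear.tendsto[OF bounded_linear_qcnj]

lemma qRe_sum: "qRe (sum f S) = (\<Sum>i\<in>S. qRe (f i))"
  by (induction S rule: infinite_finite_induct) auto

lemma Reals_quat_iff: "x \<in> \<real> \<longleftrightarrow> qcnj x = x"
proof
  assume "qcnj x = x"
  then have "x = of_real (qRe x)" by (simp add: quat_eq_iff)
  then show "x \<in> \<real>" by (metis Reals_of_real)
qed (auto elim: Reals_cases)

lemma Reals_quat_eq: "x \<in> \<real> \<Longrightarrow> x = of_real (qRe x)"
  by (auto elim!: Reals_cases)

lemma qcnj_eq_minus_iff: "qcnj x = - x \<longleftrightarrow> qRe x = 0"
  by (auto simp: quat_eq_iff)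

lemma quat_add_qcnj: "x + qcnj x = of_real (2 * qRe x)"
  by (simp add: quat_eq_iff del: of_real_mult)

section \<open>The hermitian form and its isometries\<close>

definition eps :: "nat \<Rightarrow> nat \<Rightarrow> quat" where
  "eps n i = (if i = n then -1 else 1)"

definition qvec :: "nat \<Rightarrow> (nat \<Rightarrow> quat) set" where
  "qvec n = {v. \<forall>i>n. v i = 0}"

text \<open>\<open>x^* J y\<close> with \<open>J\<close> the diagonal matrix of signs. Scalars
  multiply vectors from the right, so that matrices act linearly from the left and the form is
  conjugate linear in its first argument.\<close>

definition herm :: "nat \<Rightarrow> (nat \<Rightarrow> quat) \<Rightarrow> (nat \<Rightarrow> quat) \<Rightarrow> quat" where
  "herm n x y = (\<Sum>i\<le>n. eps n i * (qcnj (x i) * y i))"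

definition mvec :: "nat \<Rightarrow> qmatrix \<Rightarrow> (nat \<Rightarrow> quat) \<Rightarrow> nat \<Rightarrow> quat" where
  "mvec n A v = (\<lambda>i. \<Sum>k\<le>n. A i k * v k)"

text \<open>\<open>J A^* J\<close>, the adjoint for \<open>herm\<close>. For an isometry it is the
  inverse, so a group of isometries is closed under it.\<close>

definition adj :: "nat \<Rightarrow> qmatrix \<Rightarrow> qmatrix" where
  "adj n A = (\<lambda>i j. if i \<le> n \<and> j \<le> n then eps n i * qcnj (A j i) * eps n j else 0)"

text \<open>The rank one matrix \<open>x y^* J\<close>, which sends \<open>v\<close> to
  \<open>x\<close> times \<open>herm n y v\<close>. A coefficient \<open>d\<close> between the two
  ends is absorbed into the first one as \<open>\<lambda>i. x i * d\<close>.\<close>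

definition dyad :: "nat \<Rightarrow> (nat \<Rightarrow> quat) \<Rightarrow> (nat \<Rightarrow> quat) \<Rightarrow> qmatrix" where
  "dyad n x y = (\<lambda>i j. x i * qcnj (y j) * eps n j)"

definition isom :: "nat \<Rightarrow> qmatrix set" where
  "isom n = {A \<in> qmat (Suc n). qmult (Suc n) (adj n A) A = qid (Suc n) \<and>
     qmult (Suc n) A (adj n A) = qid (Suc n)}"

lemma eps_simps [simp]: "qcnj (eps n i) = eps n i" "eps n i * eps n i = 1"
  "eps n i * (eps n i * x) = x" "norm (eps n i) = 1"
  by (auto simp: eps_def)

lemma eps_commute: "x * eps n i = eps n i * x"
  by (simp add: eps_def)

lemma qmult_Suc: "qmult (Suc n) A B i j = (if i \<le> n \<and> j \<le> n then \<Sum>k\<le>n. A i k * B k j else 0)"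
  by (simp add: qmult_def lessThan_Suc_atMost less_Suc_eq_le)

lemma qmat_Suc_iff: "A \<in> qmat (Suc n) \<longleftrightarrow> (\<forall>i j. n < i \<or> n < j \<longrightarrow> A i j = 0)"
  by (simp add: qmat_def Suc_le_eq)

lemma qid_Suc: "qid (Suc n) i j = (if i = j \<and> i \<le> n then 1 else 0)"
  by (simp add: qid_def less_Suc_eq_le)

lemma qmult_in_qmat [simp]: "qmult (Suc n) A B \<in> qmat (Suc n)"
  by (auto simp: qmat_Suc_iff qmult_Suc)

lemma qid_in_qmat [simp]: "qid (Suc n) \<in> qmat (Suc n)"
  by (auto simp: qmat_Suc_iff qid_Suc)

lemma adj_in_qmat [simp]: "adj n A \<in> qmat (Suc n)"
  by (auto simp: qmat_Suc_iff adj_def)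

lemma dyad_in_qmat [simp]: "x \<in> qvec n \<Longrightarrow> y \<in> qvec n \<Longrightarrow> dyad n x y \<in> qmat (Suc n)"
  by (auto simp: qmat_Suc_iff dyad_def qvec_def)

lemma mvec_in_qvec [simp]: "A \<in> qmat (Suc n) \<Longrightarrow> mvec n A v \<in> qvec n"
  by (auto simp: qmat_Suc_iff qvec_def mvec_def)

lemma qvec_add [simp]: "x \<in> qvec n \<Longrightarrow> y \<in> qvec n \<Longrightarrow> (\<lambda>i. x i + y i) \<in> qvec n"
  by (simp add: qvec_def)

lemma qvec_diff [simp]: "x \<in> qvec n \<Longrightarrow> y \<in> qvec n \<Longrightarrow> (\<lambda>i. x i - y i) \<in> qvec n"
  by (simp add: qvec_def)

lemma qvec_scale [simp]: "x \<in> qvec n \<Longrightarrow> (\<lambda>i. x i * q) \<in> qvec n"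
  by (simp add: qvec_def)

lemma qvec_eqI:
  assumes "x \<in> qvec n" "y \<in> qvec n" "\<And>i. i \<le> n \<Longrightarrow> x i = y i"
  shows "x = y"
proof
  fix i
  show "x i = y i" using assms by (cases "i \<le> n") (simp_all add: qvec_def)
qed

lemma herm_cong: "(\<And>i. i \<le> n \<Longrightarrow> x i = x' i) \<Longrightarrow> (\<And>i. i \<le> n \<Longrightarrow> y i = y' i) \<Longrightarrow> herm n x y = herm n x' y'"
  by (simp add: herm_def)

lemma herm_add_right: "herm n x (\<lambda>i. y i + z i) = herm n x y + herm n x z"
  by (simp add: herm_def distrib_left sum.distrib)

lemma herm_diff_right: "herm n x (\<lambda>i. y i - z i) = herm n x y - herm n x z"
  by (simp add: herm_def right_diff_distrib sum_subtractf)

lemma herm_scale_right: "herm n x (\<lambda>i. y i * q) = herm n x y * q"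
  by (simp add: herm_def sum_distrib_right mult.assoc)

lemma herm_sum_right: "herm n x (\<lambda>i. \<Sum>j\<in>S. f j i) = (\<Sum>j\<in>S. herm n x (f j))"
  unfolding herm_def sum_distrib_left by (rule sum.swap)

lemma qcnj_herm: "qcnj (herm n x y) = herm n y x"
  unfolding herm_def qcnj_sum by (rule sum.cong) (simp_all add: eps_def)

lemma herm_zero_sym: "herm n x y = 0 \<Longrightarrow> herm n y x = 0"
  using qcnj_herm[of n x y] by simp

lemma herm_add_left: "herm n (\<lambda>i. x i + y i) z = herm n x z + herm n y z"
  by (simp add: herm_def distrib_left distrib_right sum.distrib)

lemma herm_diff_left: "herm n (\<lambda>i. x i - y i) z = herm n x z - herm n y z"
  by (simp add: herm_def right_diff_distrib left_diff_distrib sum_subtractf)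

lemma herm_scale_left: "herm n (\<lambda>i. x i * q) y = qcnj q * herm n x y"
  unfolding herm_def sum_distrib_left by (rule sum.cong) (simp_all add: eps_def mult.assoc)

lemma herm_zero_right [simp]: "herm n x (\<lambda>i. 0) = 0"
  by (simp add: herm_def)

lemma herm_zero_left [simp]: "herm n (\<lambda>i. 0) x = 0"
  by (simp add: herm_def)

lemmas herm_lin = herm_add_right herm_diff_right herm_scale_right
  herm_add_left herm_diff_left herm_scale_left

lemma sum_atMost_eps: "(\<Sum>i\<le>n. eps n i * f i) = (\<Sum>i<n. f i) - f n"
proof -
  have "(\<Sum>i<n. eps n i * f i) = (\<Sum>i<n. f i)"
    by (rule sum.cong) (auto simp: eps_def)
  then show ?thesis
    by (simp add: lessThan_Suc_atMost[symmetric]) (simp add: eps_def)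
qed

lemma herm_self: "herm n x x = of_real ((\<Sum>i<n. (norm (x i))\<^sup>2) - (norm (x n))\<^sup>2)"
  by (simp add: herm_def sum_atMost_eps qcnj_mult_self)

lemma qRe_herm_self: "qRe (herm n x x) = (\<Sum>i<n. (norm (x i))\<^sup>2) - (norm (x n))\<^sup>2"
  unfolding herm_self by (rule of_real_quat_sel)

lemma herm_self_qRe: "herm n x x = of_real (qRe (herm n x x))"
  unfolding qRe_herm_self by (rule herm_self)

lemma herm_self_eq_0: "herm n x x = 0 \<longleftrightarrow> (\<Sum>i<n. (norm (x i))\<^sup>2) = (norm (x n))\<^sup>2"
  unfolding herm_self by (simp only: of_real_eq_0_iff right_minus_eq)

lemma mvec_scale: "mvec n A (\<lambda>i. v i * q) = (\<lambda>i. mvec n A v i * q)"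
  by (simp add: mvec_def sum_distrib_right mult.assoc)

lemma mvec_add: "mvec n A (\<lambda>i. v i + w i) = (\<lambda>i. mvec n A v i + mvec n A w i)"
  by (simp add: mvec_def distrib_left sum.distrib)

lemma mvec_diff: "mvec n A (\<lambda>i. v i - w i) = (\<lambda>i. mvec n A v i - mvec n A w i)"
  by (simp add: mvec_def right_diff_distrib sum_subtractf)

lemma mvec_qmult:
  assumes "A \<in> qmat (Suc n)"
  shows "mvec n (qmult (Suc n) A B) v = mvec n A (mvec n B v)"
proof
  fix i
  show "mvec n (qmult (Suc n) A B) v i = mvec n A (mvec n B v) i"
  proof (cases "i \<le> n")
    case True
    have "mvec n (qmult (Suc n) A B) v i = (\<Sum>k\<le>n. \<Sum>l\<le>n. A i l * (B l k * v k))"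
      using True by (simp add: mvec_def qmult_Suc sum_distrib_right mult.assoc)
    also have "\<dots> = (\<Sum>l\<le>n. \<Sum>k\<le>n. A i l * (B l k * v k))"
      by (rule sum.swap)
    finally show ?thesis by (simp add: mvec_def sum_distrib_left)
  next
    case False
    then show ?thesis using assms by (simp add: mvec_def qmult_Suc qmat_Suc_iff)
  qed
qed

lemma mvec_qid: "v \<in> qvec n \<Longrightarrow> mvec n (qid (Suc n)) v = v"
  by (rule qvec_eqI[OF mvec_in_qvec])
    (auto simp: mvec_def qid_Suc if_distrib[of "\<lambda>c. c * _"] cong: if_cong)

definition bvec :: "nat \<Rightarrow> nat \<Rightarrow> quat" where
  "bvec j = (\<lambda>i. if i = j then 1 else 0)"

lemma bvec_in_qvec [simp]: "j \<le> n \<Longrightarrow> bvec j \<in> qvec n"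
  by (auto simp: bvec_def qvec_def)

lemma mvec_bvec: "j \<le> n \<Longrightarrow> mvec n A (bvec j) = (\<lambda>i. A i j)"
  by (auto simp: mvec_def bvec_def if_distrib[of "\<lambda>c. _ * c"] cong: if_cong)

lemma qmat_eqI:
  assumes "A \<in> qmat (Suc n)" "B \<in> qmat (Suc n)" "\<And>v. v \<in> qvec n \<Longrightarrow> mvec n A v = mvec n B v"
  shows "A = B"
proof (intro ext)
  fix i j
  show "A i j = B i j"
  proof (cases "j \<le> n")
    case True
    have "mvec n A (bvec j) i = mvec n B (bvec j) i"
      using assms(3)[OF bvec_in_qvec[OF True]] by simp
    then show ?thesis by (simp add: mvec_bvec True)
  next
    case False
    then show ?thesis using assms(1,2) by (simp add: qmat_Suc_iff)
  qed
qed

lemma qmult_assoc: "A \<in> qmat (Suc n) \<Longrightarrow> B \<in> qmat (Suc n) \<Longrightarrow>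
  qmult (Suc n) (qmult (Suc n) A B) C = qmult (Suc n) A (qmult (Suc n) B C)"
  by (rule qmat_eqI[of _ n]) (simp_all add: mvec_qmult)

lemma qmult_qid [simp]: "A \<in> qmat (Suc n) \<Longrightarrow> qmult (Suc n) A (qid (Suc n)) = A"
  "A \<in> qmat (Suc n) \<Longrightarrow> qmult (Suc n) (qid (Suc n)) A = A"
  by (auto intro!: qmat_eqI[of _ n] simp: mvec_qmult mvec_qid)

lemma herm_adj: "herm n (mvec n A x) y = herm n x (mvec n (adj n A) y)"
proof -
  have "herm n (mvec n A x) y = (\<Sum>i\<le>n. \<Sum>k\<le>n. eps n i * (qcnj (x k) * qcnj (A i k) * y i))"
    by (simp add: herm_def mvec_def qcnj_sum sum_distrib_left sum_distrib_right)
  also have "\<dots> = (\<Sum>k\<le>n. \<Sum>i\<le>n. eps n i * (qcnj (x k) * qcnj (A i k) * y i))"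
    by (rule sum.swap)
  also have "\<dots> = (\<Sum>k\<le>n. \<Sum>i\<le>n. eps n k * (qcnj (x k) * (eps n k * qcnj (A i k) * eps n i * y i)))"
    by (intro sum.cong refl) (simp add: eps_def mult.assoc)
  also have "\<dots> = herm n x (mvec n (adj n A) y)"
    by (simp add: herm_def mvec_def adj_def sum_distrib_left)
  finally show ?thesis .
qed

lemma adj_adj [simp]: "A \<in> qmat (Suc n) \<Longrightarrow> adj n (adj n A) = A"
  by (intro ext) (auto simp: adj_def qmat_Suc_iff eps_def)

lemma herm_adj': "A \<in> qmat (Suc n) \<Longrightarrow> herm n (mvec n (adj n A) x) y = herm n x (mvec n A y)"
  by (metis adj_adj herm_adj)

lemma herm_bvec: "j \<le> n \<Longrightarrow> herm n (bvec j) x = eps n j * x j"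
  by (simp add: herm_def bvec_def if_distrib[of qcnj] if_distrib[of "\<lambda>c. c * _"]
      if_distrib[of "\<lambda>c. _ * c"] cong: if_cong)

lemma herm_eqI:
  assumes "x \<in> qvec n" "y \<in> qvec n" "\<And>z. z \<in> qvec n \<Longrightarrow> herm n z x = herm n z y"
  shows "x = y"
proof (rule qvec_eqI[OF assms(1,2)])
  fix i assume "i \<le> n"
  then have "eps n i * (eps n i * x i) = eps n i * (eps n i * y i)"
    using assms(3)[OF bvec_in_qvec, of i] by (simp only: herm_bvec)
  then show "x i = y i" by simp
qed

lemma adj_qmult:
  assumes "A \<in> qmat (Suc n)" "B \<in> qmat (Suc n)"
  shows "adj n (qmult (Suc n) A B) = qmult (Suc n) (adj n B) (adj n A)"
proof (rule qmat_eqI[OF adj_in_qmat qmult_in_qmat])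
  fix v assume "v \<in> qvec n"
  show "mvec n (adj n (qmult (Suc n) A B)) v = mvec n (qmult (Suc n) (adj n B) (adj n A)) v"
    by (rule herm_eqI[of _ n]) (simp_all add: mvec_qmult assms herm_adj[symmetric])
qed

lemma mvec_dyad: "mvec n (dyad n x y) v = (\<lambda>i. x i * herm n y v)"
proof
  fix i
  have "x i * qcnj (y k) * eps n k * v k = x i * (eps n k * (qcnj (y k) * v k))" for k
    by (simp add: eps_def mult.assoc)
  then show "mvec n (dyad n x y) v i = x i * herm n y v"
    by (simp add: mvec_def dyad_def herm_def sum_distrib_left)
qed

lemma qmult_dyad: "A \<in> qmat (Suc n) \<Longrightarrow> x \<in> qvec n \<Longrightarrow> y \<in> qvec n \<Longrightarrow>
  qmult (Suc n) A (dyad n x y) = dyad n (mvec n A x) y"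
  by (rule qmat_eqI[of _ n]) (simp_all add: mvec_qmult mvec_dyad mvec_scale)

lemma dyad_qmult: "A \<in> qmat (Suc n) \<Longrightarrow> x \<in> qvec n \<Longrightarrow> y \<in> qvec n \<Longrightarrow>
  qmult (Suc n) (dyad n x y) A = dyad n x (mvec n (adj n A) y)"
  by (rule qmat_eqI[of _ n]) (simp_all add: mvec_qmult mvec_dyad herm_adj')

lemma adj_dyad: "x \<in> qvec n \<Longrightarrow> y \<in> qvec n \<Longrightarrow> adj n (dyad n x y) = dyad n y x"
  by (intro ext) (auto simp: adj_def dyad_def qvec_def eps_def)

lemma qtrace_dyad: "qtrace (Suc n) (dyad n x y) = (\<Sum>i\<le>n. eps n i * (x i * qcnj (y i)))"
  by (simp add: qtrace_def dyad_def lessThan_Suc_atMost eps_commute)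

section \<open>Sp(n,1) as the isometry group of the form\<close>

lemma qmult_Iform_entry:
  assumes "i \<le> n" "j \<le> n"
  shows "qmult (Suc n) (qmult (Suc n) (qct A) (Iform n)) A i j =
    eps n i * qmult (Suc n) (adj n A) A i j"
proof -
  have *: "qmult (Suc n) (qct A) (Iform n) i k = qcnj (A k i) * eps n k" if "k \<le> n" for k
  proof -
    have "qmult (Suc n) (qct A) (Iform n) i k = (\<Sum>l\<le>n. if l = k then qcnj (A k i) * eps n k else 0)"
      using assms that unfolding qmult_Suc
      by (simp only: simp_thms if_True) (rule sum.cong, auto simp: qct_def Iform_def eps_def)
    then show ?thesis using that by simp
  qed
  show ?thesis
    using assms unfolding qmult_Suc[of _ _ A]
    by (simp add: * adj_def sum_distrib_left mult.assoc)
qed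

lemma Iform_eq_iff:
  "qmult (Suc n) (qmult (Suc n) (qct A) (Iform n)) A = Iform n \<longleftrightarrow>
   qmult (Suc n) (adj n A) A = qid (Suc n)"
proof -
  have I: "Iform n i j = eps n i * qid (Suc n) i j" for i j
    by (auto simp: Iform_def eps_def qid_Suc)
  have inj: "eps n i * a = eps n i * b \<longleftrightarrow> a = b" for i a b
    by (simp add: eps_def)
  have "(\<forall>i j. qmult (Suc n) (qmult (Suc n) (qct A) (Iform n)) A i j = Iform n i j) \<longleftrightarrow>
     (\<forall>i j. qmult (Suc n) (adj n A) A i j = qid (Suc n) i j)" (is "(\<forall>i j. ?P i j) \<longleftrightarrow> (\<forall>i j. ?Q i j)")
  proof -
    have "?P i j \<longleftrightarrow> ?Q i j" for i j
    proof (cases "i \<le> n \<and> j \<le> n")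
      case True
      then show ?thesis by (simp only: qmult_Iform_entry I inj)
    next
      case False
      then show ?thesis by (auto simp: qmult_Suc[of n _ A] I qid_Suc)
    qed
    then show ?thesis by simp
  qed
  then show ?thesis by (simp add: fun_eq_iff)
qed

lemma Sp_n1_iff:
  "A \<in> Sp_n1 n \<longleftrightarrow> A \<in> qmat (Suc n) \<and>
    (\<exists>B\<in>qmat (Suc n). qmult (Suc n) A B = qid (Suc n) \<and> qmult (Suc n) B A = qid (Suc n)) \<and>
    qmult (Suc n) (adj n A) A = qid (Suc n)"
  unfolding Sp_n1_def qGL_def Suc_eq_plus1[symmetric] Iform_eq_iff mem_Collect_eq by (rule conj_assoc)

text \<open>The inverse granted by \<open>qGL\<close> is forced to be the adjoint, which turns the
  one-sided equation \<open>A^* J A = J\<close> into a two-sided one.\<close>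

lemma Sp_n1_eq_isom: "Sp_n1 n = isom n"
proof (intro subset_antisym subsetI)
  fix A assume "A \<in> Sp_n1 n"
  then have A: "A \<in> qmat (Suc n)" and adj: "qmult (Suc n) (adj n A) A = qid (Suc n)"
    and ex: "\<exists>B\<in>qmat (Suc n). qmult (Suc n) A B = qid (Suc n) \<and> qmult (Suc n) B A = qid (Suc n)"
    by (simp_all only: Sp_n1_iff)
  from ex obtain B where B: "B \<in> qmat (Suc n)" and AB: "qmult (Suc n) A B = qid (Suc n)" by metis
  have "adj n A = qmult (Suc n) (adj n A) (qmult (Suc n) A B)"
    by (simp only: AB qmult_qid adj_in_qmat)
  also have "\<dots> = qmult (Suc n) (qmult (Suc n) (adj n A) A) B"
    using A B by (simp only: qmult_assoc adj_in_qmat)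
  also have "\<dots> = B" using B by (simp only: adj qmult_qid)
  finally have "adj n A = B" .
  then show "A \<in> isom n" using A adj AB by (simp only: isom_def mem_Collect_eq simp_thms)
next
  fix A assume "A \<in> isom n"
  then have A: "A \<in> qmat (Suc n)" "qmult (Suc n) (adj n A) A = qid (Suc n)"
     "qmult (Suc n) A (adj n A) = qid (Suc n)"
    by (simp_all only: isom_def mem_Collect_eq)
  show "A \<in> Sp_n1 n"
    unfolding Sp_n1_iff by (intro conjI bexI[of _ "adj n A"] A adj_in_qmat)
qed

lemma isom_qmat: "A \<in> isom n \<Longrightarrow> A \<in> qmat (Suc n)"
  by (simp add: isom_def)

lemma isom_adj: "A \<in> isom n \<Longrightarrow> adj n A \<in> isom n"
  by (simp add: isom_def)

lemma isom_qid: "qid (Suc n) \<in> isom n"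
proof -
  have "adj n (qid (Suc n)) = qid (Suc n)"
    by (intro ext) (auto simp: adj_def qid_Suc eps_def)
  then show ?thesis
    unfolding isom_def mem_Collect_eq by (simp only: qmult_qid qid_in_qmat simp_thms)
qed

lemma mvec_adj_cancel:
  assumes "A \<in> isom n" "v \<in> qvec n"
  shows "mvec n (adj n A) (mvec n A v) = v" "mvec n A (mvec n (adj n A) v) = v"
proof -
  have A: "A \<in> qmat (Suc n)" and 1: "qmult (Suc n) (adj n A) A = qid (Suc n)"
    and 2: "qmult (Suc n) A (adj n A) = qid (Suc n)"
    using assms(1) by (simp_all only: isom_def mem_Collect_eq)
  show "mvec n (adj n A) (mvec n A v) = v"
    unfolding mvec_qmult[OF adj_in_qmat, symmetric] 1 by (rule mvec_qid[OF assms(2)])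
  show "mvec n A (mvec n (adj n A) v) = v"
    unfolding mvec_qmult[OF A, symmetric] 2 by (rule mvec_qid[OF assms(2)])
qed

lemma isom_herm:
  assumes "A \<in> isom n"
  shows "herm n (mvec n A x) (mvec n A y) = herm n x y"
proof -
  have "mvec n (qmult (Suc n) (adj n A) A) y = mvec n (qid (Suc n)) y"
    using assms by (simp add: isom_def)
  then have "herm n (mvec n A x) (mvec n A y) = herm n x (mvec n (qid (Suc n)) y)"
    by (simp add: herm_adj mvec_qmult)
  also have "\<dots> = herm n x y"
    by (rule herm_cong) (simp_all add: mvec_def qid_Suc if_distrib[of "\<lambda>c. c * _"] cong: if_cong)
  finally show ?thesis .
qed

lemma isomI:
  assumes "A \<in> qmat (Suc n)"
    "\<And>v. v \<in> qvec n \<Longrightarrow> mvec n (adj n A) (mvec n A v) = v"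
    "\<And>v. v \<in> qvec n \<Longrightarrow> mvec n A (mvec n (adj n A) v) = v"
  shows "A \<in> isom n"
  unfolding isom_def using assms by (auto intro!: qmat_eqI[of _ n] simp: mvec_qmult mvec_qid)

lemma isom_qmult:
  assumes "A \<in> isom n" "B \<in> isom n"
  shows "qmult (Suc n) A B \<in> isom n"
  using assms by (intro isomI) (simp_all add: isom_qmat adj_qmult mvec_qmult mvec_adj_cancel)

section \<open>Signature of the form\<close>

lemma herm_pos_last_zero:
  assumes "x \<in> qvec n" "x n = 0"
  shows "0 \<le> qRe (herm n x x)" "qRe (herm n x x) = 0 \<Longrightarrow> x = (\<lambda>i. 0)"
proof -
  show "0 \<le> qRe (herm n x x)" by (simp add: qRe_herm_self assms sum_nonneg)
  assume "qRe (herm n x x) = 0"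
  then have "\<forall>i<n. x i = 0"
    by (simp add: qRe_herm_self assms sum_nonneg_eq_0_iff)
  then show "x = (\<lambda>i. 0)" using assms by (auto simp: qvec_def) (metis linorder_neqE_nat)
qed

text \<open>A multiple of \<open>x\<close> brings the last coordinate of \<open>z\<close> to 0,
  where the form is nonnegative. By orthogonality the resulting vector has square
  \<open>herm n z z\<close> plus a nonnegative multiple of \<open>herm n x x\<close>, so the latter
  has to outweigh a negative number.\<close>

lemma herm_pos_orth:
  assumes z: "z \<in> qvec n" "qRe (herm n z z) < 0" and x: "x \<in> qvec n" "herm n z x = 0" "x \<noteq> (\<lambda>i. 0)"
  shows "0 < qRe (herm n x x)"
proof (cases "x n = 0")
  case True
  then show ?thesis using herm_pos_last_zero[OF x(1) True] x(3) by linarith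
next
  case False
  define t where "t = inverse (x n) * z n"
  define y where "y = (\<lambda>i. z i - x i * t)"
  have y: "y \<in> qvec n" "y n = 0" using z(1) x(1) False by (simp_all add: y_def t_def mult.assoc[symmetric])
  have xz: "herm n x z = 0" using x by (simp add: herm_zero_sym)
  have "herm n y y = herm n z z + qcnj t * herm n x x * t"
    unfolding y_def herm_lin by (simp add: x(2) xz)
  also have "qcnj t * herm n x x * t = of_real (qRe (herm n x x)) * (qcnj t * t)"
    by (subst herm_self_qRe) (simp only: of_real_commute_quat[of _ "qcnj t", symmetric] mult.assoc)
  also have "\<dots> = of_real (qRe (herm n x x) * (norm t)\<^sup>2)"
    by (simp add: qcnj_mult_self)
  finally have "qRe (herm n y y) = qRe (herm n z z) + qRe (herm n x x) * (norm t)\<^sup>2"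
    by (simp del: of_real_mult)
  with herm_pos_last_zero(1)[OF y] z(2) have "0 < qRe (herm n x x) * (norm t)\<^sup>2" by linarith
  then show ?thesis by (simp add: zero_less_mult_iff)
qed

text \<open>The combination of \<open>x\<close> and \<open>y\<close> with last coordinate 0 is
  isotropic by orthogonality, and on such vectors the form is definite.\<close>

lemma null_orth_parallel:
  assumes x: "x \<in> qvec n" "herm n x x = 0" and y: "y \<in> qvec n" "herm n y y = 0"
    and xy: "herm n x y = 0" and x0: "x n \<noteq> 0"
  shows "y = (\<lambda>i. x i * (inverse (x n) * y n))"
proof -
  define t where "t = inverse (x n) * y n"
  define z where "z = (\<lambda>i. y i - x i * t)"
  have "x n * t = y n" unfolding t_def mult.assoc[symmetric] using x0 by simp
  then have z: "z \<in> qvec n" "z n = 0" using x(1) y(1) by (simp_all add: z_def)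
  have yx: "herm n y x = 0" using xy by (rule herm_zero_sym)
  have "herm n z z = 0" unfolding z_def herm_lin by (simp add: x(2) y(2) xy yx)
  then have "z = (\<lambda>i. 0)" using herm_pos_last_zero(2)[OF z] by simp
  then have "y i - x i * t = 0" for i by (simp add: z_def fun_eq_iff)
  then show ?thesis unfolding t_def[symmetric] by (intro ext) simp
qed

lemma null_last_nonzero:
  assumes "x \<in> qvec n" "herm n x x = 0" "x \<noteq> (\<lambda>i. 0)"
  shows "x n \<noteq> 0"
  using herm_pos_last_zero[of x n] assms by auto

section \<open>Limits of isometries\<close>

lemma herm_scaleR_right: "herm n x (\<lambda>i. r *\<^sub>R y i) = r *\<^sub>R herm n x y"
  by (simp add: herm_def scaleR_sum_right)

lemma herm_scaleR_left: "herm n (\<lambda>i. r *\<^sub>R x i) y = r *\<^sub>R herm n x y"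
proof -
  have "qcnj (r *\<^sub>R q) = r *\<^sub>R qcnj q" for q by (simp add: quat_eq_iff)
  then show ?thesis by (simp add: herm_def scaleR_sum_right)
qed

lemma mvec_scaleR: "mvec n A (\<lambda>i. r *\<^sub>R v i) = (\<lambda>i. r *\<^sub>R mvec n A v i)"
  by (simp add: mvec_def scaleR_sum_right)

lemma qvec_scaleR [simp]: "x \<in> qvec n \<Longrightarrow> (\<lambda>i. r *\<^sub>R x i) \<in> qvec n"
  by (simp add: qvec_def)

lemma tendsto_herm:
  assumes "\<And>i. ((\<lambda>k. X k i) \<longlongrightarrow> x i) F" "\<And>i. ((\<lambda>k. Y k i) \<longlongrightarrow> y i) F"
  shows "((\<lambda>k. herm n (X k) (Y k)) \<longlongrightarrow> herm n x y) F"
  unfolding herm_def by (intro tendsto_intros assms)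

lemma tendsto_mvec:
  assumes "\<And>i j. ((\<lambda>k. A k i j) \<longlongrightarrow> B i j) F"
  shows "((\<lambda>k. mvec n (A k) v i) \<longlongrightarrow> mvec n B v i) F"
  unfolding mvec_def by (intro tendsto_intros assms)

lemma isom_column_norm:
  assumes A: "A \<in> isom n" and j: "j \<le> n"
  shows "(\<Sum>i<n. (norm (A i j))\<^sup>2) = (norm (A n j))\<^sup>2 + (if j = n then -1 else 1)"
proof -
  have "herm n (\<lambda>i. A i j) (\<lambda>i. A i j) = herm n (bvec j) (bvec j)"
    using isom_herm[OF A, of "bvec j" "bvec j"] by (simp only: mvec_bvec[OF j])
  also have "\<dots> = eps n j" using j by (simp add: herm_bvec) (simp add: bvec_def)
  finally have "qRe (herm n (\<lambda>i. A i j) (\<lambda>i. A i j)) = qRe (eps n j)" by (rule arg_cong)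
  then show ?thesis unfolding qRe_herm_self by (simp add: eps_def split: if_splits)
qed

lemma isom_row_norm:
  assumes A: "A \<in> isom n" and i: "i \<le> n"
  shows "(\<Sum>j<n. (norm (A i j))\<^sup>2) = (norm (A i n))\<^sup>2 + (if i = n then -1 else 1)"
proof -
  have e: "norm (adj n A j i) = norm (A i j)" if "j \<le> n" for j
    using i that by (simp add: adj_def norm_mult)
  show ?thesis using isom_column_norm[OF isom_adj[OF A] i] by (simp add: e)
qed

lemma isom_corner_ge_1: "A \<in> isom n \<Longrightarrow> 1 \<le> norm (A n n)"
proof -
  assume "A \<in> isom n"
  from isom_column_norm[OF this, of n] have "(norm (A n n))\<^sup>2 = 1 + (\<Sum>i<n. (norm (A i n))\<^sup>2)" by simp
  then have "1 \<le> (norm (A n n))\<^sup>2" by (simp add: sum_nonneg)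
  then show ?thesis by (simp add: power2_nonneg_ge_1_iff)
qed

text \<open>This lets one entry measure divergence in the group. The last row and column are bounded
  by the corner with a slack of 1 in the squares; any other entry satisfies
  \<open>|A i j|^2 \<le> 1 + |A i n|^2\<close>, which uses up exactly that slack.\<close>

lemma isom_entry_le_corner:
  assumes A: "A \<in> isom n"
  shows "norm (A i j) \<le> norm (A n n)"
proof (cases "i \<le> n \<and> j \<le> n")
  case False
  then have "A i j = 0" using isom_qmat[OF A] by (auto simp: qmat_Suc_iff)
  then show ?thesis by simp
next
  case True
  have m: "(f k)\<^sup>2 \<le> (\<Sum>k<n. (f k)\<^sup>2)" if "k < n" for k and f :: "nat \<Rightarrow> real"
    using that by (intro member_le_sum) auto
  have col: "(norm (A i n))\<^sup>2 \<le> (norm (A n n))\<^sup>2 - 1" if "i < n" for i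
    using m[OF that, of "\<lambda>i. norm (A i n)"] isom_column_norm[OF A, of n] by simp
  have row: "(norm (A n j))\<^sup>2 \<le> (norm (A n n))\<^sup>2 - 1" if "j < n" for j
    using m[OF that, of "\<lambda>j. norm (A n j)"] isom_row_norm[OF A, of n] by simp
  have inner: "(norm (A i j))\<^sup>2 \<le> 1 + (norm (A i n))\<^sup>2" if "i < n" "j < n" for i j
    using m[OF that(2), of "\<lambda>j. norm (A i j)"] isom_row_norm[OF A, of i] that(1) by simp
  have "(norm (A i j))\<^sup>2 \<le> (norm (A n n))\<^sup>2"
  proof (cases "i = n")
    case True
    show ?thesis
    proof (cases "j = n")
      case False
      then have "(norm (A n j))\<^sup>2 \<le> (norm (A n n))\<^sup>2 - 1" using row[of j] \<open>i \<le> n \<and> j \<le> n\<close> by simp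
      then show ?thesis unfolding \<open>i = n\<close> by linarith
    qed (simp add: \<open>i = n\<close>)
  next
    case False
    then have "i < n" using True by simp
    then have c: "(norm (A i n))\<^sup>2 \<le> (norm (A n n))\<^sup>2 - 1" by (rule col)
    show ?thesis
    proof (cases "j = n")
      case True
      show ?thesis unfolding True using c by linarith
    next
      case False
      then have "(norm (A i j))\<^sup>2 \<le> 1 + (norm (A i n))\<^sup>2" using inner[OF \<open>i < n\<close>] True by simp
      then show ?thesis using c by linarith
    qed
  qed
  then show ?thesis by (rule power2_le_imp_le) simp
qed

section \<open>Compactness of rescaled isometries\<close>

lemma finite_family_convergent_subseq:
  fixes f :: "nat \<Rightarrow> 'a \<Rightarrow> 'b::heine_borel"
  assumes "finite S" "\<And>s. s \<in> S \<Longrightarrow> bounded (range (\<lambda>k. f k s))"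
  shows "\<exists>r. strict_mono (r :: nat \<Rightarrow> nat) \<and> (\<forall>s\<in>S. \<exists>l. (\<lambda>k. f (r k) s) \<longlonglongrightarrow> l)"
  using assms
proof (induction S rule: finite_induct)
  case empty
  show ?case by (intro exI[of _ id]) (simp add: strict_mono_def)
next
  case (insert a S)
  then obtain r where r: "strict_mono (r :: nat \<Rightarrow> nat)" "\<forall>s\<in>S. \<exists>l. (\<lambda>k. f (r k) s) \<longlonglongrightarrow> l"
    by auto
  have "bounded (range (\<lambda>k. f (r k) a))"
    using insert.prems[of a] by (rule bounded_subset) auto
  from bounded_imp_convergent_subsequence[OF this]
  obtain l r' where r': "strict_mono (r' :: nat \<Rightarrow> nat)" "((\<lambda>k. f (r k) a) \<circ> r') \<longlonglongrightarrow> l" by blast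
  show ?case
  proof (intro exI[of _ "r \<circ> r'"] conjI ballI)
    show "strict_mono (r \<circ> r')" by (rule strict_mono_o[OF r(1) r'(1)])
    fix s assume "s \<in> insert a S"
    then show "\<exists>l. (\<lambda>k. f ((r \<circ> r') k) s) \<longlonglongrightarrow> l"
    proof
      assume "s = a"
      then show ?thesis using r'(2) by (auto simp: o_def)
    next
      assume "s \<in> S"
      then obtain l where "(\<lambda>k. f (r k) s) \<longlonglongrightarrow> l" using r(2) by blast
      from LIMSEQ_subseq_LIMSEQ[OF this r'(1)] show ?thesis by (auto simp: o_def)
    qed
  qed
qed

lemma bounded_matrices_convergent_subseq:
  assumes "\<And>k. X k \<in> qmat (Suc n)" "\<And>k i j. norm (X k i j) \<le> b"
  obtains r E where "strict_mono (r :: nat \<Rightarrow> nat)" "E \<in> qmat (Suc n)"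
    "\<And>i j. (\<lambda>k. X (r k) i j) \<longlonglongrightarrow> E i j"
proof -
  have "\<exists>r. strict_mono (r :: nat \<Rightarrow> nat) \<and>
     (\<forall>s\<in>{..n} \<times> {..n}. \<exists>l. (\<lambda>k. (\<lambda>k (i, j). X k i j) (r k) s) \<longlonglongrightarrow> l)"
  proof (rule finite_family_convergent_subseq)
    fix s :: "nat \<times> nat"
    show "bounded (range (\<lambda>k. (\<lambda>k (i, j). X k i j) k s))"
      using assms(2) by (intro boundedI[of _ b]) (auto simp: case_prod_unfold)
  qed simp
  then obtain r where r: "strict_mono (r :: nat \<Rightarrow> nat)"
    and ex: "\<And>i j. i \<le> n \<Longrightarrow> j \<le> n \<Longrightarrow> \<exists>l. (\<lambda>k. X (r k) i j) \<longlonglongrightarrow> l"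
    by fastforce
  have ex': "\<exists>l. (\<lambda>k. X (r k) i j) \<longlonglongrightarrow> l" for i j
  proof (cases "i \<le> n \<and> j \<le> n")
    case False
    then have "(\<lambda>k. X (r k) i j) = (\<lambda>k. 0)" using assms(1) by (auto simp: qmat_Suc_iff)
    then show ?thesis by (intro exI[of _ 0]) simp
  qed (use ex in simp)
  define E where "E = (\<lambda>i j. lim (\<lambda>k. X (r k) i j))"
  have E: "(\<lambda>k. X (r k) i j) \<longlonglongrightarrow> E i j" for i j
    using ex'[of i j] unfolding E_def by (auto simp: limI)
  have "E i j = 0" if "n < i \<or> n < j" for i j
  proof -
    have "(\<lambda>k. X (r k) i j) = (\<lambda>k. 0)" using assms(1) that by (auto simp: qmat_Suc_iff)
    then show ?thesis using E[of i j] by (simp add: LIMSEQ_const_iff)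
  qed
  then show ?thesis using that[OF r _ E] by (simp add: qmat_Suc_iff)
qed

text \<open>Division by the corner entry bounds all entries. In the limit \<open>g^* J g = J\<close>
  becomes \<open>E^* J E = 0\<close>, so the columns of \<open>E\<close> are isotropic and mutually
  orthogonal, hence right multiples of the last one: \<open>E\<close> has rank one. Its normalised
  last column is also the limit of the images of the origin, which ties \<open>x\<close> to a
  boundary point.\<close>

lemma isom_unbounded_limit:
  assumes g: "\<And>k. g k \<in> isom n" and inf: "filterlim (\<lambda>k. norm (g k n n)) at_top sequentially"
  obtains r x y where "strict_mono (r :: nat \<Rightarrow> nat)" "x \<in> qvec n" "y \<in> qvec n"
    "herm n x x = 0" "herm n y y = 0" "x n = 1" "y n \<noteq> 0"
    "\<And>i j. (\<lambda>k. (1 / norm (g (r k) n n)) *\<^sub>R g (r k) i j) \<longlonglongrightarrow> dyad n x y i j"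
    "\<And>i. (\<lambda>k. g (r k) i n * inverse (g (r k) n n)) \<longlonglongrightarrow> x i"
proof -
  define M where "M k = norm (g k n n)" for k
  have M: "1 \<le> M k" for k unfolding M_def by (rule isom_corner_ge_1[OF g])
  define f where "f k = (\<lambda>i j. (1 / M k) *\<^sub>R g k i j)" for k
  have fq: "f k \<in> qmat (Suc n)" for k using isom_qmat[OF g[of k]] by (auto simp: f_def qmat_Suc_iff)
  have fb: "norm (f k i j) \<le> 1" for k i j
  proof -
    have "norm (f k i j) = norm (g k i j) / M k" using M[of k] by (simp add: f_def)
    also have "\<dots> \<le> 1" using isom_entry_le_corner[OF g[of k], of i j] M[of k] by (simp add: M_def divide_le_eq_1)
    finally show ?thesis .
  qed
  obtain r E where r: "strict_mono (r :: nat \<Rightarrow> nat)" and Eq: "E \<in> qmat (Suc n)"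
    and E: "\<And>i j. (\<lambda>k. f (r k) i j) \<longlonglongrightarrow> E i j"
    by (rule bounded_matrices_convergent_subseq[of f n 1]) (simp_all only: fq fb)
  have Minf: "filterlim (\<lambda>k. M (r k)) at_top sequentially"
    using filterlim_compose[OF inf filterlim_subseq[OF r]] by (simp add: M_def)
  have M0: "(\<lambda>k. 1 / M (r k)) \<longlonglongrightarrow> 0"
    using tendsto_inverse_0_at_top[OF Minf] by (simp add: inverse_eq_divide)
  have "(\<lambda>k. norm (f (r k) n n)) \<longlonglongrightarrow> norm (E n n)" by (intro tendsto_intros E)
  moreover have "norm (f k n n) = 1" for k using M[of k] by (simp add: f_def M_def[symmetric])
  ultimately have En: "norm (E n n) = 1" by (simp add: LIMSEQ_const_iff)
  then have En0: "E n n \<noteq> 0" by auto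
  have cols: "herm n (\<lambda>l. E l i) (\<lambda>l. E l j) = 0" if "i \<le> n" "j \<le> n" for i j
  proof -
    have "herm n (\<lambda>l. f k l i) (\<lambda>l. f k l j) = (1 / M k) *\<^sub>R (1 / M k) *\<^sub>R herm n (bvec i) (bvec j)" for k
    proof -
      have "herm n (\<lambda>l. f k l i) (\<lambda>l. f k l j) =
          (1 / M k) *\<^sub>R (1 / M k) *\<^sub>R herm n (\<lambda>l. g k l i) (\<lambda>l. g k l j)"
        unfolding f_def herm_scaleR_left herm_scaleR_right by (rule refl)
      also have "herm n (\<lambda>l. g k l i) (\<lambda>l. g k l j) = herm n (bvec i) (bvec j)"
        using isom_herm[OF g, of k "bvec i" "bvec j"] by (simp only: mvec_bvec that)
      finally show ?thesis .
    qed
    moreover have "(\<lambda>k. herm n (\<lambda>l. f (r k) l i) (\<lambda>l. f (r k) l j)) \<longlonglongrightarrow> herm n (\<lambda>l. E l i) (\<lambda>l. E l j)"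
      by (intro tendsto_herm E)
    moreover have "(\<lambda>k. (1 / M (r k)) *\<^sub>R (1 / M (r k)) *\<^sub>R herm n (bvec i) (bvec j))
        \<longlonglongrightarrow> 0 *\<^sub>R 0 *\<^sub>R herm n (bvec i) (bvec j)"
      by (intro tendsto_intros M0)
    ultimately show ?thesis using LIMSEQ_unique by fastforce
  qed
  define x where "x = (\<lambda>i. E i n * inverse (E n n))"
  \<comment> \<open>As \<open>x n = 1\<close>, the last row of \<open>dyad n x y\<close> is
    \<open>y^* J\<close>; this reads \<open>y\<close> off the last row of \<open>E\<close>.\<close>
  define y where "y = (\<lambda>j. eps n j * qcnj (E n j))"
  have Ecol: "(\<lambda>l. E l j) \<in> qvec n" for j using Eq by (simp add: qmat_Suc_iff qvec_def)
  have Exy: "E = dyad n x y"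
  proof (intro ext)
    fix i j
    show "E i j = dyad n x y i j"
    proof (cases "j \<le> n")
      case True
      have "(\<lambda>l. E l j) = (\<lambda>l. E l n * (inverse (E n n) * E n j))"
        using null_orth_parallel[OF Ecol cols Ecol cols cols, of n j] En0 True by simp
      then have "E i j = E i n * (inverse (E n n) * E n j)" by (rule fun_cong)
      also have "E n j = qcnj (y j) * eps n j" by (simp add: y_def eps_def)
      also have "E i n * (inverse (E n n) * (qcnj (y j) * eps n j)) = dyad n x y i j"
        by (simp only: dyad_def x_def mult.assoc)
      finally show ?thesis .
    next
      case False
      then show ?thesis using Eq by (simp add: dyad_def y_def qmat_Suc_iff)
    qed
  qed
  have yy: "herm n y y = 0"
  proof -
    \<comment> \<open>The last row of an isometry satisfies the same norm identity as its last
      column, so its rescaled version has square \<open>-1/M^2\<close>, which tends to 0.\<close>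
    define Y where "Y k = (\<lambda>j. eps n j * qcnj (f k n j))" for k
    have "herm n (Y k) (Y k) = of_real (- (1 / M k)\<^sup>2)" for k
    proof -
      have e: "norm (Y k j) = (1 / M k) * norm (g k n j)" for j
        using M[of k] by (simp add: Y_def norm_mult f_def)
      have s: "(\<Sum>i<n. (norm (g k n i))\<^sup>2) - (norm (g k n n))\<^sup>2 = -1"
        using isom_row_norm[OF g[of k], of n] by simp
      have "(\<Sum>i<n. (norm (Y k i))\<^sup>2) - (norm (Y k n))\<^sup>2 =
          (1 / M k)\<^sup>2 * ((\<Sum>i<n. (norm (g k n i))\<^sup>2) - (norm (g k n n))\<^sup>2)"
        unfolding e power_mult_distrib sum_distrib_left[symmetric] by (simp add: right_diff_distrib)
      then show ?thesis unfolding herm_self s by simp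
    qed
    moreover have "(\<lambda>k. herm n (Y (r k)) (Y (r k))) \<longlonglongrightarrow> herm n y y"
      unfolding Y_def y_def by (intro tendsto_herm tendsto_intros E)
    moreover have "(\<lambda>k. of_real (- (1 / M (r k))\<^sup>2) :: quat) \<longlonglongrightarrow> of_real (- 0\<^sup>2)"
      by (intro tendsto_intros M0)
    ultimately show ?thesis using LIMSEQ_unique by fastforce
  qed
  show thesis
  proof (rule that[OF r])
    show "x \<in> qvec n" unfolding x_def by (intro qvec_scale Ecol)
    show "y \<in> qvec n" using Eq by (simp add: y_def qvec_def qmat_Suc_iff)
    show "herm n x x = 0" unfolding x_def herm_lin by (simp add: cols)
    show "herm n y y = 0" by (rule yy)
    show "x n = 1" "y n \<noteq> 0" using En0 by (simp_all add: x_def y_def eps_def)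
    show "(\<lambda>k. (1 / norm (g (r k) n n)) *\<^sub>R g (r k) i j) \<longlonglongrightarrow> dyad n x y i j" for i j
      using E[of i j] by (simp add: f_def M_def Exy)
    have "(\<lambda>k. f (r k) i n * inverse (f (r k) n n)) \<longlonglongrightarrow> x i" for i
      unfolding x_def by (intro tendsto_intros E En0)
    moreover have "f k i n * inverse (f k n n) = g k i n * inverse (g k n n)" for k i
      using M[of k] by (simp add: f_def inverse_scaleR_distrib)
    ultimately show "(\<lambda>k. g (r k) i n * inverse (g (r k) n n)) \<longlonglongrightarrow> x i" for i by simp
  qed
qed

section \<open>Limit points as limits of last columns\<close>

lemma hyp_act_zero: "hyp_act n A (\<lambda>_. 0) = (\<lambda>i. if i < n then A i n * inverse (A n n) else 0)"
proof -
  have "(\<Sum>k<n + 1. A i k * (if k < n then 0 else if k = n then 1 else 0)) = A i n" for i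
  proof -
    have "(\<Sum>k<n. A i k * (if k < n then 0 else if k = n then 1 else 0)) = 0"
      by (rule sum.neutral) simp
    then show ?thesis by simp
  qed
  then show ?thesis by (simp only: hyp_act_def Let_def)
qed

text \<open>The image of the origin has squared norm \<open>1 - 1/|g n n|^2\<close>, so an orbit
  approaches the unit sphere only if the corner entry diverges. \<open>\<xi>(n := 1)\<close> is the
  isotropic lift of the boundary point \<open>\<xi>\<close>.\<close>

lemma limit_set_sequence:
  assumes "\<xi> \<in> limit_set n \<Gamma>" "\<Gamma> \<subseteq> isom n"
  obtains g where "\<And>k. g k \<in> \<Gamma>" "filterlim (\<lambda>k. norm (g k n n)) at_top sequentially"
    "\<And>i. (\<lambda>k. g k i n * inverse (g k n n)) \<longlonglongrightarrow> (\<xi>(n := 1)) i"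
proof -
  from assms(1) obtain g where \<xi>: "\<forall>i\<ge>n. \<xi> i = 0" "qvec_norm2 n \<xi> = 1" and g: "\<And>k. g k \<in> \<Gamma>"
    and lim: "(\<lambda>k. \<Sum>i<n. qnorm (hyp_act n (g k) (\<lambda>_. 0) i - \<xi> i)) \<longlonglongrightarrow> 0"
    unfolding limit_set_def mem_Collect_eq by blast
  have gi: "g k \<in> isom n" for k using g assms(2) by blast
  have g0: "g k n n \<noteq> 0" for k using isom_corner_ge_1[OF gi[of k]] by auto
  have lt: "(\<lambda>k. g k i n * inverse (g k n n)) \<longlonglongrightarrow> \<xi> i" if "i < n" for i
  proof -
    have "(\<lambda>k. g k i n * inverse (g k n n) - \<xi> i) \<longlonglongrightarrow> 0"
    proof (rule Lim_null_comparison[OF _ lim], rule always_eventually, rule allI)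
      fix k
      have "norm (g k i n * inverse (g k n n) - \<xi> i) = qnorm (hyp_act n (g k) (\<lambda>_. 0) i - \<xi> i)"
        using that by (simp add: hyp_act_zero norm_quat_def)
      also have "\<dots> \<le> (\<Sum>i<n. qnorm (hyp_act n (g k) (\<lambda>_. 0) i - \<xi> i))"
        using that by (intro member_le_sum) (auto simp: norm_quat_def[symmetric])
      finally show "norm (g k i n * inverse (g k n n) - \<xi> i) \<le>
         (\<Sum>i<n. qnorm (hyp_act n (g k) (\<lambda>_. 0) i - \<xi> i))" .
    qed
    then show ?thesis by (simp add: LIM_zero_iff)
  qed
  have "(\<lambda>k. \<Sum>i<n. (norm (g k i n * inverse (g k n n)))\<^sup>2) \<longlonglongrightarrow> (\<Sum>i<n. (norm (\<xi> i))\<^sup>2)"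
    by (intro tendsto_intros) (use lt in simp)
  moreover have "(\<Sum>i<n. (norm (\<xi> i))\<^sup>2) = 1"
    using \<xi>(2) by (simp add: qvec_norm2_def norm_quat_def)
  moreover have "(\<Sum>i<n. (norm (g k i n * inverse (g k n n)))\<^sup>2) = 1 - (inverse (norm (g k n n)))\<^sup>2" for k
  proof -
    have "(\<Sum>i<n. (norm (g k i n * inverse (g k n n)))\<^sup>2) =
      (\<Sum>i<n. (norm (g k i n))\<^sup>2) * (inverse (norm (g k n n)))\<^sup>2"
      by (simp add: norm_mult norm_inverse power_mult_distrib sum_distrib_right)
    then show ?thesis using isom_column_norm[OF gi[of k], of n] g0[of k]
      by (simp add: left_diff_distrib power_mult_distrib[symmetric])
  qed
  ultimately have "(\<lambda>k. 1 - (inverse (norm (g k n n)))\<^sup>2) \<longlonglongrightarrow> 1" by simp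
  then have "(\<lambda>k. 1 - (1 - (inverse (norm (g k n n)))\<^sup>2)) \<longlonglongrightarrow> 1 - 1" by (intro tendsto_intros)
  then have "(\<lambda>k. sqrt ((inverse (norm (g k n n)))\<^sup>2)) \<longlonglongrightarrow> sqrt 0"
    by (intro tendsto_real_sqrt) simp
  then have "(\<lambda>k. inverse (norm (g k n n))) \<longlonglongrightarrow> 0" by simp
  then have "filterlim (\<lambda>k. inverse (inverse (norm (g k n n)))) at_top sequentially"
    using g0 by (intro filterlim_inverse_at_top) simp_all
  then have inf: "filterlim (\<lambda>k. norm (g k n n)) at_top sequentially" by simp
  show thesis
  proof (rule that[OF g inf])
    fix i
    consider "i < n" | "i = n" | "n < i" by linarith
    then show "(\<lambda>k. g k i n * inverse (g k n n)) \<longlonglongrightarrow> (\<xi>(n := 1)) i"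
    proof cases
      case 3
      then have "g k i n = 0" for k using isom_qmat[OF gi[of k]] by (simp add: qmat_Suc_iff)
      then show ?thesis using \<xi>(1) 3 by simp
    qed (use lt g0 in simp_all)
  qed
qed

lemma limit_set_null:
  assumes "\<xi> \<in> limit_set n \<Gamma>"
  shows "\<xi>(n := 1) \<in> qvec n" "herm n (\<xi>(n := 1)) (\<xi>(n := 1)) = 0"
proof -
  have \<xi>: "\<forall>i\<ge>n. \<xi> i = 0" "qvec_norm2 n \<xi> = 1"
    using assms unfolding limit_set_def by simp_all
  show "\<xi>(n := 1) \<in> qvec n" using \<xi>(1) by (simp add: qvec_def)
  show "herm n (\<xi>(n := 1)) (\<xi>(n := 1)) = 0"
    using \<xi>(2) by (simp add: herm_self_eq_0 qvec_norm2_def norm_quat_def[symmetric])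
qed

lemma limit_set_lift_inj:
  assumes "\<xi> \<in> limit_set n \<Gamma>" "\<eta> \<in> limit_set n \<Gamma>" "\<xi>(n := 1) = \<eta>(n := (1::quat))"
  shows "\<xi> = \<eta>"
proof
  fix i
  have "\<xi> n = 0" "\<eta> n = 0" using assms(1,2) unfolding limit_set_def by simp_all
  then show "\<xi> i = \<eta> i" using fun_cong[OF assms(3), of i] by (simp split: if_splits)
qed

section \<open>Extension of orthonormal families\<close>

text \<open>The map is \<open>1 - z c z^* J\<close>. Its adjoint has \<open>qcnj c\<close> in place
  of \<open>c\<close>, and the two hypotheses say that the products of the two maps in either order
  are the identity.\<close>

lemma isom_reflection:
  assumes z: "z \<in> qvec n" and c: "c + qcnj c = c * herm n z z * qcnj c" "c + qcnj c = qcnj c * herm n z z * c"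
  obtains R where "R \<in> isom n" "\<And>v. v \<in> qvec n \<Longrightarrow> mvec n R v = (\<lambda>i. v i - z i * (c * herm n z v))"
proof -
  define R where "R c = (\<lambda>i j. qid (Suc n) i j - dyad n (\<lambda>i. z i * c) z i j)" for c
  have Rq: "R c \<in> qmat (Suc n)" for c
    using qid_in_qmat[of n] dyad_in_qmat[OF qvec_scale[OF z] z, of c] by (simp add: R_def qmat_Suc_iff)
  have Rv: "mvec n (R c) v = (\<lambda>i. v i - z i * (c * herm n z v))" if "v \<in> qvec n" for c v
  proof
    fix i
    have "mvec n (R c) v i = mvec n (qid (Suc n)) v i - mvec n (dyad n (\<lambda>i. z i * c) z) v i"
      unfolding mvec_def R_def by (simp add: left_diff_distrib sum_subtractf)
    then show "mvec n (R c) v i = v i - z i * (c * herm n z v)"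
      by (simp add: mvec_qid[OF that] mvec_dyad mult.assoc)
  qed
  have Radj: "adj n (R c) = R (qcnj c)"
  proof (rule qmat_eqI[OF adj_in_qmat Rq])
    fix v assume v: "v \<in> qvec n"
    show "mvec n (adj n (R c)) v = mvec n (R (qcnj c)) v"
    proof (rule herm_eqI[OF mvec_in_qvec[OF adj_in_qmat] mvec_in_qvec[OF Rq]])
      fix u assume u: "u \<in> qvec n"
      show "herm n u (mvec n (adj n (R c)) v) = herm n u (mvec n (R (qcnj c)) v)"
        unfolding herm_adj[symmetric] Rv[OF u] Rv[OF v] herm_lin
        by (simp add: qcnj_herm mult.assoc)
    qed
  qed
  have canc: "mvec n (R a) (mvec n (R b) v) = v"
    if v: "v \<in> qvec n" and ab: "a + b = a * herm n z z * b" for a b v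
  proof -
    have "mvec n (R a) (mvec n (R b) v) = (\<lambda>i. mvec n (R b) v i - z i * (a * herm n z (mvec n (R b) v)))"
      by (rule Rv[OF mvec_in_qvec[OF Rq]])
    also have "\<dots> = (\<lambda>i. v i - z i * ((a + b - a * herm n z z * b) * herm n z v))"
      unfolding Rv[OF v] herm_lin by (simp add: algebra_simps)
    also have "\<dots> = v" using ab by simp
    finally show ?thesis .
  qed
  show thesis
  proof (rule that[OF _ Rv])
    show "R c \<in> isom n"
    proof (rule isomI[OF Rq])
      fix v assume v: "v \<in> qvec n"
      show "mvec n (adj n (R c)) (mvec n (R c) v) = v"
        unfolding Radj by (rule canc[OF v]) (use c(2) in \<open>simp add: add.commute\<close>)
      show "mvec n (R c) (mvec n (adj n (R c)) v) = v"
        unfolding Radj by (rule canc[OF v c(1)])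
    qed
  qed
qed

text \<open>The reflection along \<open>x - y\<close>. If \<open>x - y\<close> is orthogonal to \<open>x\<close> it is isotropic, and the
  last hypothesis forces it to vanish.\<close>
lemma isom_transitive:
  assumes x: "x \<in> qvec n" and y: "y \<in> qvec n" and xy: "herm n x x = herm n y y"
    and last: "herm n (\<lambda>i. x i - y i) x = 0 \<Longrightarrow> x n = y n"
  obtains R where "R \<in> isom n" "mvec n R x = y"
    "\<And>v. v \<in> qvec n \<Longrightarrow> herm n (\<lambda>i. x i - y i) v = 0 \<Longrightarrow> mvec n R v = v"
proof (cases "herm n (\<lambda>i. x i - y i) x = 0")
  case True
  define z where "z = (\<lambda>i. x i - y i)"
  have zx: "herm n z x = 0" using True by (simp add: z_def)
  have s: "herm n z z = herm n z x + qcnj (herm n z x)"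
    unfolding z_def qcnj_herm herm_diff_left herm_diff_right by (simp add: qcnj_herm xy)
  have "z = (\<lambda>i. 0)"
    by (rule herm_pos_last_zero(2)[of _ n]) (use x y last[OF True] s zx in \<open>simp_all add: z_def\<close>)
  then have "x = y" by (simp add: z_def fun_eq_iff)
  then show thesis using that[OF isom_qid] by (simp add: mvec_qid y)
next
  case False
  define z where "z = (\<lambda>i. x i - y i)"
  define w where "w = herm n z x"
  \<comment> \<open>With this coefficient \<open>x\<close> is sent to \<open>x - z = y\<close>.
    Since \<open>x\<close> and \<open>y\<close> have the same square,
    \<open>herm n z z = w + qcnj w\<close>, and this is what the two conditions of
    \<open>isom_reflection\<close> amount to.\<close>
  define c where "c = inverse w"
  have w0: "w \<noteq> 0" using False by (simp add: w_def z_def)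
  have z: "z \<in> qvec n" using x y by (simp add: z_def)
  have s: "herm n z z = w + qcnj w"
    unfolding z_def w_def qcnj_herm herm_diff_left herm_diff_right by (simp add: qcnj_herm xy)
  have cw: "c * w = 1" "w * c = 1" using w0 by (simp_all add: c_def)
  have cw': "qcnj w * qcnj c = 1" "qcnj c * qcnj w = 1"
    unfolding qcnj_simps(7)[symmetric] cw by simp_all
  have 1: "c * herm n z z * qcnj c = qcnj c + c"
    unfolding s distrib_left distrib_right cw mult.assoc cw' by simp
  have 2: "qcnj c * herm n z z * c = qcnj c + c"
    unfolding s distrib_left distrib_right cw' mult.assoc cw
    by (simp add: mult.assoc[symmetric] cw')
  obtain R where R: "R \<in> isom n" "\<And>v. v \<in> qvec n \<Longrightarrow> mvec n R v = (\<lambda>i. v i - z i * (c * herm n z v))"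
    using isom_reflection[OF z, of c] 1 2 by (metis add.commute)
  show thesis
  proof (rule that[OF R(1)])
    show "mvec n R x = y" unfolding R(2)[OF x] w_def[symmetric] cw by (simp add: z_def)
    fix v assume "v \<in> qvec n" "herm n (\<lambda>i. x i - y i) v = 0"
    then show "mvec n R v = v" by (simp add: R(2) z_def)
  qed
qed

text \<open>An extension theorem of Witt type. The family is placed at positions
  \<open>n - 1\<close>, \<open>n - 2\<close>, and so on, next to the negative index, so that
  together with \<open>w\<close> it will fill the lower right block. In the induction the new vector
  is pulled back by \<open>D\<close>; it then vanishes at the occupied positions, and a reflection
  moving the next standard vector to it fixes the occupied ones. A unit vector needs a free
  position, which yields \<open>m \<le> n\<close>.\<close>

lemma orthonormal_extension:
  assumes w: "w \<in> qvec n" "herm n w w = -1"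
    and e: "\<And>k. k < m \<Longrightarrow> e k \<in> qvec n" "\<And>k. k < m \<Longrightarrow> herm n w (e k) = 0"
      "\<And>k l. k < m \<Longrightarrow> l < m \<Longrightarrow> herm n (e k) (e l) = (if k = l then 1 else 0)"
  shows "m \<le> n \<and> (\<exists>D\<in>isom n. mvec n D (bvec n) = w \<and> (\<forall>k<m. mvec n D (bvec (n - 1 - k)) = e k))"
  using e
proof (induction m)
  case 0
  have "herm n (bvec n) (bvec n) = -1" by (simp add: herm_bvec) (simp add: bvec_def eps_def)
  \<comment> \<open>\<open>herm n (bvec n) x\<close> is \<open>- x n\<close>, so orthogonality of
    the difference to \<open>bvec n\<close> equates the last coordinates, as the last hypothesis of
    \<open>isom_transitive\<close> demands.\<close>
  moreover have "bvec n n = w n" if "herm n (\<lambda>i. bvec n i - w i) (bvec n) = 0"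
    using herm_zero_sym[OF that] by (simp add: herm_bvec eps_def)
  ultimately obtain R where "R \<in> isom n" "mvec n R (bvec n) = w"
    using isom_transitive[of "bvec n" n w] w by (metis bvec_in_qvec order_refl)
  then show ?case by auto
next
  case (Suc m)
  from Suc.IH Suc.prems obtain D where m: "m \<le> n" and D: "D \<in> isom n" "mvec n D (bvec n) = w"
    "\<And>k. k < m \<Longrightarrow> mvec n D (bvec (n - 1 - k)) = e k" by auto
  define x where "x = mvec n (adj n D) (e m)"
  have em: "e m \<in> qvec n" using Suc.prems(1) by simp
  have Dx: "mvec n D x = e m" unfolding x_def by (rule mvec_adj_cancel(2)[OF D(1) em])
  have x: "x \<in> qvec n" unfolding x_def by simp
  have xx: "herm n x x = 1" using isom_herm[OF D(1), of x x] Suc.prems(3)[of m m] by (simp add: Dx)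
  have coord: "x j = 0" if "j \<le> n" "herm n (mvec n D (bvec j)) (e m) = 0" for j
  proof -
    have "herm n (bvec j) x = 0" using isom_herm[OF D(1), of "bvec j" x] that(2) by (simp add: Dx)
    then show ?thesis using that(1) by (auto simp: herm_bvec eps_def split: if_splits)
  qed
  have xn: "x n = 0" using coord[of n] Suc.prems(2)[of m] by (simp add: D(2))
  have xk: "x (n - 1 - k) = 0" if "k < m" for k
    using coord[of "n - 1 - k"] Suc.prems(3)[of k m] D(3)[OF that] that by simp
  have mn: "m < n"
  proof (rule ccontr)
    assume "\<not> m < n"
    then have "m = n" using m by simp
    have "x i = 0" if "i < n" for i
      using xk[of "n - 1 - i"] that \<open>m = n\<close> by simp
    then have "herm n x x = 0" unfolding herm_self_eq_0 by (simp add: xn)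
    then show False using xx by simp
  qed
  define j where "j = n - 1 - m"
  have j: "j < n" using mn by (simp add: j_def)
  have "herm n (bvec j) (bvec j) = herm n x x"
    unfolding xx using j by (simp add: herm_bvec) (simp add: bvec_def eps_def)
  moreover have "bvec j n = x n" using j xn by (simp add: bvec_def)
  ultimately obtain R where R: "R \<in> isom n" "mvec n R (bvec j) = x"
    "\<And>v. v \<in> qvec n \<Longrightarrow> herm n (\<lambda>i. bvec j i - x i) v = 0 \<Longrightarrow> mvec n R v = v"
    using isom_transitive[of "bvec j" n x] x j by (metis bvec_in_qvec less_imp_le)
  have Rfix: "mvec n R (bvec i) = bvec i" if "i \<le> n" "i \<noteq> j" "x i = 0" for i
  proof (rule R(3))
    show "bvec i \<in> qvec n" using that(1) by simp
    show "herm n (\<lambda>i. bvec j i - x i) (bvec i) = 0"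
      by (rule herm_zero_sym) (use that in \<open>simp add: herm_bvec, simp add: bvec_def\<close>)
  qed
  have Dq: "D \<in> qmat (Suc n)" by (rule isom_qmat[OF D(1)])
  show ?case
  proof (intro conjI bexI[of _ "qmult (Suc n) D R"] allI impI)
    show "Suc m \<le> n" using mn by simp
    show "qmult (Suc n) D R \<in> isom n" by (rule isom_qmult[OF D(1) R(1)])
    show "mvec n (qmult (Suc n) D R) (bvec n) = w"
      unfolding mvec_qmult[OF Dq] using Rfix[of n] j xn D(2) by simp
    fix k assume k: "k < Suc m"
    show "mvec n (qmult (Suc n) D R) (bvec (n - 1 - k)) = e k"
    proof (cases "k = m")
      case True
      then show ?thesis unfolding mvec_qmult[OF Dq] using R(2) Dx by (simp add: j_def)
    next
      case False
      then have "k < m" using k by simp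
      then have "n - 1 - k \<noteq> j" using mn by (simp add: j_def)
      then show ?thesis
        unfolding mvec_qmult[OF Dq] using Rfix[of "n - 1 - k"] xk[OF \<open>k < m\<close>] D(3)[OF \<open>k < m\<close>] by simp
    qed
  qed
qed

section \<open>The real algebra spanned by a group of isometries\<close>

text \<open>The closed real algebra spanned by a matrix group. Closing under entrywise limits
  makes the rank one limits of unbounded sequences available.\<close>
inductive_set alg :: "qmatrix set \<Rightarrow> qmatrix set" for \<Gamma> where
  base: "A \<in> \<Gamma> \<Longrightarrow> A \<in> alg \<Gamma>"
| add: "A \<in> alg \<Gamma> \<Longrightarrow> B \<in> alg \<Gamma> \<Longrightarrow> (\<lambda>i j. A i j + B i j) \<in> alg \<Gamma>"
| scale: "A \<in> alg \<Gamma> \<Longrightarrow> (\<lambda>i j. c *\<^sub>R A i j) \<in> alg \<Gamma>"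
| lim: "(\<And>k. X k \<in> alg \<Gamma>) \<Longrightarrow> (\<And>i j. (\<lambda>k::nat. X k i j) \<longlonglongrightarrow> L i j) \<Longrightarrow> L \<in> alg \<Gamma>"

locale isom_group =
  fixes n :: nat and \<Gamma> :: "qmatrix set"
  assumes isom: "A \<in> \<Gamma> \<Longrightarrow> A \<in> isom n"
    and one: "qid (Suc n) \<in> \<Gamma>"
    and mult: "A \<in> \<Gamma> \<Longrightarrow> B \<in> \<Gamma> \<Longrightarrow> qmult (Suc n) A B \<in> \<Gamma>"
    and adj: "A \<in> \<Gamma> \<Longrightarrow> adj n A \<in> \<Gamma>"
begin

lemma qmat: "A \<in> \<Gamma> \<Longrightarrow> A \<in> qmat (Suc n)"
  by (rule isom_qmat[OF isom])

lemma alg_qmat: "A \<in> alg \<Gamma> \<Longrightarrow> A \<in> qmat (Suc n)"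
proof (induction rule: alg.induct)
  case (base A)
  then show ?case by (rule qmat)
next
  case (lim X L)
  show ?case
    unfolding qmat_Suc_iff
  proof (intro allI impI)
    fix i j assume "n < i \<or> n < j"
    then have "X k i j = 0" for k using lim.IH[of k] unfolding qmat_Suc_iff by blast
    then show "L i j = 0" using lim.hyps(2)[of i j] by (simp add: LIMSEQ_const_iff)
  qed
qed (simp_all add: qmat_Suc_iff)

lemma tendsto_qmult:
  assumes "\<And>i j. ((\<lambda>k. A k i j) \<longlongrightarrow> A' i j) F" "\<And>i j. ((\<lambda>k. B k i j) \<longlongrightarrow> B' i j) F"
  shows "((\<lambda>k. qmult (Suc n) (A k) (B k) i j) \<longlongrightarrow> qmult (Suc n) A' B' i j) F"
  by (cases "i \<le> n \<and> j \<le> n") (auto simp: qmult_Suc intro!: tendsto_intros assms)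

lemma tendsto_adj:
  assumes "\<And>i j. ((\<lambda>k. A k i j) \<longlongrightarrow> A' i j) F"
  shows "((\<lambda>k. adj n (A k) i j) \<longlongrightarrow> adj n A' i j) F"
  by (cases "i \<le> n \<and> j \<le> n") (auto simp: adj_def intro!: tendsto_intros assms)

text \<open>Closure under products takes two inductions: on the left factor with a generator on the
  right, then on the right factor.\<close>

lemma alg_qmult_generator: "A \<in> alg \<Gamma> \<Longrightarrow> B \<in> \<Gamma> \<Longrightarrow> qmult (Suc n) A B \<in> alg \<Gamma>"
proof (induction rule: alg.induct)
  case (base A)
  then show ?case by (intro alg.base mult)
next
  case (add A A')
  have "qmult (Suc n) (\<lambda>i j. A i j + A' i j) B = (\<lambda>i j. qmult (Suc n) A B i j + qmult (Suc n) A' B i j)"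
    by (intro ext) (simp add: qmult_Suc distrib_right sum.distrib)
  then show ?case using alg.add[OF add.IH(1)[OF add.prems] add.IH(2)[OF add.prems]] by simp
next
  case (scale A c)
  have "qmult (Suc n) (\<lambda>i j. c *\<^sub>R A i j) B = (\<lambda>i j. c *\<^sub>R qmult (Suc n) A B i j)"
    by (intro ext) (simp add: qmult_Suc scaleR_sum_right)
  then show ?case using alg.scale[OF scale.IH[OF scale.prems]] by simp
next
  case (lim X L)
  show ?case
    by (rule alg.lim[where X = "\<lambda>k. qmult (Suc n) (X k) B"])
      (intro lim.IH lim.prems tendsto_qmult lim.hyps(2) tendsto_const)+
qed

lemma alg_qmult: "B \<in> alg \<Gamma> \<Longrightarrow> A \<in> alg \<Gamma> \<Longrightarrow> qmult (Suc n) A B \<in> alg \<Gamma>"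
proof (induction rule: alg.induct)
  case (base B)
  then show ?case by (intro alg_qmult_generator)
next
  case (add B B')
  have "qmult (Suc n) A (\<lambda>i j. B i j + B' i j) = (\<lambda>i j. qmult (Suc n) A B i j + qmult (Suc n) A B' i j)"
    by (intro ext) (simp add: qmult_Suc distrib_left sum.distrib)
  then show ?case using alg.add[OF add.IH(1)[OF add.prems] add.IH(2)[OF add.prems]] by simp
next
  case (scale B c)
  have "qmult (Suc n) A (\<lambda>i j. c *\<^sub>R B i j) = (\<lambda>i j. c *\<^sub>R qmult (Suc n) A B i j)"
    by (intro ext) (simp add: qmult_Suc scaleR_sum_right)
  then show ?case using alg.scale[OF scale.IH[OF scale.prems]] by simp
next
  case (lim X L)
  show ?case
    by (rule alg.lim[where X = "\<lambda>k. qmult (Suc n) A (X k)"])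
      (intro lim.IH lim.prems tendsto_qmult lim.hyps(2) tendsto_const)+
qed

lemma alg_adj: "A \<in> alg \<Gamma> \<Longrightarrow> adj n A \<in> alg \<Gamma>"
proof (induction rule: alg.induct)
  case (base A)
  then show ?case by (intro alg.base adj)
next
  case (add A B)
  have "adj n (\<lambda>i j. A i j + B i j) = (\<lambda>i j. adj n A i j + adj n B i j)"
    by (intro ext) (simp add: adj_def distrib_left distrib_right)
  then show ?case using alg.add[OF add.IH] by simp
next
  case (scale A c)
  have "qcnj (c *\<^sub>R q) = c *\<^sub>R qcnj q" for q by (simp add: quat_eq_iff)
  then have "adj n (\<lambda>i j. c *\<^sub>R A i j) = (\<lambda>i j. c *\<^sub>R adj n A i j)"
    by (intro ext) (simp add: adj_def)
  then show ?case using alg.scale[OF scale.IH] by simp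
next
  case (lim X L)
  show ?case by (rule alg.lim[where X = "\<lambda>k. adj n (X k)"]) (intro lim.IH tendsto_adj lim.hyps(2))+
qed

text \<open>Reality of a trace survives real multiples and limits, but not quaternionic multiples;
  hence an algebra over the reals.\<close>

lemma alg_trace_real:
  assumes "\<And>A. A \<in> \<Gamma> \<Longrightarrow> qtrace (Suc n) A \<in> \<real>"
  shows "A \<in> alg \<Gamma> \<Longrightarrow> qtrace (Suc n) A \<in> \<real>"
proof (induction rule: alg.induct)
  case (base A)
  then show ?case by (rule assms)
next
  case (add A B)
  have "qtrace (Suc n) (\<lambda>i j. A i j + B i j) = qtrace (Suc n) A + qtrace (Suc n) B"
    unfolding qtrace_def sum.distrib ..
  then show ?case using add.IH by simp
next
  case (scale A c)
  have "qtrace (Suc n) (\<lambda>i j. c *\<^sub>R A i j) = c *\<^sub>R qtrace (Suc n) A"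
    unfolding qtrace_def scaleR_sum_right ..
  then show ?case using scale.IH by (simp add: scaleR_conv_of_real)
next
  case (lim X L)
  have 1: "(\<lambda>k. qtrace (Suc n) (X k)) \<longlonglongrightarrow> qtrace (Suc n) L"
    unfolding qtrace_def by (intro tendsto_sum lim.hyps(2))
  have 2: "(\<lambda>k. qcnj (qtrace (Suc n) (X k))) \<longlonglongrightarrow> qcnj (qtrace (Suc n) L)"
    by (rule tendsto_qcnj[OF 1])
  have "qcnj (qtrace (Suc n) (X k)) = qtrace (Suc n) (X k)" for k
    using lim.IH[of k] unfolding Reals_quat_iff .
  from 2[unfolded this] have "qcnj (qtrace (Suc n) L) = qtrace (Suc n) L"
    by (rule LIMSEQ_unique[OF _ 1])
  then show ?case unfolding Reals_quat_iff .
qed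

text \<open>For \<open>v n = 1\<close> this is invariance of the line of \<open>v\<close>, with the
  multiplier read off the last coordinate. In this form it is a real linear and closed condition on
  \<open>A\<close>, so it passes to the algebra.\<close>

lemma alg_line:
  assumes "\<And>A i. A \<in> \<Gamma> \<Longrightarrow> mvec n A v i = v i * mvec n A v n"
  shows "A \<in> alg \<Gamma> \<Longrightarrow> mvec n A v i = v i * mvec n A v n"
proof (induction rule: alg.induct)
  case (base A)
  then show ?case by (rule assms)
next
  case (add A B)
  have "mvec n (\<lambda>i j. A i j + B i j) v l = mvec n A v l + mvec n B v l" for l
    by (simp add: mvec_def distrib_right sum.distrib)
  then show ?case using add.IH by (simp add: distrib_left)
next
  case (scale A c)
  have "mvec n (\<lambda>i j. c *\<^sub>R A i j) v l = c *\<^sub>R mvec n A v l" for l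
    by (simp add: mvec_def scaleR_sum_right)
  then show ?case using scale.IH by simp
next
  case (lim X L)
  have 1: "(\<lambda>k. mvec n (X k) v l) \<longlonglongrightarrow> mvec n L v l" for l
    by (intro tendsto_mvec lim.hyps(2))
  have "(\<lambda>k. mvec n (X k) v i) \<longlonglongrightarrow> v i * mvec n L v n"
    unfolding lim.IH by (intro tendsto_intros 1)
  then show ?case by (rule LIMSEQ_unique[OF 1])
qed

lemma alg_limit_point:
  assumes "\<xi> \<in> limit_set n \<Gamma>"
  obtains y where "y \<in> qvec n" "herm n y y = 0" "y n \<noteq> 0" "dyad n (\<xi>(n := 1)) y \<in> alg \<Gamma>"
proof -
  have "\<Gamma> \<subseteq> isom n" using isom by (rule subsetI)
  show thesis
  proof (rule limit_set_sequence[OF assms \<open>\<Gamma> \<subseteq> isom n\<close>])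
    fix g assume g: "\<And>k. g k \<in> \<Gamma>"
      and inf: "filterlim (\<lambda>k. norm (g k n n)) at_top sequentially"
      and lim: "\<And>i. (\<lambda>k. g k i n * inverse (g k n n)) \<longlonglongrightarrow> (\<xi>(n := 1)) i"
    show thesis
    proof (rule isom_unbounded_limit[OF isom[OF g] inf])
      fix r :: "nat \<Rightarrow> nat" and x y :: "nat \<Rightarrow> quat"
      assume r: "strict_mono r" and y: "y \<in> qvec n" "herm n y y = 0" "y n \<noteq> 0"
        and E: "\<And>i j. (\<lambda>k. (1 / norm (g (r k) n n)) *\<^sub>R g (r k) i j) \<longlonglongrightarrow> dyad n x y i j"
        and x: "\<And>i. (\<lambda>k. g (r k) i n * inverse (g (r k) n n)) \<longlonglongrightarrow> x i"
      have "x = \<xi>(n := 1)"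
      proof
        fix i
        have "(\<lambda>k. g (r k) i n * inverse (g (r k) n n)) \<longlonglongrightarrow> (\<xi>(n := 1)) i"
          using LIMSEQ_subseq_LIMSEQ[OF lim[of i] r] by (simp only: o_def)
        then show "x i = (\<xi>(n := 1)) i" by (rule LIMSEQ_unique[OF x])
      qed
      moreover have "dyad n x y \<in> alg \<Gamma>"
        by (rule alg.lim[OF _ E]) (intro alg.scale alg.base g)
      ultimately show thesis using that[OF y] by simp
    qed
  qed
qed

text \<open>\<open>discrete_set\<close> isolates each element but says nothing about limits outside
  \<open>\<Gamma>\<close>. The quotients of consecutive terms, however, lie in
  \<open>\<Gamma>\<close> and converge to the identity, because the limit is again an isometry; so
  some quotient is the identity.\<close>

lemma discrete_convergent_repeats:
  assumes disc: "discrete_set (Suc n) \<Gamma>" and X: "\<And>k. X k \<in> \<Gamma>"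
    and lim: "\<And>i j. (\<lambda>k. X k i j) \<longlonglongrightarrow> E i j"
  shows "\<exists>k. X (Suc k) = X k"
proof -
  define Y where "Y k = qmult (Suc n) (adj n (X k)) (X (Suc k))" for k
  have Y: "Y k \<in> \<Gamma>" for k unfolding Y_def by (intro mult adj X)
  have limS: "(\<lambda>k. X (Suc k) i j) \<longlonglongrightarrow> E i j" for i j
    using lim[of i j] by (rule LIMSEQ_Suc)
  have "(\<lambda>k. qmult (Suc n) (adj n (X k)) (X k) i j) \<longlonglongrightarrow> qmult (Suc n) (adj n E) E i j" for i j
    by (intro tendsto_qmult tendsto_adj lim)
  moreover have "qmult (Suc n) (adj n (X k)) (X k) = qid (Suc n)" for k
    using isom[OF X[of k]] by (simp add: isom_def)
  ultimately have E: "qmult (Suc n) (adj n E) E i j = qid (Suc n) i j" for i j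
    by (simp add: LIMSEQ_const_iff)
  have "(\<lambda>k. Y k i j) \<longlonglongrightarrow> qmult (Suc n) (adj n E) E i j" for i j
    unfolding Y_def by (intro tendsto_qmult tendsto_adj lim limS)
  then have Ylim: "(\<lambda>k. Y k i j) \<longlonglongrightarrow> qid (Suc n) i j" for i j by (simp only: E)
  have "(\<lambda>k. qmat_dist (Suc n) (qid (Suc n)) (Y k)) \<longlonglongrightarrow>
      (\<Sum>i<Suc n. \<Sum>j<Suc n. norm (qid (Suc n) i j - qid (Suc n) i j))"
    unfolding qmat_dist_def norm_quat_def[symmetric] by (intro tendsto_sum tendsto_norm tendsto_diff tendsto_const Ylim)
  then have lim0: "(\<lambda>k. qmat_dist (Suc n) (qid (Suc n)) (Y k)) \<longlonglongrightarrow> 0" by simp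
  obtain e where "e > 0" and e: "\<And>B. B \<in> \<Gamma> \<Longrightarrow> qmat_dist (Suc n) (qid (Suc n)) B < e \<Longrightarrow> B = qid (Suc n)"
    using disc one unfolding discrete_set_def by blast
  from order_tendstoD(2)[OF lim0 \<open>e > 0\<close>] obtain k where "qmat_dist (Suc n) (qid (Suc n)) (Y k) < e"
    unfolding eventually_sequentially by blast
  then have "Y k = qid (Suc n)" by (intro e Y)
  then have 1: "qmult (Suc n) (adj n (X k)) (X (Suc k)) = qid (Suc n)" by (simp only: Y_def)
  have "X (Suc k) = X k"
  proof (rule qmat_eqI[OF qmat[OF X] qmat[OF X]])
    fix v assume v: "v \<in> qvec n"
    have "mvec n (adj n (X k)) (mvec n (X (Suc k)) v) = v"
      using mvec_qmult[OF adj_in_qmat, of n "X k" "X (Suc k)" v] unfolding 1 mvec_qid[OF v] by simp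
    then have "mvec n (X k) v = mvec n (X k) (mvec n (adj n (X k)) (mvec n (X (Suc k)) v))" by simp
    also have "\<dots> = mvec n (X (Suc k)) v"
      by (rule mvec_adj_cancel(2)[OF isom[OF X] mvec_in_qvec[OF qmat[OF X]]])
    finally show "mvec n (X (Suc k)) v = mvec n (X k) v" by simp
  qed
  then show ?thesis ..
qed

end

text \<open>The distance of \<open>b k\<close> to the identity is measured at the point represented by the
  negative vector \<open>z\<close>.\<close>
lemma isom_bounded_displacement:
  assumes b: "\<And>k. b k \<in> isom n" and z: "z \<in> qvec n" "qRe (herm n z z) < 0"
    and bd: "\<And>k. norm (herm n z (mvec n (b k) z)) \<le> B"
  shows "\<exists>B'. \<forall>k i j. norm (b k i j) \<le> B'"
proof (cases "\<exists>B'. \<forall>k. norm (b k n n) \<le> B'")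
  case True
  then obtain B' where B': "\<And>k. norm (b k n n) \<le> B'" by blast
  have "norm (b k i j) \<le> B'" for k i j
    by (rule order_trans[OF isom_entry_le_corner[OF b] B'])
  then show ?thesis by blast
next
  case False
  then have "\<forall>m::nat. \<exists>k. real m \<le> norm (b k n n)" by (meson linorder_le_cases)
  then obtain s where s: "\<And>m::nat. real m \<le> norm (b (s m) n n)" by metis
  define g where "g m = b (s m)" for m
  have g: "g m \<in> isom n" for m unfolding g_def by (rule b)
  have inf: "filterlim (\<lambda>m. norm (g m n n)) at_top sequentially"
    by (rule filterlim_at_top_mono[OF filterlim_real_sequentially]) (simp add: g_def s)
  show ?thesis
  proof (rule isom_unbounded_limit[OF g inf])
    fix r :: "nat \<Rightarrow> nat" and x y :: "nat \<Rightarrow> quat"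
    assume r: "strict_mono r" and x: "x \<in> qvec n" "herm n x x = 0" "x n = 1"
      and y: "y \<in> qvec n" "herm n y y = 0" "y n \<noteq> 0"
      and E: "\<And>i j. (\<lambda>k. (1 / norm (g (r k) n n)) *\<^sub>R g (r k) i j) \<longlonglongrightarrow> dyad n x y i j"
    \<comment> \<open>An isotropic line is never orthogonal to the negative vector \<open>z\<close>.
      Hence rescaled displacements of \<open>z\<close> along an unbounded sequence would have a
      nonzero limit, while the bound \<open>B\<close> divided by the diverging corner entry gives
      0.\<close>
    have nz: "herm n z u \<noteq> 0" if "u \<in> qvec n" "herm n u u = 0" "u n \<noteq> 0" for u
    proof
      assume "herm n z u = 0"
      moreover have "u \<noteq> (\<lambda>i. 0)" using that(3) by auto
      ultimately have "0 < qRe (herm n u u)" by (intro herm_pos_orth[OF z that(1)])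
      then show False by (simp add: that(2))
    qed
    have "herm n y z \<noteq> 0" using nz[OF y] herm_zero_sym by blast
    then have n0: "herm n z (mvec n (dyad n x y) z) \<noteq> 0"
      using nz[OF x(1,2)] x(3) by (simp add: mvec_dyad herm_scale_right)
    have "(\<lambda>k. herm n z (mvec n (\<lambda>i j. (1 / norm (g (r k) n n)) *\<^sub>R g (r k) i j) z)) \<longlonglongrightarrow>
        herm n z (mvec n (dyad n x y) z)"
      by (intro tendsto_herm tendsto_mvec E tendsto_const)
    moreover have "herm n z (mvec n (\<lambda>i j. (1 / norm (g (r k) n n)) *\<^sub>R g (r k) i j) z) =
        inverse (norm (g (r k) n n)) *\<^sub>R herm n z (mvec n (g (r k)) z)" for k
    proof -
      have "mvec n (\<lambda>i j. (1 / norm (g (r k) n n)) *\<^sub>R g (r k) i j) z =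
        (\<lambda>i. inverse (norm (g (r k) n n)) *\<^sub>R mvec n (g (r k)) z i)"
        by (intro ext) (simp add: mvec_def scaleR_sum_right inverse_eq_divide)
      then show ?thesis by (simp only: herm_scaleR_right)
    qed
    moreover have "(\<lambda>k. inverse (norm (g (r k) n n)) *\<^sub>R herm n z (mvec n (g (r k)) z)) \<longlonglongrightarrow> 0"
    proof (rule Lim_null_comparison)
      show "\<forall>\<^sub>F k in sequentially. norm (inverse (norm (g (r k) n n)) *\<^sub>R herm n z (mvec n (g (r k)) z))
          \<le> inverse (norm (g (r k) n n)) * B"
        using bd by (intro always_eventually allI) (simp add: g_def mult_left_mono)
      have "(\<lambda>k. inverse (norm (g (r k) n n))) \<longlonglongrightarrow> 0"
        by (rule tendsto_inverse_0_at_top) (rule filterlim_compose[OF inf filterlim_subseq[OF r]])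
      from tendsto_mult_left_zero[OF this, of B]
      show "(\<lambda>k. inverse (norm (g (r k) n n)) * B) \<longlonglongrightarrow> 0" .
    qed
    ultimately have "herm n z (mvec n (dyad n x y) z) = 0" by (simp add: LIMSEQ_unique)
    then show ?thesis using n0 by contradiction
  qed
qed

section \<open>Groups fixing a boundary point\<close>

locale fixed_boundary_point = isom_group +
  fixes f :: "nat \<Rightarrow> quat"
  assumes f: "f \<in> qvec n" "herm n f f = 0" "f n = 1"
    and fixed: "A \<in> \<Gamma> \<Longrightarrow> mvec n A f i = f i * mvec n A f n"
begin

text \<open>Since \<open>f n = 1\<close>, the last coordinate of \<open>A f\<close> is the right
  multiplier of \<open>A\<close> on the fixed line.\<close>

definition lam :: "qmatrix \<Rightarrow> quat" where
  "lam A = mvec n A f n"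

lemma mvec_f: "A \<in> \<Gamma> \<Longrightarrow> mvec n A f = (\<lambda>i. f i * lam A)"
  unfolding lam_def by (rule ext) (rule fixed)

lemma lam_mult_adj:
  assumes "A \<in> \<Gamma>"
  shows "lam A * lam (adj n A) = 1"
proof -
  have "(\<lambda>i. f i * (lam A * lam (adj n A))) = mvec n A (mvec n (adj n A) f)"
    by (simp add: mvec_f adj assms mvec_scale mult.assoc)
  also have "\<dots> = f" by (rule mvec_adj_cancel(2)[OF isom[OF assms] f(1)])
  finally have "f n * (lam A * lam (adj n A)) = f n" by (rule fun_cong)
  then show ?thesis by (simp add: f(3))
qed

lemma norm_lam_mult_adj: "A \<in> \<Gamma> \<Longrightarrow> norm (lam A) * norm (lam (adj n A)) = 1"
  using arg_cong[OF lam_mult_adj, of A norm] by (simp add: norm_mult)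

lemma herm_f_mvec: "A \<in> \<Gamma> \<Longrightarrow> herm n f (mvec n A v) = qcnj (lam (adj n A)) * herm n f v"
proof -
  assume A: "A \<in> \<Gamma>"
  have "herm n f (mvec n A v) = herm n (mvec n (adj n A) f) v"
    by (rule herm_adj'[OF qmat[OF A], symmetric])
  then show ?thesis by (simp only: mvec_f[OF adj[OF A]] herm_scale_left)
qed

lemma herm_f_bvec: "herm n f (bvec n) = -1"
proof -
  have "herm n (bvec n) f = -1" by (simp add: herm_bvec f(3) eps_def)
  then show ?thesis using qcnj_herm[of n "bvec n" f] by simp
qed

text \<open>If all multipliers had norm 1, the group would preserve the horospheres at
  \<open>f\<close>: \<open>herm n f\<close> would keep norm 1 on the orbit of \<open>bvec n\<close>.
  After division by the diverging corner entry it tends to 0, so a limit point would be orthogonal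
  to \<open>f\<close> and therefore equal to it.\<close>

lemma contracting_element:
  assumes \<xi>: "\<xi> \<in> limit_set n \<Gamma>" "\<xi>(n := 1) \<noteq> f"
  shows "\<exists>g\<in>\<Gamma>. norm (lam g) < 1"
proof (rule ccontr)
  assume neg: "\<not> (\<exists>g\<in>\<Gamma>. norm (lam g) < 1)"
  have ge: "1 \<le> norm (lam A)" if "A \<in> \<Gamma>" for A using neg that by (simp add: not_less)
  have one': "norm (lam A) = 1" if A: "A \<in> \<Gamma>" for A
  proof -
    have "norm (lam A) * 1 \<le> norm (lam A) * norm (lam (adj n A))"
      by (rule mult_left_mono[OF ge[OF adj[OF A]]]) simp
    then show ?thesis using ge[OF A] norm_lam_mult_adj[OF A] by simp
  qed
  have "\<Gamma> \<subseteq> isom n" using isom by (rule subsetI)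
  have "herm n f (\<xi>(n := 1)) = 0"
  proof (rule limit_set_sequence[OF \<xi>(1) \<open>\<Gamma> \<subseteq> isom n\<close>])
    fix g assume g: "\<And>k. g k \<in> \<Gamma>"
      and inf: "filterlim (\<lambda>k. norm (g k n n)) at_top sequentially"
      and lim: "\<And>i. (\<lambda>k. g k i n * inverse (g k n n)) \<longlonglongrightarrow> (\<xi>(n := 1)) i"
    have "(\<lambda>k. herm n f (\<lambda>i. g k i n * inverse (g k n n))) \<longlonglongrightarrow> herm n f (\<xi>(n := 1))"
      by (intro tendsto_herm lim tendsto_const)
    moreover have "(\<lambda>k. herm n f (\<lambda>i. g k i n * inverse (g k n n))) \<longlonglongrightarrow> 0"
    proof (rule Lim_null_comparison)
      have "norm (herm n f (\<lambda>i. g k i n * inverse (g k n n))) \<le> inverse (norm (g k n n))" for k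
      proof -
        have "herm n f (\<lambda>i. g k i n * inverse (g k n n)) =
            qcnj (lam (adj n (g k))) * herm n f (bvec n) * inverse (g k n n)"
          using herm_f_mvec[OF g[of k], of "bvec n"] by (simp add: herm_scale_right mvec_bvec)
        then show ?thesis using one'[OF adj[OF g[of k]]]
          by (simp add: norm_mult norm_inverse herm_f_bvec)
      qed
      then show "\<forall>\<^sub>F k in sequentially. norm (herm n f (\<lambda>i. g k i n * inverse (g k n n)))
          \<le> inverse (norm (g k n n))"
        by (intro always_eventually allI)
      show "(\<lambda>k. inverse (norm (g k n n))) \<longlonglongrightarrow> 0" by (rule tendsto_inverse_0_at_top[OF inf])
    qed
    ultimately show ?thesis by (rule LIMSEQ_unique)
  qed
  from null_orth_parallel[OF f(1,2) limit_set_null[OF \<xi>(1)] this] have "\<xi>(n := 1) = f"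
    by (simp add: f(3))
  then show False using \<xi>(2) by simp
qed

text \<open>The second fixed point of a loxodromic element is the fixed point of the affine map
  \<open>v \<mapsto> g v (cnj \<lambda>)\<close> on the hyperplane \<open>herm f v = 1\<close>. Modulo \<open>f\<close> the linear part scales
  the positive form on the orthogonal complement of \<open>f\<close> by \<open>|\<lambda>|\<^sup>2\<close>, and it scales \<open>f\<close> itself by
  \<open>|\<lambda>|\<^sup>2\<close>, so the iterates converge geometrically.\<close>
lemma second_fixed_point:
  assumes g: "g \<in> \<Gamma>" and lt: "norm (lam g) < 1"
  obtains x where "x \<in> qvec n" "herm n x x = 0" "herm n f x = 1"
    "(\<lambda>i. mvec n g x i * qcnj (lam g)) = x"
proof -
  define T where "T v = (\<lambda>i. mvec n g v i * qcnj (lam g))" for v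
  define q where "q = norm (lam g)"
  have q0: "0 < q" and q1: "q < 1" using lam_mult_adj[OF g] lt by (auto simp: q_def)
  have Tq: "T v \<in> qvec n" for v unfolding T_def by (intro qvec_scale mvec_in_qvec qmat[OF g])
  have Tdiff: "T (\<lambda>i. u i - v i) = (\<lambda>i. T u i - T v i)" for u v
    unfolding T_def mvec_diff left_diff_distrib ..
  have herm_T: "herm n (T u) (T v) = lam g * herm n u v * qcnj (lam g)" for u v
    unfolding T_def herm_scale_right herm_scale_left isom_herm[OF isom[OF g]] by (simp add: mult.assoc)
  have "lam (adj n g) * lam g = 1"
    using lam_mult_adj[OF adj[OF g]] by (simp add: qmat[OF g])
  have f_T: "herm n f (T v) = 1" if "herm n f v = 1" for v
  proof -
    have "herm n f (T v) = qcnj (lam (adj n g)) * qcnj (lam g)"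
      unfolding T_def herm_scale_right herm_f_mvec[OF g] that by simp
    also have "\<dots> = qcnj (lam g * lam (adj n g))" by (simp only: qcnj_simps(7))
    finally show ?thesis by (simp only: lam_mult_adj[OF g] qcnj_simps(2))
  qed
  \<comment> \<open>The starting vector is \<open>- bvec n\<close>, on which \<open>herm n f\<close>
    takes the value 1.\<close>
  define v where "v k = (T ^^ k) (\<lambda>i. bvec n i * (-1))" for k
  have v0: "v 0 = (\<lambda>i. bvec n i * (-1))" and vS: "v (Suc k) = T (v k)" for k
    by (simp_all add: v_def)
  have vq: "v k \<in> qvec n" for k
  proof (cases k)
    case 0
    have "(\<lambda>i. bvec n i * (-1)) \<in> qvec n" by (rule qvec_scale) simp
    then show ?thesis using 0 v0 by simp
  qed (simp add: vS Tq)
  have fv: "herm n f (v k) = 1" for k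
  proof (induction k)
    case 0
    show ?case unfolding v0 herm_scale_right herm_f_bvec by simp
  qed (simp add: vS f_T)
  define d where "d k = (\<lambda>i. v (Suc k) i - v k i)" for k
  have dq: "d k \<in> qvec n" for k unfolding d_def by (intro qvec_diff vq)
  have dS: "d (Suc k) = T (d k)" for k unfolding d_def Tdiff vS ..
  have fd: "herm n f (d k) = 0" for k unfolding d_def herm_diff_right fv by simp
  define s where "s k = qRe (herm n (d k) (d k))" for k
  have hd: "herm n (d k) (d k) = of_real (s k)" for k unfolding s_def by (rule herm_self_qRe)
  have sS: "s (Suc k) = q\<^sup>2 * s k" for k
  proof -
    have "of_real (s (Suc k)) = lam g * of_real (s k) * qcnj (lam g)"
      unfolding hd[symmetric] dS herm_T ..
    also have "\<dots> = of_real (s k) * (lam g * qcnj (lam g))"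
      by (simp only: of_real_commute_quat[of _ "lam g", symmetric] mult.assoc)
    also have "\<dots> = of_real (q\<^sup>2 * s k)"
      unfolding qcnj_mult_self q_def by (simp add: mult.commute)
    finally show ?thesis by (simp only: of_real_eq_iff)
  qed
  \<comment> \<open>The form is only semidefinite on the complement of \<open>f\<close>, which
    contains \<open>f\<close>. Removing the multiple \<open>t k\<close> of \<open>f\<close> leaves
    the representative with last coordinate 0, whose square is its Euclidean one.\<close>
  define D where "D k = (\<lambda>i. d k i - f i * d k n)" for k
  define t where "t k = d k n" for k
  have Dn: "D k n = 0" for k by (simp add: D_def f(3))
  have Dq: "D k \<in> qvec n" for k unfolding D_def by (intro qvec_diff qvec_scale dq f)
  have hD: "herm n (D k) (D k) = of_real (s k)" for k
    unfolding D_def herm_diff_left herm_diff_right herm_scale_left herm_scale_right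
    by (simp add: fd herm_zero_sym[OF fd] f(2) hd)
  have s_eq: "s k = (\<Sum>i<n. (norm (D k i))\<^sup>2)" for k
    using arg_cong[OF hD, of qRe k] unfolding qRe_herm_self Dn by simp
  have s0: "0 \<le> s k" for k unfolding s_eq by (simp add: sum_nonneg)
  have s_pow: "sqrt (s k) = q ^ k * sqrt (s 0)" for k
    by (induction k) (use q0 in \<open>simp_all add: sS real_sqrt_mult\<close>)
  have D_le: "norm (D k l) \<le> q ^ k * sqrt (s 0)" for k l
  proof (cases "l < n")
    case True
    have "(norm (D k l))\<^sup>2 \<le> s k"
      unfolding s_eq using True by (intro member_le_sum) auto
    then have "norm (D k l) \<le> sqrt (s k)" by (rule real_le_rsqrt)
    then show ?thesis by (simp only: s_pow[of k])
  next
    case False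
    then have "D k l = 0" using Dn[of k] Dq[of k] by (cases "l = n") (simp_all add: qvec_def)
    then show ?thesis using q0 s0[of 0] by simp
  qed
  define G where "G = (\<Sum>l\<le>n. norm (g n l)) * sqrt (s 0)"
  have G0: "0 \<le> G" unfolding G_def by (intro mult_nonneg_nonneg sum_nonneg) (simp_all add: s0)
  have tS: "norm (t (Suc k)) \<le> q * (q ^ k * G) + q\<^sup>2 * norm (t k)" for k
  proof -
    have "d k = (\<lambda>i. D k i + f i * t k)" by (simp add: D_def t_def)
    then have "mvec n g (d k) n = mvec n g (D k) n + lam g * t k"
      using mvec_f[OF g] by (simp add: mvec_add mvec_scale f(3))
    then have "t (Suc k) = (mvec n g (D k) n + lam g * t k) * qcnj (lam g)"
      by (simp add: t_def dS T_def)
    then have "norm (t (Suc k)) \<le> (norm (mvec n g (D k) n) + q * norm (t k)) * q"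
      using norm_triangle_ineq[of "mvec n g (D k) n" "lam g * t k"]
      by (simp add: norm_mult q_def mult_right_mono)
    moreover have "norm (mvec n g (D k) n) \<le> q ^ k * G"
    proof -
      have "norm (mvec n g (D k) n) \<le> (\<Sum>l\<le>n. norm (g n l) * (q ^ k * sqrt (s 0)))"
        unfolding mvec_def by (rule sum_norm_le) (simp add: norm_mult D_le mult_left_mono)
      also have "\<dots> = q ^ k * G" by (simp add: G_def sum_distrib_left sum_distrib_right mult_ac)
      finally show ?thesis .
    qed
    then have "(norm (mvec n g (D k) n) + q * norm (t k)) * q \<le> (q ^ k * G + q * norm (t k)) * q"
      using q0 by (intro mult_right_mono add_right_mono) simp_all
    ultimately show ?thesis by (simp add: algebra_simps power2_eq_square)
  qed
  \<comment> \<open>Chosen to dominate \<open>norm (t 0)\<close> and to satisfy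
    \<open>G + q C \<le> C\<close>, so that the bound \<open>C q^k\<close> reproduces itself in the
    recursion \<open>tS\<close>.\<close>
  define C where "C = norm (t 0) + G / (1 - q)"
  have CG: "G + q * C \<le> C"
  proof -
    have "G = (1 - q) * (G / (1 - q))" using q1 by simp
    also have "\<dots> \<le> (1 - q) * C" unfolding C_def using q1 by (intro mult_left_mono) simp_all
    finally show ?thesis by (simp add: algebra_simps)
  qed
  have t_le: "norm (t k) \<le> C * q ^ k" for k
  proof (induction k)
    case 0
    show ?case using G0 q1 by (simp add: C_def)
  next
    case (Suc k)
    have "norm (t (Suc k)) \<le> q * (q ^ k * G) + q\<^sup>2 * (C * q ^ k)"
      using tS[of k] mult_left_mono[OF Suc.IH, of "q\<^sup>2"] by simp
    also have "\<dots> = q ^ Suc k * (G + q * C)" by (simp add: algebra_simps power2_eq_square)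
    also have "\<dots> \<le> q ^ Suc k * C" using q0 by (intro mult_left_mono[OF CG]) simp
    finally show ?case by (simp add: mult.commute)
  qed
  have d_le: "norm (d k i) \<le> (sqrt (s 0) + norm (f i) * C) * q ^ k" for k i
  proof -
    have "d k i = D k i + f i * t k" by (simp add: D_def t_def)
    then have "norm (d k i) \<le> norm (D k i) + norm (f i) * norm (t k)"
      using norm_triangle_ineq[of "D k i" "f i * t k"] by (simp add: norm_mult)
    also have "\<dots> \<le> q ^ k * sqrt (s 0) + norm (f i) * (C * q ^ k)"
      by (intro add_mono D_le mult_left_mono t_le) simp
    finally show ?thesis by (simp add: algebra_simps)
  qed
  have summ: "summable (\<lambda>k. d k i)" for i
  proof (rule summable_comparison_test)
    show "\<exists>N. \<forall>k\<ge>N. norm (d k i) \<le> (sqrt (s 0) + norm (f i) * C) * q ^ k" using d_le by blast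
    show "summable (\<lambda>k. (sqrt (s 0) + norm (f i) * C) * q ^ k)"
      using q0 q1 by (intro summable_mult summable_geometric) simp
  qed
  define x where "x = (\<lambda>i. v 0 i + (\<Sum>k. d k i))"
  have v_sum: "v k i = v 0 i + (\<Sum>j<k. d j i)" for k i
    by (induction k) (simp_all add: d_def)
  have lim: "(\<lambda>k. v k i) \<longlonglongrightarrow> x i" for i
  proof -
    have "(\<lambda>k. v 0 i + (\<Sum>j<k. d j i)) \<longlonglongrightarrow> x i"
      unfolding x_def by (intro tendsto_intros summable_LIMSEQ summ)
    moreover have "(\<lambda>k. v k i) = (\<lambda>k. v 0 i + (\<Sum>j<k. d j i))"
      by (rule ext) (rule v_sum)
    ultimately show ?thesis by (simp only:)
  qed
  have Tx: "T x i = x i" for i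
  proof (rule LIMSEQ_unique)
    have "(\<lambda>k. T (v k) i) \<longlonglongrightarrow> T x i"
      unfolding T_def mvec_def by (intro tendsto_intros lim)
    then show "(\<lambda>k. v (Suc k) i) \<longlonglongrightarrow> T x i" unfolding vS .
    show "(\<lambda>k. v (Suc k) i) \<longlonglongrightarrow> x i" by (rule LIMSEQ_Suc[OF lim])
  qed
  then have Tx': "T x = x" ..
  have xq: "x \<in> qvec n" using Tq[of x] unfolding Tx' .
  \<comment> \<open>The fixed point is isotropic because \<open>T\<close> scales squares by a factor
    below 1.\<close>
  have "norm (herm n x x) = q * norm (herm n x x) * q"
    using arg_cong[OF herm_T[of x x], of norm] unfolding Tx' by (simp add: norm_mult q_def)
  then have "norm (herm n x x) * (1 - q * q) = 0" by (simp add: algebra_simps)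
  moreover have "q * q < 1" using q0 q1 mult_strict_mono[of q 1 q 1] by simp
  ultimately have xx: "herm n x x = 0" by simp
  have "(\<lambda>k. herm n f (v k)) \<longlonglongrightarrow> herm n f x" by (intro tendsto_herm lim tendsto_const)
  then have fx: "herm n f x = 1" unfolding fv by (simp add: LIMSEQ_const_iff)
  show thesis
    by (rule that[OF xq xx fx]) (use Tx' in \<open>simp only: T_def\<close>)
qed

text \<open>Conjugates \<open>g\<^sup>k h g\<^sup>-\<^sup>k\<close> displace a point of the axis of \<open>g\<close> by a bounded amount, so by
  discreteness some power of \<open>g\<close> commutes with one of them.\<close>
lemma second_point_fixed:
  assumes disc: "discrete_set (Suc n) \<Gamma>"
    and g: "g \<in> \<Gamma>" and lt: "norm (lam g) < 1"
    and x: "x \<in> qvec n" "herm n x x = 0" "herm n f x = 1"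
    and gx: "(\<lambda>i. mvec n g x i * qcnj (lam g)) = x"
    and h: "h \<in> \<Gamma>"
  shows "\<exists>c. mvec n h x = (\<lambda>i. x i * c)"
proof -
  have lam0: "lam A \<noteq> 0" if "A \<in> \<Gamma>" for A using lam_mult_adj[OF that] by auto
  have xn: "x n \<noteq> 0"
  proof (rule null_last_nonzero[OF x(1,2)])
    show "x \<noteq> (\<lambda>i. 0)" using x(3) by auto
  qed
  have gx': "mvec n g x = (\<lambda>i. x i * inverse (qcnj (lam g)))"
  proof
    fix i
    have "mvec n g x i = mvec n g x i * qcnj (lam g) * inverse (qcnj (lam g))"
      using lam0[OF g] by (simp add: mult.assoc)
    then show "mvec n g x i = x i * inverse (qcnj (lam g))" by (simp only: fun_cong[OF gx])
  qed
  define pw where "pw k = ((qmult (Suc n) g) ^^ k) (qid (Suc n))" for k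
  have pw0: "pw 0 = qid (Suc n)" and pwS: "pw (Suc k) = qmult (Suc n) g (pw k)" for k
    by (simp_all add: pw_def)
  have pw: "pw k \<in> \<Gamma>" for k by (induction k) (simp_all add: pw0 pwS one mult g)
  define b where "b k = ((\<lambda>B. qmult (Suc n) (qmult (Suc n) g B) (adj n g)) ^^ k) h" for k
  have b0: "b 0 = h" and bS: "b (Suc k) = qmult (Suc n) (qmult (Suc n) g (b k)) (adj n g)" for k
    by (simp_all add: b_def)
  have b: "b k \<in> \<Gamma>" for k by (induction k) (simp_all add: b0 bS h mult adj g)
  \<comment> \<open>\<open>b k\<close> is the conjugate of \<open>h\<close> by \<open>g^k\<close>;
    this is \<open>b (K + r) g^r = g^r b K\<close>, written without inverse powers.\<close>
  have bpw: "mvec n (b (K + r)) (mvec n (pw r) v) = mvec n (pw r) (mvec n (b K) v)" if v: "v \<in> qvec n" for K r v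
  proof (induction r)
    case 0
    show ?case by (simp add: pw0 mvec_qid v qmat[OF b])
  next
    case (Suc r)
    have u: "mvec n (pw r) v \<in> qvec n" by (rule mvec_in_qvec[OF qmat[OF pw]])
    have "mvec n (b (K + Suc r)) (mvec n (pw (Suc r)) v) =
        mvec n g (mvec n (b (K + r)) (mvec n (adj n g) (mvec n g (mvec n (pw r) v))))"
      by (simp add: bS pwS mvec_qmult qmat g b)
    also have "\<dots> = mvec n g (mvec n (pw r) (mvec n (b K) v))"
      by (simp only: mvec_adj_cancel(1)[OF isom[OF g] u] Suc.IH)
    also have "\<dots> = mvec n (pw (Suc r)) (mvec n (b K) v)"
      by (simp add: pwS mvec_qmult qmat g)
    finally show ?case .
  qed
  have pwf: "mvec n (pw k) f = (\<lambda>i. f i * lam (pw k))" for k by (rule mvec_f[OF pw])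
  have pwx: "\<exists>m. mvec n (pw k) x = (\<lambda>i. x i * m)" for k
  proof (induction k)
    case 0
    show ?case by (rule exI[of _ 1]) (simp add: pw0 mvec_qid x(1))
  next
    case (Suc k)
    then obtain m where m: "mvec n (pw k) x = (\<lambda>i. x i * m)" by (rule exE)
    have "mvec n (pw (Suc k)) x = (\<lambda>i. x i * (inverse (qcnj (lam g)) * m))"
      by (simp add: pwS mvec_qmult qmat g m mvec_scale gx' mult.assoc)
    then show ?case by (rule exI)
  qed
  then obtain \<mu> where \<mu>: "\<And>k. mvec n (pw k) x = (\<lambda>i. x i * \<mu> k)" by (rule that[OF someI_ex])
  have lam_pw: "norm (lam (pw k)) = norm (lam g) ^ k" for k
  proof (induction k)
    case 0
    have "lam (pw 0) = 1" by (simp add: lam_def pw0 mvec_qid f)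
    then show ?case by simp
  next
    case (Suc k)
    have "mvec n (qmult (Suc n) g (pw k)) f n = lam g * lam (pw k)"
      unfolding mvec_qmult[OF qmat[OF g]] pwf mvec_scale mvec_f[OF g] by (simp add: f(3))
    then have "lam (pw (Suc k)) = lam g * lam (pw k)"
      by (simp only: pwS lam_def[of "qmult (Suc n) g (pw k)"])
    then show ?case by (simp add: norm_mult Suc.IH)
  qed
  have lam_mu: "norm (lam (pw k)) * norm (\<mu> k) = 1" for k
  proof -
    have "qcnj (lam (pw k)) * \<mu> k = herm n (mvec n (pw k) f) (mvec n (pw k) x)"
      unfolding pwf \<mu> herm_scale_left herm_scale_right by (simp add: x(3))
    also have "\<dots> = 1" by (simp only: isom_herm[OF isom[OF pw]] x(3))
    finally show ?thesis using norm_mult[of "qcnj (lam (pw k))" "\<mu> k"] by simp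
  qed
  \<comment> \<open>A negative vector spanned by the two fixed lines of \<open>g\<close>, that is, a
    point on its axis; its square is -2.\<close>
  define z where "z = (\<lambda>i. f i - x i)"
  have xf: "herm n x f = 1" using qcnj_herm[of n f x] x(3) by simp
  have "herm n z z = -1 + -1"
    unfolding z_def herm_diff_left herm_diff_right by (simp add: f(2) x(2,3) xf)
  then have "qRe (herm n z z) < 0" by (simp only: quat_sel)
  moreover have "z \<in> qvec n" unfolding z_def by (intro qvec_diff f(1) x(1))
  ultimately have z: "z \<in> qvec n" "qRe (herm n z z) < 0" by simp_all
  have tri: "norm (- a - b + c) \<le> norm a + norm b + norm c" for a b c :: quat
    using norm_triangle_ineq[of "- a - b" c] norm_triangle_ineq4[of "- a" b] by simp
  have bd: "norm (herm n z (mvec n (b k) z)) \<le>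
      norm (herm n f (mvec n h x)) + norm (lam h) + norm (herm n x (mvec n h x))" for k
  proof -
    \<comment> \<open>\<open>g^k\<close> pulls \<open>z\<close> back to
      \<open>f \<alpha> - x \<beta>\<close>, where \<open>|\<alpha>|\<close> grows with
      \<open>k\<close>. The term with \<open>|\<alpha>|^2\<close> carries the form value of
      \<open>f\<close> and \<open>h f\<close>, which is 0 because \<open>h\<close> fixes the
      isotropic line of \<open>f\<close>. In the other terms \<open>|\<alpha>| |\<beta>| = 1\<close>
      and \<open>|\<beta>| \<le> 1\<close>.\<close>
    define \<alpha> where "\<alpha> = inverse (lam (pw k))"
    define \<beta> where "\<beta> = inverse (\<mu> k)"
    have nz: "lam (pw k) \<noteq> 0" "\<mu> k \<noteq> 0" using lam_mu[of k] by auto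
    have ab: "norm \<alpha> * norm \<beta> = 1"
      using lam_mu[of k] unfolding \<alpha>_def \<beta>_def norm_inverse inverse_mult_distrib[symmetric] by simp
    have b1: "norm \<beta> \<le> 1"
    proof -
      have "norm \<beta> = norm (lam (pw k))"
        using lam_mu[of k] nz unfolding \<beta>_def norm_inverse by (simp add: field_simps)
      then show ?thesis using lt by (simp add: lam_pw power_le_one)
    qed
    define u where "u = (\<lambda>i. f i * \<alpha> - x i * \<beta>)"
    have u: "u \<in> qvec n" unfolding u_def by (intro qvec_diff qvec_scale f(1) x(1))
    have pu: "mvec n (pw k) u = z"
      unfolding u_def mvec_diff mvec_scale pwf \<mu> z_def \<alpha>_def \<beta>_def using nz by (simp add: mult.assoc)
    have "mvec n (b k) z = mvec n (pw k) (mvec n h u)"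
      using bpw[OF u, of 0 k] by (simp add: pu b0)
    then have "herm n z (mvec n (b k) z) = herm n u (mvec n h u)"
      using isom_herm[OF isom[OF pw], of k u "mvec n h u"] by (simp only: pu)
    also have "\<dots> = - (qcnj \<alpha> * herm n f (mvec n h x) * \<beta>) - qcnj \<beta> * lam h * \<alpha>
        + qcnj \<beta> * herm n x (mvec n h x) * \<beta>"
      unfolding u_def mvec_diff mvec_scale mvec_f[OF h] herm_lin
      by (simp add: f(2) xf mult.assoc left_diff_distrib)
    finally have eq: "herm n z (mvec n (b k) z) = - (qcnj \<alpha> * herm n f (mvec n h x) * \<beta>) - qcnj \<beta> * lam h * \<alpha>
        + qcnj \<beta> * herm n x (mvec n h x) * \<beta>" .
    have "norm (herm n z (mvec n (b k) z)) \<le> norm (qcnj \<alpha> * herm n f (mvec n h x) * \<beta>) + norm (qcnj \<beta> * lam h * \<alpha>)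
        + norm (qcnj \<beta> * herm n x (mvec n h x) * \<beta>)"
      unfolding eq by (rule tri)
    also have "norm (qcnj \<alpha> * herm n f (mvec n h x) * \<beta>) = (norm \<alpha> * norm \<beta>) * norm (herm n f (mvec n h x))"
      by (simp add: norm_mult mult_ac)
    also have "norm (qcnj \<beta> * lam h * \<alpha>) = (norm \<alpha> * norm \<beta>) * norm (lam h)"
      by (simp add: norm_mult mult_ac)
    also have "norm (qcnj \<beta> * herm n x (mvec n h x) * \<beta>) = (norm \<beta> * norm \<beta>) * norm (herm n x (mvec n h x))"
      by (simp add: norm_mult mult_ac)
    also have "(norm \<beta> * norm \<beta>) * norm (herm n x (mvec n h x)) \<le> 1 * norm (herm n x (mvec n h x))"
      using mult_mono[OF b1 b1] by (intro mult_right_mono) simp_all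
    finally show ?thesis unfolding ab by simp
  qed
  have bi: "b k \<in> isom n" for k by (rule isom[OF b])
  obtain B' where B': "\<forall>k i j. norm (b k i j) \<le> B'"
    using isom_bounded_displacement[of b n z, OF bi z bd] by (rule exE)
  obtain r E where r: "strict_mono (r :: nat \<Rightarrow> nat)" and "E \<in> qmat (Suc n)"
    and E: "\<And>i j. (\<lambda>k. b (r k) i j) \<longlonglongrightarrow> E i j"
    by (rule bounded_matrices_convergent_subseq[of b n B']) (simp_all add: qmat[OF b] B')
  obtain k where k: "b (r (Suc k)) = b (r k)"
    using discrete_convergent_repeats[OF disc, of "\<lambda>k. b (r k)" E] b E by blast
  have rk: "r k < r (Suc k)" using r by (simp add: strict_mono_def)
  define K where "K = r k"
  define p where "p = r (Suc k) - r k"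
  have p: "0 < p" "K + p = r (Suc k)" using rk by (simp_all add: p_def K_def)
  have bK: "b (K + p) = b K" unfolding p(2) unfolding K_def by (rule k)
  \<comment> \<open>\<open>b (K + p) = b K\<close> says that \<open>b K\<close> commutes with
    \<open>g^p\<close>, so \<open>y\<close> is an eigenvector of \<open>g^p\<close> with the
    expanding multiplier of \<open>x\<close>. Invariance of the form then equates
    \<open>|herm n x y|\<close> with a multiple of itself by a factor above 1, so it is 0, and
    orthogonal isotropic lines coincide.\<close>
  define y where "y = mvec n (b K) x"
  have y: "y \<in> qvec n" unfolding y_def by (rule mvec_in_qvec[OF qmat[OF b]])
  have yy: "herm n y y = 0" unfolding y_def isom_herm[OF isom[OF b]] by (rule x(2))
  have ry: "mvec n (pw p) y = (\<lambda>i. y i * \<mu> p)"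
  proof -
    have "mvec n (pw p) y = mvec n (b (K + p)) (mvec n (pw p) x)"
      unfolding y_def by (rule bpw[OF x(1), symmetric])
    also have "\<dots> = (\<lambda>i. mvec n (b K) x i * \<mu> p)"
      unfolding bK \<mu> mvec_scale ..
    finally show ?thesis unfolding y_def .
  qed
  have mu_gt: "1 < norm (\<mu> p)"
  proof -
    have "norm (lam (pw p)) < 1" unfolding lam_pw using lt p(1) by (simp add: power_less_one_iff)
    moreover have "norm (lam (pw p)) * norm (\<mu> p) \<le> norm (lam (pw p)) * 1" if "norm (\<mu> p) \<le> 1"
      by (rule mult_left_mono[OF that]) simp
    ultimately show ?thesis using lam_mu[of p] by (simp only: not_le[symmetric]) linarith
  qed
  have "herm n x y = qcnj (\<mu> p) * herm n x y * \<mu> p"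
    using isom_herm[OF isom[OF pw], of p x y] unfolding \<mu> ry herm_scale_left herm_scale_right
    by (simp add: mult.assoc)
  then have "norm (herm n x y) = norm (\<mu> p) * norm (herm n x y) * norm (\<mu> p)"
    by (metis norm_mult norm_qcnj)
  then have "norm (herm n x y) * (norm (\<mu> p) * norm (\<mu> p) - 1) = 0" by (simp add: algebra_simps)
  moreover have "1 < norm (\<mu> p) * norm (\<mu> p)" using mu_gt by (simp add: less_1_mult)
  ultimately have xy: "herm n x y = 0" by simp
  define c where "c = inverse (x n) * y n"
  have yc: "mvec n (b K) x = (\<lambda>i. x i * c)"
    using null_orth_parallel[OF x(1,2) y yy xy xn] unfolding c_def y_def .
  define m where "m = inverse (\<mu> K)"
  have "\<mu> K \<noteq> 0" using lam_mu[of K] by auto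
  then have m: "\<mu> K * m = 1" unfolding m_def by (rule right_inverse)
  \<comment> \<open>Powers of \<open>g\<close> fix the line of \<open>x\<close>, so undoing the
    conjugation carries the conclusion from \<open>b K\<close> over to \<open>h\<close>.\<close>
  have "mvec n (pw K) (mvec n h x) = mvec n (b K) (mvec n (pw K) x)"
    using bpw[OF x(1), of 0 K] by (simp add: b0)
  also have "\<dots> = (\<lambda>i. x i * (c * \<mu> K))" unfolding \<mu> mvec_scale yc by (simp add: mult.assoc)
  also have "\<dots> = mvec n (pw K) (\<lambda>i. x i * (m * (c * \<mu> K)))"
    unfolding mvec_scale \<mu> by (simp add: mult.assoc[symmetric]) (simp add: mult.assoc m)
  finally have "mvec n (adj n (pw K)) (mvec n (pw K) (mvec n h x)) =
      mvec n (adj n (pw K)) (mvec n (pw K) (\<lambda>i. x i * (m * (c * \<mu> K))))" by simp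
  then have "mvec n h x = (\<lambda>i. x i * (m * (c * \<mu> K)))"
    using mvec_adj_cancel(1)[OF isom[OF pw[of K]]] mvec_in_qvec[OF qmat[OF h]] qvec_scale[OF x(1)] by simp
  then show ?thesis by (rule exI)
qed

end

context isom_group
begin

text \<open>Discreteness is essential: the full stabiliser of a boundary point has many limit
  points. For a discrete group a fixed line \<open>e\<close> brings a second fixed line
  \<open>x'\<close>, the other end of a loxodromic axis. A third limit point \<open>p\<close> then
  contributes a rank one element that has to preserve both.\<close>

lemma no_fixed_boundary_point:
  assumes disc: "discrete_set (Suc n) \<Gamma>" and nonel: "nonelementary n \<Gamma>"
    and f: "f \<in> qvec n" "herm n f f = 0" "f n \<noteq> 0"
  shows "\<exists>A\<in>\<Gamma>. herm n f (mvec n A f) \<noteq> 0"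
proof (rule ccontr)
  assume "\<not> ?thesis"
  then have orth: "herm n f (mvec n A f) = 0" if "A \<in> \<Gamma>" for A using that by simp
  define e where "e = (\<lambda>i. f i * inverse (f n))"
  have e: "e \<in> qvec n" "herm n e e = 0" "e n = 1"
    using f by (simp_all add: e_def herm_scale_left herm_scale_right)
  interpret fixed_boundary_point n \<Gamma> e
  proof unfold_locales
    fix A i assume A: "A \<in> \<Gamma>"
    have "herm n (mvec n A f) (mvec n A f) = 0" by (simp only: isom_herm[OF isom[OF A]] f(2))
    from null_orth_parallel[OF f(1,2) mvec_in_qvec[OF qmat[OF A]] this orth[OF A] f(3)]
    have Af: "mvec n A f = (\<lambda>i. f i * (inverse (f n) * mvec n A f n))" .
    have "mvec n A e i = mvec n A f i * inverse (f n)" by (simp add: e_def mvec_scale)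
    also have "\<dots> = f i * (inverse (f n) * mvec n A f n) * inverse (f n)"
      by (subst Af) (rule refl)
    also have "\<dots> = e i * mvec n A e n" by (simp add: e_def mvec_scale mult.assoc)
    finally show "mvec n A e i = e i * mvec n A e n" .
  qed (rule e)+
  obtain a b c where abc: "a \<in> limit_set n \<Gamma>" "b \<in> limit_set n \<Gamma>" "c \<in> limit_set n \<Gamma>"
    "a \<noteq> b" "a \<noteq> c" "b \<noteq> c" using nonel unfolding nonelementary_def by auto
  have dist: "a(n := 1) \<noteq> b(n := 1)" "a(n := 1) \<noteq> c(n := 1)" "b(n := 1) \<noteq> c(n := 1)"
    using abc limit_set_lift_inj by blast+
  have third: "\<exists>\<xi>\<in>limit_set n \<Gamma>. \<xi>(n := 1) \<noteq> u \<and> \<xi>(n := 1) \<noteq> v" (is ?third) for u v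
  proof (rule ccontr)
    assume "\<not> ?third"
    then have "a(n := 1) = u \<or> a(n := 1) = v" "b(n := 1) = u \<or> b(n := 1) = v" "c(n := 1) = u \<or> c(n := 1) = v"
      using abc(1-3) by blast+
    then show False using dist by (elim disjE) simp_all
  qed
  obtain \<xi> where "\<xi> \<in> limit_set n \<Gamma>" "\<xi>(n := 1) \<noteq> e" using third[of e e] by blast
  from contracting_element[OF this] obtain g where g: "g \<in> \<Gamma>" "norm (lam g) < 1" by (rule bexE)
  obtain x where x: "x \<in> qvec n" "herm n x x = 0" "herm n e x = 1"
    and gx: "(\<lambda>i. mvec n g x i * qcnj (lam g)) = x"
    by (rule second_fixed_point[OF g])
  have fix_x: "\<exists>c. mvec n h x = (\<lambda>i. x i * c)" if "h \<in> \<Gamma>" for h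
    by (rule second_point_fixed[OF disc g x gx that])
  have "x \<noteq> (\<lambda>i. 0)" using x(3) by auto
  then have xn: "x n \<noteq> 0" by (rule null_last_nonzero[OF x(1,2)])
  define x' where "x' = (\<lambda>i. x i * inverse (x n))"
  have x': "x' \<in> qvec n" "herm n x' x' = 0" "x' n = 1" "herm n e x' \<noteq> 0"
    using x xn by (simp_all add: x'_def herm_scale_left herm_scale_right)
  have fix_x': "mvec n h x' i = x' i * mvec n h x' n" if h: "h \<in> \<Gamma>" for h i
  proof -
    obtain c where "mvec n h x = (\<lambda>i. x i * c)" using fix_x[OF h] by (rule exE)
    then show ?thesis using xn by (simp add: x'_def mvec_scale mult.assoc) (simp add: mult.assoc[symmetric])
  qed
  obtain \<zeta> where \<zeta>: "\<zeta> \<in> limit_set n \<Gamma>" "\<zeta>(n := 1) \<noteq> e" "\<zeta>(n := 1) \<noteq> x'" using third[of e x'] by blast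
  define p where "p = \<zeta>(n := 1)"
  have pn: "p n = 1" by (simp add: p_def)
  obtain y where y: "y \<in> qvec n" "herm n y y = 0" "y n \<noteq> 0" and E: "dyad n p y \<in> alg \<Gamma>"
    unfolding p_def by (rule alg_limit_point[OF \<zeta>(1)])
  \<comment> \<open>\<open>p y^* J\<close> maps \<open>v\<close> into the line of \<open>p\<close>;
    if it preserves a different line \<open>v\<close>, it must kill it. So \<open>v\<close> is
    orthogonal to \<open>y\<close>, and isotropic, hence the line of \<open>y\<close>. This applies
    to both \<open>e\<close> and \<open>x'\<close>, which are not orthogonal to each other.\<close>
  have line: "v = (\<lambda>i. y i * inverse (y n))"
    if v: "v \<in> qvec n" "herm n v v = 0" "v n = 1" "p \<noteq> v"
      and fix_v: "\<And>A i. A \<in> \<Gamma> \<Longrightarrow> mvec n A v i = v i * mvec n A v n" for v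
  proof -
    have "p i * herm n y v = v i * herm n y v" for i
      using alg_line[of v, OF fix_v E, of i] by (simp add: mvec_dyad pn)
    then have "herm n y v = 0" using v(4) by (auto simp: fun_eq_iff)
    from null_orth_parallel[OF y(1,2) v(1,2) this y(3)] show ?thesis by (simp add: v(3))
  qed
  have "e = x'"
    using line[OF e _ fixed] line[OF x'(1-3) _ fix_x'] \<zeta>(2,3) unfolding p_def[symmetric] by simp
  then show False using x'(4) e(2) by simp
qed

end

section \<open>Rank one elements and the trace condition\<close>

lemma norm_diff_sq_quat: "(norm (x - y))\<^sup>2 = (norm x)\<^sup>2 + (norm y)\<^sup>2 - 2 * qRe (x * qcnj y)"
  unfolding norm_quat_sq by (simp add: quat_mult_sel power2_eq_square algebra_simps)

text \<open>The equality case of \<open>|\<Sum> c\<^sub>l d cnj c\<^sub>l| \<le> |d|\<close>.\<close>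
lemma sum_conj_fixed_commute:
  fixes c :: "nat \<Rightarrow> quat"
  assumes c: "(\<Sum>l<n. (norm (c l))\<^sup>2) = 1" and d: "(\<Sum>l<n. c l * d * qcnj (c l)) = d" and l: "l < n"
  shows "c l * d = d * c l"
proof -
  \<comment> \<open>The sum of the squared commutators measures the defect in the inequality; it is
    \<open>2 |d|^2 - 2 |d|^2\<close>.\<close>
  have "(\<Sum>l<n. (norm (c l * d - d * c l))\<^sup>2) =
      (\<Sum>l<n. 2 * (norm d)\<^sup>2 * (norm (c l))\<^sup>2 - 2 * qRe (c l * d * qcnj (c l) * qcnj d))"
    by (rule sum.cong) (simp_all add: norm_diff_sq_quat norm_mult power_mult_distrib mult.assoc)
  also have "\<dots> = 2 * (norm d)\<^sup>2 * (\<Sum>l<n. (norm (c l))\<^sup>2) - 2 * qRe ((\<Sum>l<n. c l * d * qcnj (c l)) * qcnj d)"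
    by (simp only: sum_subtractf sum_distrib_left[symmetric] sum_distrib_right qRe_sum)
  also have "\<dots> = 0" by (simp only: c d qcnj_mult_self of_real_quat_sel mult_1_right)
  finally have "\<forall>l\<in>{..<n}. (norm (c l * d - d * c l))\<^sup>2 = 0"
    by (subst (asm) sum_nonneg_eq_0_iff) simp_all
  then show ?thesis using l by simp
qed

text \<open>The imaginary parts of commuting quaternions have vanishing cross product. The factor
  \<open>s / N\<close> is the projection of \<open>d\<close> onto the imaginary part of
  \<open>c\<close>.\<close>

lemma commute_imaginary_parallel:
  assumes cd: "c * d = d * c" and d: "qRe d = 0" and c: "c \<notin> \<real>"
  shows "\<exists>r. d = r *\<^sub>R (c - of_real (qRe c))"
proof -
  define N where "N = (qI c)\<^sup>2 + (qJ c)\<^sup>2 + (qK c)\<^sup>2"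
  define s where "s = qI c * qI d + qJ c * qJ d + qK c * qK d"
  have "N \<noteq> 0"
  proof
    assume "N = 0"
    then have "qI c = 0 \<and> qJ c = 0 \<and> qK c = 0"
      unfolding N_def by (simp add: add_nonneg_eq_0_iff)
    then have "qcnj c = c" by (simp add: quat_eq_iff)
    then show False using c by (simp add: Reals_quat_iff)
  qed
  have e: "qJ c * qK d = qK c * qJ d" "qI c * qK d = qK c * qI d" "qI c * qJ d = qJ c * qI d"
    using cd by (simp_all add: quat_eq_iff quat_mult_sel mult.commute)
  have "N * qI d = s * qI c" "N * qJ d = s * qJ c" "N * qK d = s * qK c"
    using e unfolding N_def s_def by algebra+
  then have "d = (s / N) *\<^sub>R (c - of_real (qRe c))"
    using d \<open>N \<noteq> 0\<close> by (simp add: quat_eq_iff field_simps)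
  then show ?thesis by (rule exI)
qed

lemma commute_two_imaginary_real:
  assumes "c * h = h * c" "c * j = j * c" "qRe h = 0" "qRe j = 0" "h \<noteq> 0" "\<And>r. j \<noteq> r *\<^sub>R h"
  shows "c \<in> \<real>"
proof (rule ccontr)
  assume c: "c \<notin> \<real>"
  define v where "v = c - of_real (qRe c)"
  obtain r where r: "h = r *\<^sub>R v"
    using commute_imaginary_parallel[OF assms(1,3) c] unfolding v_def by (rule exE)
  obtain s where s: "j = s *\<^sub>R v"
    using commute_imaginary_parallel[OF assms(2,4) c] unfolding v_def by (rule exE)
  have "r \<noteq> 0" using r assms(5) by auto
  then have "j = (s / r) *\<^sub>R h" by (simp add: r s)
  then show False using assms(6) by blast
qed

text \<open>The triangle inequality bounds \<open>|w n|^2 |d|\<close> by \<open>|d|\<close> times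
  the sum of the other \<open>|w l|^2\<close>, which is smaller than \<open>|w n|^2\<close> for a
  negative vector.\<close>

lemma negative_trace_nonzero:
  assumes w: "qRe (herm n w w) < 0" and d: "(\<Sum>l<n. w l * d * qcnj (w l)) = w n * d * qcnj (w n)"
  shows "d = 0"
proof (rule ccontr)
  assume "d \<noteq> 0"
  have "(norm (w n))\<^sup>2 * norm d = norm (\<Sum>l<n. w l * d * qcnj (w l))"
    unfolding d by (simp add: norm_mult power2_eq_square)
  also have "\<dots> \<le> (\<Sum>l<n. (norm (w l))\<^sup>2 * norm d)"
    by (rule sum_norm_le) (simp add: norm_mult power2_eq_square)
  also have "\<dots> = (\<Sum>l<n. (norm (w l))\<^sup>2) * norm d" by (simp only: sum_distrib_right)
  finally have "(norm (w n))\<^sup>2 \<le> (\<Sum>l<n. (norm (w l))\<^sup>2)" using \<open>d \<noteq> 0\<close> by simp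
  then show False using w unfolding qRe_herm_self by simp
qed

text \<open>Division by \<open>v n\<close> is on the left, unlike projective scaling: it conjugates
  the trace identity into \<open>\<Sum> c_l d cnj c_l = d\<close>, while isotropy makes the
  \<open>|c_l|^2\<close> sum to 1. That is the equality case of the triangle inequality.\<close>

lemma null_trace_zero_commute:
  assumes v: "herm n v v = 0" "v n \<noteq> 0" and d: "(\<Sum>l<n. v l * d * qcnj (v l)) = v n * d * qcnj (v n)"
    and l: "l < n"
  shows "(inverse (v n) * v l) * d = d * (inverse (v n) * v l)"
proof (rule sum_conj_fixed_commute[OF _ _ l])
  have "(\<Sum>l<n. (norm (inverse (v n) * v l))\<^sup>2) = (inverse (norm (v n)))\<^sup>2 * (\<Sum>l<n. (norm (v l))\<^sup>2)"
    by (simp add: norm_mult norm_inverse power_mult_distrib sum_distrib_left)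
  also have "\<dots> = 1" using v by (simp add: herm_self_eq_0 power_mult_distrib[symmetric])
  finally show "(\<Sum>l<n. (norm (inverse (v n) * v l))\<^sup>2) = 1" .
  have "(\<Sum>l<n. inverse (v n) * v l * d * qcnj (inverse (v n) * v l)) =
      inverse (v n) * (\<Sum>l<n. v l * d * qcnj (v l)) * qcnj (inverse (v n))"
    by (simp add: sum_distrib_left sum_distrib_right mult.assoc)
  also have "\<dots> = (inverse (v n) * v n) * d * qcnj (inverse (v n) * v n)"
    unfolding d by (simp only: mult.assoc qcnj_simps(7))
  finally show "(\<Sum>l<n. inverse (v n) * v l * d * qcnj (inverse (v n) * v l)) = d"
    using v(2) by simp
qed

lemma qtrace_dyad_scaled:
  "qtrace (Suc n) (dyad n (\<lambda>i. x i * d) y) = (\<Sum>l<n. x l * d * qcnj (y l)) - x n * d * qcnj (y n)"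
  unfolding qtrace_dyad sum_atMost_eps ..

lemma real_imaginary_zero: "x \<in> \<real> \<Longrightarrow> qcnj x = - x \<Longrightarrow> x = (0::quat)"
  unfolding Reals_quat_iff by (simp add: quat_eq_iff)

lemma herm_self_zero_if_qRe_zero: "herm n x x = 0" if "qRe (herm n x x) = 0"
  using herm_self_qRe[of n x] that by simp

section \<open>The invariant real space, its form values and the rank one coefficients\<close>

locale rank_one_generator = isom_group +
  fixes p :: "nat \<Rightarrow> quat"
  assumes p: "p \<in> qvec n" "herm n p p = 0" "p n = 1"
    and moved: "\<exists>A\<in>\<Gamma>. herm n p (mvec n A p) \<noteq> 0"
    and generator: "\<exists>d. d \<noteq> 0 \<and> dyad n (\<lambda>i. p i * d) p \<in> alg \<Gamma>"
    and trace_real: "A \<in> alg \<Gamma> \<Longrightarrow> qtrace (Suc n) A \<in> \<real>"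
begin

definition M :: "(nat \<Rightarrow> quat) set" where "M = (\<lambda>A. mvec n A p) ` alg \<Gamma>"
text \<open>These are all values of the form on \<open>M\<close>: pairing \<open>A p\<close> with
  \<open>y\<close> is pairing \<open>p\<close> with \<open>adj n A\<close> applied to
  \<open>y\<close>, which is again in \<open>M\<close>.\<close>

definition F :: "quat set" where "F = herm n p ` M"
text \<open>Multiplying by algebra elements on both sides moves the ends from \<open>p\<close> to
  arbitrary vectors of \<open>M\<close>, so the same coefficients serve for all of them.\<close>

definition Q :: "quat set" where "Q = {d. dyad n (\<lambda>i. p i * d) p \<in> alg \<Gamma>}"

lemma M_qvec: "x \<in> M \<Longrightarrow> x \<in> qvec n"
  by (auto simp: M_def alg_qmat)

lemma M_I: "A \<in> alg \<Gamma> \<Longrightarrow> mvec n A p \<in> M"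
  unfolding M_def by (rule imageI)

lemma M_add: "x \<in> M \<Longrightarrow> y \<in> M \<Longrightarrow> (\<lambda>i. x i + y i) \<in> M"
proof -
  assume "x \<in> M" "y \<in> M"
  then obtain A B where A: "A \<in> alg \<Gamma>" "x = mvec n A p" and B: "B \<in> alg \<Gamma>" "y = mvec n B p"
    unfolding M_def by (elim imageE) simp
  have "mvec n (\<lambda>i j. A i j + B i j) p = (\<lambda>i. x i + y i)"
    by (simp add: mvec_def A B distrib_right sum.distrib)
  then show ?thesis using M_I[OF alg.add[OF A(1) B(1)]] by simp
qed

lemma M_scale: "x \<in> M \<Longrightarrow> (\<lambda>i. c *\<^sub>R x i) \<in> M"
proof -
  assume "x \<in> M"
  then obtain A where A: "A \<in> alg \<Gamma>" "x = mvec n A p" unfolding M_def by (elim imageE) simp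
  have "mvec n (\<lambda>i j. c *\<^sub>R A i j) p = (\<lambda>i. c *\<^sub>R x i)"
    by (simp add: mvec_def A scaleR_sum_right)
  then show ?thesis using M_I[OF alg.scale[OF A(1)], of c] by simp
qed

lemma M_zero: "(\<lambda>i. 0) \<in> M" if "x \<in> M"
  using M_scale[OF that, of 0] by simp

lemma M_sum: "finite S \<Longrightarrow> x \<in> M \<Longrightarrow> (\<And>k. k \<in> S \<Longrightarrow> f k \<in> M) \<Longrightarrow> (\<lambda>i. \<Sum>k\<in>S. f k i) \<in> M"
proof (induction S rule: finite_induct)
  case empty
  then show ?case by (simp add: M_zero)
next
  case (insert k S)
  then show ?case using M_add[of "f k" "\<lambda>i. \<Sum>k\<in>S. f k i"] by simp
qed

lemma M_diff: "x \<in> M \<Longrightarrow> y \<in> M \<Longrightarrow> (\<lambda>i. x i - y i) \<in> M"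
  using M_add[OF _ M_scale[of y "-1"], of x] by simp

lemma M_alg: "A \<in> alg \<Gamma> \<Longrightarrow> x \<in> M \<Longrightarrow> mvec n A x \<in> M"
proof -
  assume A: "A \<in> alg \<Gamma>" and "x \<in> M"
  then obtain B where B: "B \<in> alg \<Gamma>" "x = mvec n B p" unfolding M_def by (elim imageE) simp
  show ?thesis using M_I[OF alg_qmult[OF B(1) A]] by (simp add: mvec_qmult alg_qmat[OF A] B(2))
qed

lemma M_group: "A \<in> \<Gamma> \<Longrightarrow> x \<in> M \<Longrightarrow> mvec n A x \<in> M"
  by (rule M_alg[OF alg.base])

lemma p_in_M: "p \<in> M"
  using M_I[OF alg.base[OF one]] by (simp add: mvec_qid p)

lemma M_dyad:
  assumes "u \<in> M" "v \<in> M" "d \<in> Q"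
  shows "dyad n (\<lambda>i. u i * d) v \<in> alg \<Gamma>"
proof -
  obtain A where A: "A \<in> alg \<Gamma>" "u = mvec n A p" using assms(1) unfolding M_def by (elim imageE) simp
  obtain B where B: "B \<in> alg \<Gamma>" "v = mvec n B p" using assms(2) unfolding M_def by (elim imageE) simp
  have "dyad n (\<lambda>i. p i * d) p \<in> alg \<Gamma>" using assms(3) unfolding Q_def by simp
  from alg_qmult[OF this A(1)] have "dyad n (\<lambda>i. u i * d) p \<in> alg \<Gamma>"
    by (simp add: qmult_dyad alg_qmat[OF A(1)] p mvec_scale A(2))
  from alg_qmult[OF alg_adj[OF B(1)] this] show ?thesis
    using M_qvec[OF assms(1)] by (simp add: dyad_qmult p alg_qmat[OF B(1)] B(2))
qed

lemma F_I: "x \<in> M \<Longrightarrow> herm n p x \<in> F"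
  unfolding F_def by (rule imageI)

lemma F_E: "c \<in> F \<Longrightarrow> (\<And>x. x \<in> M \<Longrightarrow> c = herm n p x \<Longrightarrow> thesis) \<Longrightarrow> thesis"
  unfolding F_def by blast

lemma herm_M: "x \<in> M \<Longrightarrow> y \<in> M \<Longrightarrow> herm n x y \<in> F"
proof -
  assume "x \<in> M" and y: "y \<in> M"
  then obtain A where A: "A \<in> alg \<Gamma>" "x = mvec n A p" unfolding M_def by (elim imageE) simp
  show ?thesis unfolding A(2) herm_adj by (intro F_I M_alg alg_adj A(1) y)
qed

lemma F_scale: "c \<in> F \<Longrightarrow> r *\<^sub>R c \<in> F"
  by (erule F_E) (auto simp: herm_scaleR_right[symmetric] intro: F_I M_scale)

lemma F_add: "c \<in> F \<Longrightarrow> d \<in> F \<Longrightarrow> c + d \<in> F"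
  by (elim F_E) (auto simp: herm_add_right[symmetric] intro: F_I M_add)

lemma F_diff: "c \<in> F \<Longrightarrow> d \<in> F \<Longrightarrow> c - d \<in> F"
  using F_add[OF _ F_scale[of d "-1"], of c] by simp

lemma F_qcnj: "c \<in> F \<Longrightarrow> qcnj c \<in> F"
  by (erule F_E) (simp add: qcnj_herm herm_M p_in_M)

lemma F_nonzero: "\<exists>c\<in>F. c \<noteq> 0"
  using moved F_I M_group p_in_M by blast

lemma Q_scale: "d \<in> Q \<Longrightarrow> r *\<^sub>R d \<in> Q"
proof -
  assume "d \<in> Q"
  then have "(\<lambda>i j. r *\<^sub>R dyad n (\<lambda>i. p i * d) p i j) \<in> alg \<Gamma>" unfolding Q_def by (intro alg.scale) simp
  then show ?thesis by (simp add: Q_def dyad_def)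
qed

lemma Q_add: "d \<in> Q \<Longrightarrow> d' \<in> Q \<Longrightarrow> d + d' \<in> Q"
proof -
  assume "d \<in> Q" "d' \<in> Q"
  then have "(\<lambda>i j. dyad n (\<lambda>i. p i * d) p i j + dyad n (\<lambda>i. p i * d') p i j) \<in> alg \<Gamma>"
    unfolding Q_def by (intro alg.add) simp_all
  then show ?thesis by (simp add: Q_def dyad_def distrib_left distrib_right)
qed

lemma Q_qcnj: "d \<in> Q \<Longrightarrow> qcnj d \<in> Q"
proof -
  assume "d \<in> Q"
  then have "adj n (dyad n (\<lambda>i. p i * d) p) \<in> alg \<Gamma>" unfolding Q_def by (intro alg_adj) simp
  then show ?thesis by (simp add: Q_def adj_dyad p) (simp add: dyad_def mult.assoc)
qed

text \<open>Multiplying \<open>p d p^* J\<close> by \<open>u d' p^* J\<close> inserts the form value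
  of \<open>p\<close> and \<open>u\<close> between the coefficients. Dually, applying
  \<open>u d p^* J\<close> to a vector of \<open>M\<close> and pairing with \<open>p\<close> gives
  \<open>FQF\<close>.\<close>

lemma QFQ: "d \<in> Q \<Longrightarrow> c \<in> F \<Longrightarrow> d' \<in> Q \<Longrightarrow> d * c * d' \<in> Q"
proof -
  assume d: "d \<in> Q" and "c \<in> F" and d': "d' \<in> Q"
  then obtain u where u: "u \<in> M" "c = herm n p u" by (elim F_E)
  have "qmult (Suc n) (dyad n (\<lambda>i. p i * d) p) (dyad n (\<lambda>i. u i * d') p) \<in> alg \<Gamma>"
    using d by (intro alg_qmult M_dyad u(1) p_in_M d') (simp add: Q_def)
  then show ?thesis
    using u by (simp add: Q_def qmult_dyad p M_qvec mvec_dyad herm_scale_right mult.assoc)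
qed

lemma FQF: "c \<in> F \<Longrightarrow> d \<in> Q \<Longrightarrow> c' \<in> F \<Longrightarrow> c * d * c' \<in> F"
proof -
  assume "c \<in> F" and d: "d \<in> Q" and "c' \<in> F"
  then obtain u u' where u: "u \<in> M" "c = herm n p u" and u': "u' \<in> M" "c' = herm n p u'"
    by (elim F_E)
  have "mvec n (dyad n (\<lambda>i. u i * d) p) u' \<in> M" by (intro M_alg M_dyad u(1) u'(1) p_in_M d)
  from F_I[OF this] show ?thesis
    unfolding mvec_dyad by (simp add: herm_scale_right mult.assoc u(2)[symmetric] u'(2)[symmetric])
qed

text \<open>With equal ends and imaginary \<open>d\<close> the trace is minus its conjugate, so a
  real one vanishes.\<close>

lemma trace_zero:
  assumes u: "u \<in> M" and d: "d \<in> Q" "qRe d = 0"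
  shows "(\<Sum>l<n. u l * d * qcnj (u l)) = u n * d * qcnj (u n)"
proof -
  define x where "x = (\<Sum>l<n. u l * d * qcnj (u l)) - u n * d * qcnj (u n)"
  have dd: "qcnj d = - d" using d(2) by (simp add: qcnj_eq_minus_iff)
  have "x \<in> \<real>" unfolding x_def qtrace_dyad_scaled[symmetric] by (intro trace_real M_dyad u d(1))
  moreover have "qcnj x = - x" unfolding x_def by (simp add: qcnj_sum dd mult.assoc sum_negf)
  ultimately have "x = 0" by (rule real_imaginary_zero)
  then show ?thesis unfolding x_def by simp
qed

text \<open>Averaging with the conjugate puts 1 into \<open>Q\<close>, after which \<open>F\<close>
  is closed under products and contained in \<open>Q\<close>. From \<open>-1 \<in> F\<close> a
  negative vector \<open>w\<close> of \<open>M\<close> is built. The imaginary part of a form value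
  is then an imaginary coefficient, which the trace at \<open>w\<close> forces to be 0.\<close>

lemma symmetric_case:
  assumes d: "d \<in> Q" "qRe d \<noteq> 0"
  shows "F \<subseteq> \<real>" "\<exists>w\<in>M. herm n w w = -1"
proof -
  have "d + qcnj d \<in> Q" by (intro Q_add Q_qcnj d(1))
  then have "(1 / (2 * qRe d)) *\<^sub>R (d + qcnj d) \<in> Q" by (rule Q_scale)
  moreover have "(1 / (2 * qRe d)) *\<^sub>R (d + qcnj d) = 1"
    using d(2) by (simp add: quat_add_qcnj quat_eq_iff del: of_real_mult)
  ultimately have 1: "1 \<in> Q" by simp
  obtain c where c: "c \<in> F" "c \<noteq> 0" using F_nonzero by blast
  \<comment> \<open>The quadratic equation \<open>c^2 - 2 Re(c) c + |c|^2 = 0\<close> exhibits a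
    nonzero real number in \<open>F\<close>.\<close>
  have "(2 * qRe c) *\<^sub>R c - c * c = (c + qcnj c) * c - c * c"
    unfolding quat_add_qcnj scaleR_conv_of_real ..
  also have "\<dots> = of_real ((norm c)\<^sup>2)" by (simp add: distrib_right qcnj_mult_self)
  finally have "of_real ((norm c)\<^sup>2) \<in> F"
    using F_diff[OF F_scale[OF c(1), of "2 * qRe c"] FQF[OF c(1) 1 c(1)]] by simp
  moreover have "(- 1 / (norm c)\<^sup>2) *\<^sub>R of_real ((norm c)\<^sup>2) = (-1 :: quat)"
    using c(2) by (simp add: quat_eq_iff del: of_real_power)
  ultimately have "-1 \<in> F" using F_scale[of "of_real ((norm c)\<^sup>2)" "- 1 / (norm c)\<^sup>2"] by simp
  then obtain u where u: "u \<in> M" "-1 = herm n p u" by (rule F_E)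
  have up: "herm n u p = -1" using qcnj_herm[of n p u] u(2)[symmetric] by simp
  \<comment> \<open>\<open>p\<close> is isotropic and \<open>herm n p u = -1\<close>, so adding
    \<open>t p\<close> to \<open>u\<close> changes its square by \<open>-2 t\<close>; this value
    makes it -1.\<close>
  define t where "t = (qRe (herm n u u) + 1) / 2"
  define w where "w = (\<lambda>i. t *\<^sub>R p i + u i)"
  have w: "w \<in> M" unfolding w_def by (intro M_add M_scale p_in_M u(1))
  have "herm n w w = herm n u u - of_real (2 * t)"
    unfolding w_def herm_add_left herm_add_right herm_scaleR_left herm_scaleR_right p(2) u(2)[symmetric] up
    by (simp add: quat_eq_iff del: of_real_mult)
  also have "\<dots> = of_real (qRe (herm n u u) - 2 * t)"
    by (subst herm_self_qRe) (simp only: of_real_diff)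
  also have "qRe (herm n u u) - 2 * t = -1" by (simp add: t_def field_simps)
  finally have ww: "herm n w w = -1" by simp
  then show "\<exists>w\<in>M. herm n w w = -1" using w by (rule bexI)
  show "F \<subseteq> \<real>"
  proof
    fix k assume k: "k \<in> F"
    have "k - qcnj k \<in> F" by (intro F_diff F_qcnj k)
    then have "k - qcnj k \<in> Q" using QFQ[OF 1 _ 1, of "k - qcnj k"] by simp
    moreover have "qRe (k - qcnj k) = 0" by simp
    ultimately have "(\<Sum>l<n. w l * (k - qcnj k) * qcnj (w l)) = w n * (k - qcnj k) * qcnj (w n)"
      by (rule trace_zero[OF w])
    from negative_trace_nonzero[OF _ this] have "k - qcnj k = 0" by (simp add: ww)
    then show "k \<in> \<real>" by (simp add: Reals_quat_iff)
  qed
qed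

text \<open>Two independent imaginary coefficients have only real numbers as common centraliser, so
  an isotropic vector of \<open>M\<close> is real up to a left factor. For \<open>p\<close> and a
  translate \<open>u\<close> not orthogonal to it, the sums then collapse: the trace of
  \<open>p d u^* J\<close> becomes \<open>\<beta> d cnj (u n)\<close> with a real
  \<open>\<beta> \<noteq> 0\<close>. Its reality confines \<open>d\<close> to a real line after
  all.\<close>

lemma imaginary_Q_parallel:
  assumes Q: "\<And>d. d \<in> Q \<Longrightarrow> qRe d = 0" and h: "h \<in> Q" "h \<noteq> 0" and j: "j \<in> Q"
  shows "\<exists>r. j = r *\<^sub>R h"
proof (rule ccontr)
  assume "\<not> ?thesis"
  then have nj: "j \<noteq> r *\<^sub>R h" for r by blast
  have real_coord: "inverse (v n) * v l \<in> \<real>" if v: "v \<in> M" "herm n v v = 0" "v n \<noteq> 0" and l: "l < n" for v l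
    by (rule commute_two_imaginary_real[OF null_trace_zero_commute[OF v(2,3) trace_zero[OF v(1) h(1)] l]
          null_trace_zero_commute[OF v(2,3) trace_zero[OF v(1) j] l] Q[OF h(1)] Q[OF j] h(2) nj])
      (rule Q[OF h(1)], rule Q[OF j])
  have "inverse (p n) * p l \<in> \<real>" if "l < n" for l
    by (rule real_coord[OF p_in_M p(2) _ that]) (simp add: p(3))
  then have pr: "p l \<in> \<real>" if "l < n" for l using that by (simp add: p(3))
  obtain A where A: "A \<in> \<Gamma>" "herm n p (mvec n A p) \<noteq> 0" using moved by blast
  define u where "u = mvec n A p"
  have u: "u \<in> M" unfolding u_def by (rule M_group[OF A(1) p_in_M])
  have uu: "herm n u u = 0" unfolding u_def isom_herm[OF isom[OF A(1)]] by (rule p(2))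
  have pu: "herm n p u \<noteq> 0" using A(2) by (simp add: u_def)
  have un: "u n \<noteq> 0"
  proof (rule null_last_nonzero[OF M_qvec[OF u] uu])
    show "u \<noteq> (\<lambda>i. 0)" using pu by auto
  qed
  define c where "c l = inverse (u n) * u l" for l
  have cr: "c l \<in> \<real>" if "l < n" for l unfolding c_def by (rule real_coord[OF u uu un that])
  have uc: "u l = u n * c l" for l unfolding c_def mult.assoc[symmetric] using un by simp
  \<comment> \<open>The form value of the real vectors underlying \<open>p\<close> and
    \<open>u\<close>, both normalised to last coordinate 1; hence the \<open>- 1\<close>.\<close>
  define \<beta> where "\<beta> = (\<Sum>l<n. qRe (p l) * qRe (c l)) - 1"
  have pl: "p l = of_real (qRe (p l))" "c l = of_real (qRe (c l))" if "l < n" for l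
    using Reals_quat_eq[OF pr[OF that]] Reals_quat_eq[OF cr[OF that]] by simp_all
  have "herm n p u = (\<Sum>l<n. qcnj (p l) * u l) - qcnj (p n) * u n"
    unfolding herm_def sum_atMost_eps ..
  also have "(\<Sum>l<n. qcnj (p l) * u l) = (\<Sum>l<n. (qRe (p l) * qRe (c l)) *\<^sub>R u n)"
  proof (rule sum.cong[OF refl])
    fix l assume "l \<in> {..<n}"
    then have l: "l < n" by simp
    have "qcnj (p l) * u l = of_real (qRe (p l)) * (u n * of_real (qRe (c l)))"
      using pl[OF l] uc[of l] by (metis qcnj_simps(4))
    then show "qcnj (p l) * u l = (qRe (p l) * qRe (c l)) *\<^sub>R u n"
      unfolding of_real_commute_quat[of "qRe (c l)" "u n", symmetric]
      by (simp add: scaleR_conv_of_real mult.assoc)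
  qed
  finally have "herm n p u = \<beta> *\<^sub>R u n"
    by (simp add: \<beta>_def p(3) scaleR_sum_left scaleR_diff_left)
  then have \<beta>: "\<beta> \<noteq> 0" using pu by auto
  have tr: "d * qcnj (u n) \<in> \<real>" if d: "d \<in> Q" for d
  proof -
    have "(\<Sum>l<n. p l * d * qcnj (u l)) = (\<Sum>l<n. (qRe (p l) * qRe (c l)) *\<^sub>R (d * qcnj (u n)))"
    proof (rule sum.cong[OF refl])
      fix l assume "l \<in> {..<n}"
      then have l: "l < n" by simp
      have "p l * d * qcnj (u l) = of_real (qRe (p l)) * d * (of_real (qRe (c l)) * qcnj (u n))"
        using pl[OF l] uc[of l] by (metis qcnj_simps(4) qcnj_simps(7))
      also have "\<dots> = of_real (qRe (p l)) * (d * of_real (qRe (c l)) * qcnj (u n))"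
        by (simp only: mult.assoc)
      also have "\<dots> = of_real (qRe (p l)) * (of_real (qRe (c l)) * d * qcnj (u n))"
        by (simp only: of_real_commute_quat)
      finally show "p l * d * qcnj (u l) = (qRe (p l) * qRe (c l)) *\<^sub>R (d * qcnj (u n))"
        by (simp add: scaleR_conv_of_real mult.assoc)
    qed
    then have "qtrace (Suc n) (dyad n (\<lambda>i. p i * d) u) = \<beta> *\<^sub>R (d * qcnj (u n))"
      unfolding qtrace_dyad_scaled by (simp add: \<beta>_def p(3) scaleR_sum_left scaleR_diff_left)
    moreover have "qtrace (Suc n) (dyad n (\<lambda>i. p i * d) u) \<in> \<real>"
      by (intro trace_real M_dyad p_in_M u d)
    ultimately have "(1 / \<beta>) *\<^sub>R (\<beta> *\<^sub>R (d * qcnj (u n))) \<in> \<real>"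
      by (simp only: scaleR_conv_of_real Reals_mult Reals_of_real)
    then show ?thesis using \<beta> by simp
  qed
  obtain a b where a: "h * qcnj (u n) = of_real a" and b: "j * qcnj (u n) = of_real b"
    using tr[OF h(1)] tr[OF j] by (elim Reals_cases)
  have "a \<noteq> 0"
  proof
    assume "a = 0"
    then have "h * qcnj (u n) = 0" using a by simp
    then show False using h(2) un by simp
  qed
  then have "j * qcnj (u n) = (b / a) *\<^sub>R (h * qcnj (u n))" unfolding a b by (simp add: quat_eq_iff)
  then have "(j - (b / a) *\<^sub>R h) * qcnj (u n) = 0" by (simp add: left_diff_distrib)
  then have "j = (b / a) *\<^sub>R h" using un by simp
  then show False using nj by blast
qed

text \<open>\<open>h * c * h\<close> lies in \<open>Q\<close>, the real line of \<open>h\<close>.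
  Since \<open>h * h\<close> is a nonzero real number, cancelling \<open>h\<close> on both sides
  makes \<open>c\<close> a real multiple of \<open>h\<close> too.\<close>

lemma antisymmetric_case:
  assumes Q: "\<And>d. d \<in> Q \<Longrightarrow> qRe d = 0"
  obtains h where "h \<noteq> 0" "qRe h = 0" "\<And>c. c \<in> F \<Longrightarrow> \<exists>r. c = r *\<^sub>R h"
proof -
  obtain h where h: "h \<in> Q" "h \<noteq> 0" using generator unfolding Q_def by blast
  have hh: "h * h = of_real (- (norm h)\<^sup>2)"
  proof -
    have "qcnj h = - h" using Q[OF h(1)] by (simp add: qcnj_eq_minus_iff)
    then have "- (h * h) = of_real ((norm h)\<^sup>2)"
      using qcnj_mult_self(1)[of h] by (simp only: minus_mult_left)
    from arg_cong[OF this, of uminus] show ?thesis by (simp only: minus_minus of_real_minus)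
  qed
  have "\<exists>r. c = r *\<^sub>R h" if c: "c \<in> F" for c
  proof -
    from imaginary_Q_parallel[OF Q h QFQ[OF h(1) c h(1)]] obtain r where r: "h * c * h = r *\<^sub>R h" by blast
    have "(norm h)\<^sup>2 *\<^sub>R (norm h)\<^sup>2 *\<^sub>R c = (h * h) * c * (h * h)"
      unfolding hh by (simp add: quat_eq_iff quat_mult_sel del: of_real_power of_real_minus)
    also have "\<dots> = h * (h * c * h) * h" by (simp only: mult.assoc)
    also have "\<dots> = r *\<^sub>R ((h * h) * h)" unfolding r by (simp add: mult.assoc)
    also have "\<dots> = (- (norm h)\<^sup>2 * r) *\<^sub>R h"
      unfolding hh by (simp add: quat_eq_iff quat_mult_sel del: of_real_power of_real_minus)
    finally have "(norm h)\<^sup>2 *\<^sub>R (norm h)\<^sup>2 *\<^sub>R c = (- (norm h)\<^sup>2 * r) *\<^sub>R h" .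
    then have "(1 / (norm h)\<^sup>2) *\<^sub>R (1 / (norm h)\<^sup>2) *\<^sub>R (norm h)\<^sup>2 *\<^sub>R (norm h)\<^sup>2 *\<^sub>R c =
      (1 / (norm h)\<^sup>2) *\<^sub>R (1 / (norm h)\<^sup>2) *\<^sub>R (- (norm h)\<^sup>2 * r) *\<^sub>R h" by simp
    then have "c = (- r / (norm h)\<^sup>2) *\<^sub>R h" using h(2) by simp
    then show ?thesis by (rule exI)
  qed
  then show thesis using that[OF h(2) Q[OF h(1)]] by blast
qed

end

text \<open>A limit point gives \<open>E = p y^* J\<close> with possibly different ends.
  \<open>E A adj E\<close> has \<open>p\<close> at both ends, and its coefficient, the form value of
  \<open>y\<close> and \<open>A y\<close>, is nonzero for some \<open>A\<close> because the group
  does not fix the line of \<open>y\<close>.\<close>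

lemma (in isom_group) rank_one_generator_exists:
  assumes disc: "discrete_set (Suc n) \<Gamma>" and nonel: "nonelementary n \<Gamma>"
    and tr: "\<And>A. A \<in> \<Gamma> \<Longrightarrow> qtrace (Suc n) A \<in> \<real>"
  shows "\<exists>p. rank_one_generator n \<Gamma> p"
proof -
  obtain \<xi> where \<xi>: "\<xi> \<in> limit_set n \<Gamma>" using nonel unfolding nonelementary_def by auto
  define p where "p = \<xi>(n := 1)"
  have p: "p \<in> qvec n" "herm n p p = 0" "p n = 1"
    unfolding p_def using limit_set_null[OF \<xi>] by simp_all
  obtain y where y: "y \<in> qvec n" "herm n y y = 0" "y n \<noteq> 0" and E: "dyad n p y \<in> alg \<Gamma>"
    unfolding p_def by (rule alg_limit_point[OF \<xi>])
  obtain A where A: "A \<in> \<Gamma>" "herm n y (mvec n A y) \<noteq> 0"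
    using no_fixed_boundary_point[OF disc nonel y] by (rule bexE)
  have "qmult (Suc n) (dyad n p y) (qmult (Suc n) A (adj n (dyad n p y))) \<in> alg \<Gamma>"
    by (intro alg_qmult alg_adj E alg.base A(1))
  then have "dyad n (\<lambda>i. p i * herm n y (mvec n A y)) p \<in> alg \<Gamma>"
    using qmat[OF A(1)] by (simp add: adj_dyad p y qmult_dyad mvec_dyad)
  then have "\<exists>d. d \<noteq> 0 \<and> dyad n (\<lambda>i. p i * d) p \<in> alg \<Gamma>" using A(2) by blast
  moreover have "\<exists>A\<in>\<Gamma>. herm n p (mvec n A p) \<noteq> 0"
    by (rule no_fixed_boundary_point[OF disc nonel p(1,2)]) (simp add: p(3))
  moreover have "qtrace (Suc n) A \<in> \<real>" if "A \<in> alg \<Gamma>" for A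
    by (rule alg_trace_real[OF tr that])
  ultimately have r: "rank_one_generator n \<Gamma> p"
    by (intro rank_one_generator.intro rank_one_generator_axioms.intro isom_group_axioms p)
  show ?thesis by (rule exI[of _ p]) (rule r)
qed

section \<open>Block form\<close>

lemma herm_bvec_bvec: "i \<le> n \<Longrightarrow> herm n (bvec i) (bvec j) = (if i = j then eps n i else 0)"
  by (simp add: herm_bvec) (simp add: bvec_def)

lemma conjugate_entry:
  assumes D: "D \<in> isom n" and A: "A \<in> qmat (Suc n)" and ij: "i \<le> n" "j \<le> n"
  shows "qmult (Suc n) (qmult (Suc n) (adj n D) A) D i j =
    eps n i * herm n (mvec n D (bvec i)) (mvec n A (mvec n D (bvec j)))"
proof -
  define B where "B = qmult (Suc n) (qmult (Suc n) (adj n D) A) D"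
  have "mvec n B (bvec j) = mvec n (adj n D) (mvec n A (mvec n D (bvec j)))"
    unfolding B_def by (simp add: mvec_qmult)
  then have "herm n (mvec n D (bvec i)) (mvec n A (mvec n D (bvec j))) = herm n (bvec i) (mvec n B (bvec j))"
    by (simp add: herm_adj)
  also have "\<dots> = eps n i * B i j" unfolding mvec_bvec[OF ij(2)] by (rule herm_bvec[OF ij(1)])
  finally show ?thesis by (simp add: B_def)
qed

lemma sum_atMost_add: "(\<Sum>l\<le>k + m. f l) = (\<Sum>l<k. f l) + (\<Sum>l\<le>m. f (k + l))" for f :: "nat \<Rightarrow> quat"
proof (induction m)
  case 0
  have "{..k} = insert k {..<k}" by auto
  then show ?case by (simp add: add.commute)
qed (simp add: add.assoc)

lemma block_sum_intro:
  assumes B: "B \<in> isom (k + m)"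
    and off: "\<And>i j. i < k \<and> k \<le> j \<or> k \<le> i \<and> j < k \<Longrightarrow> B i j = 0"
  defines "L \<equiv> \<lambda>i j. if i < m + 1 \<and> j < m + 1 then B (k + i) (k + j) else 0"
  shows "L \<in> qmat (m + 1)"
    and "qmult (m + 1) (qmult (m + 1) (qct L) (Iform m)) L = Iform m"
    and "L \<in> G \<Longrightarrow> B \<in> block_sum k (m + 1) (Sp_k k) G"
proof -
  have col: "herm (k + m) (\<lambda>l. B l i) (\<lambda>l. B l j) = (if i = j then eps (k + m) i else 0)"
    if "i \<le> k + m" "j \<le> k + m" for i j
    using isom_herm[OF B, of "bvec i" "bvec j"] unfolding mvec_bvec[OF that(1)] mvec_bvec[OF that(2)]
    by (simp only: herm_bvec_bvec[OF that(1)])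
  show Lq: "L \<in> qmat (m + 1)" by (auto simp: qmat_def L_def)
  have eps_shift: "eps (k + m) (k + l) = eps m l" for l by (simp add: eps_def)
  have low: "herm m (\<lambda>l. L l i) (\<lambda>l. L l j) = (if i = j then eps m i else 0)" if ij: "i \<le> m" "j \<le> m" for i j
  proof -
    have "herm (k + m) (\<lambda>l. B l (k + i)) (\<lambda>l. B l (k + j)) = herm m (\<lambda>l. L l i) (\<lambda>l. L l j)"
      unfolding herm_def sum_atMost_add eps_shift using ij by (simp add: off L_def less_Suc_eq_le)
    then show ?thesis using col[of "k + i" "k + j"] ij by (cases "i = j") (simp_all add: eps_shift)
  qed
  have "qmult (Suc m) (adj m L) L = qid (Suc m)"
  proof (intro ext)
    fix i j
    show "qmult (Suc m) (adj m L) L i j = qid (Suc m) i j"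
    proof (cases "i \<le> m \<and> j \<le> m")
      case True
      have "qmult (Suc m) (adj m L) L i j = eps m i * herm m (\<lambda>l. L l i) (\<lambda>l. L l j)"
        using True unfolding qmult_Suc herm_def sum_distrib_left
        by (simp add: adj_def mult.assoc) (rule sum.cong, simp_all add: eps_def)
      then show ?thesis using True by (simp add: low qid_Suc)
    qed (auto simp: qmult_Suc qid_Suc)
  qed
  then show "qmult (m + 1) (qmult (m + 1) (qct L) (Iform m)) L = Iform m"
    unfolding Suc_eq_plus1[symmetric] Iform_eq_iff .
  define U where "U = (\<lambda>i j. if i < k \<and> j < k then B i j else 0)"
  have "qmult k (qct U) U i j = qid k i j" for i j
  proof (cases "i < k \<and> j < k")
    case True
    have "herm (k + m) (\<lambda>l. B l i) (\<lambda>l. B l j) = (\<Sum>l<k. qcnj (B l i) * B l j)"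
      unfolding herm_def sum_atMost_add using True by (simp add: off) (simp add: eps_def)
    then show ?thesis using True col[of i j]
      by (cases "i = j") (simp_all add: qmult_def qid_def qct_def U_def eps_def)
  qed (auto simp: qmult_def qid_def)
  then have "qmult k (qct U) U = qid k" by (simp add: fun_eq_iff)
  then have U: "U \<in> Sp_k k" by (auto simp: Sp_k_def qmat_def U_def)
  assume "L \<in> G"
  then show "B \<in> block_sum k (m + 1) (Sp_k k) G"
    using isom_qmat[OF B] off U unfolding block_sum_def L_def U_def by simp
qed

lemma is_real_q_iff: "is_real_q x \<longleftrightarrow> x \<in> \<real>"
  by (auto simp: is_real_q_def Reals_quat_iff quat_eq_iff)

text \<open>Upper right entries pair vectors orthogonal to \<open>S\<close> with vectors of
  \<open>S\<close>. For the lower left ones the adjoint moves the group element to the other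
  argument, where it preserves \<open>S\<close> as well.\<close>

lemma (in isom_group) conjugate_block_form:
  assumes D: "D \<in> isom n" and m: "m \<le> n"
    and S: "\<And>A x. A \<in> \<Gamma> \<Longrightarrow> x \<in> S \<Longrightarrow> mvec n A x \<in> S"
    and DS: "\<And>j. n - m \<le> j \<Longrightarrow> j \<le> n \<Longrightarrow> mvec n D (bvec j) \<in> S"
    and orth: "\<And>i x. i < n - m \<Longrightarrow> x \<in> S \<Longrightarrow> herm n (mvec n D (bvec i)) x = 0"
    and A: "A \<in> \<Gamma>"
  defines "B \<equiv> qmult (Suc n) (qmult (Suc n) (adj n D) A) D"
  defines "L \<equiv> \<lambda>i j. if i < m + 1 \<and> j < m + 1 then B (n - m + i) (n - m + j) else 0"
  shows "L \<in> qmat (m + 1)"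
    and "qmult (m + 1) (qmult (m + 1) (qct L) (Iform m)) L = Iform m"
    and "L \<in> G \<Longrightarrow> B \<in> block_sum (n - m) (m + 1) (Sp_k (n - m)) G"
proof -
  have nm: "n - m + m = n" using m by simp
  have B: "B \<in> isom (n - m + m)"
    unfolding nm B_def by (intro isom_qmult isom_adj D isom A)
  have entry: "B i j = eps n i * herm n (mvec n D (bvec i)) (mvec n A (mvec n D (bvec j)))"
    if "i \<le> n" "j \<le> n" for i j
    unfolding B_def by (rule conjugate_entry[OF D qmat[OF A] that])
  have off: "B i j = 0" if "i < n - m \<and> n - m \<le> j \<or> n - m \<le> i \<and> j < n - m" for i j
  proof (cases "i \<le> n \<and> j \<le> n")
    case True
    from that show ?thesis
    proof (elim disjE conjE)
      assume "i < n - m" "n - m \<le> j"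
      then have "herm n (mvec n D (bvec i)) (mvec n A (mvec n D (bvec j))) = 0"
        using True by (intro orth S A DS) simp_all
      then show ?thesis using entry True by simp
    next
      assume "n - m \<le> i" "j < n - m"
      then have "herm n (mvec n D (bvec j)) (mvec n (adj n A) (mvec n D (bvec i))) = 0"
        using True by (intro orth S adj A DS) simp_all
      then have "herm n (mvec n (adj n A) (mvec n D (bvec i))) (mvec n D (bvec j)) = 0"
        by (rule herm_zero_sym)
      then have "herm n (mvec n D (bvec i)) (mvec n A (mvec n D (bvec j))) = 0"
        by (simp only: herm_adj'[OF qmat[OF A]])
      then show ?thesis using entry True by simp
    qed
  next
    case False
    then show ?thesis using isom_qmat[OF B[unfolded nm]] by (auto simp: qmat_Suc_iff)
  qed
  note * = block_sum_intro[OF B off, folded L_def]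
  show "L \<in> qmat (m + 1)" by (rule *(1))
  show "qmult (m + 1) (qmult (m + 1) (qct L) (Iform m)) L = Iform m" by (rule *(2))
  show "L \<in> G \<Longrightarrow> B \<in> block_sum (n - m) (m + 1) (Sp_k (n - m)) G" by (rule *(3))
qed

section \<open>The symmetric case: a real form and O(m,1)\<close>

context rank_one_generator
begin

definition frame :: "(nat \<Rightarrow> quat) \<Rightarrow> nat \<Rightarrow> (nat \<Rightarrow> nat \<Rightarrow> quat) \<Rightarrow> bool" where
  "frame w m e \<longleftrightarrow> (\<forall>k<m. e k \<in> M \<and> herm n w (e k) = 0 \<and>
     (\<forall>l<m. herm n (e k) (e l) = (if k = l then 1 else 0)))"

text \<open>Gram-Schmidt over the reals: as form values on \<open>M\<close> are real, subtracting
  projections does not leave \<open>M\<close>. A nonzero remainder would be orthogonal to the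
  negative \<open>w\<close>, hence positive, and once normalised would enlarge the frame. The minus
  sign reflects \<open>herm n w w = -1\<close>.\<close>

lemma maximal_frame_spans:
  assumes real: "F \<subseteq> \<real>" and w: "w \<in> M" "herm n w w = -1" and e: "frame w m e"
    and max: "\<And>e'. \<not> frame w (Suc m) e'" and x: "x \<in> M"
  shows "x = (\<lambda>i. (\<Sum>k<m. qRe (herm n (e k) x) *\<^sub>R e k i) - qRe (herm n w x) *\<^sub>R w i)"
proof -
  have eM: "e k \<in> M" and we: "herm n w (e k) = 0" if "k < m" for k
    using e that by (auto simp: frame_def)
  have ee: "herm n (e k) (e l) = (if k = l then 1 else 0)" if "k < m" "l < m" for k l
    using e that by (auto simp: frame_def)
  have re: "of_real (qRe (herm n u v)) = herm n u v" if "u \<in> M" "v \<in> M" for u v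
    using Reals_quat_eq[of "herm n u v"] real herm_M[OF that] by auto
  define y where "y = (\<lambda>i. \<Sum>k<m. qRe (herm n (e k) x) *\<^sub>R e k i)"
  define x' where "x' = (\<lambda>i. x i - (y i - qRe (herm n w x) *\<^sub>R w i))"
  have y: "y \<in> M" unfolding y_def by (rule M_sum[OF _ x]) (auto intro: M_scale eM)
  have x': "x' \<in> M" unfolding x'_def by (intro M_diff M_scale x y w(1))
  have hy: "herm n u y = (\<Sum>k<m. qRe (herm n (e k) x) *\<^sub>R herm n u (e k))" for u
    unfolding y_def herm_sum_right herm_scaleR_right ..
  have "herm n w y = 0" unfolding hy by (simp add: we)
  then have wx': "herm n w x' = 0"
    unfolding x'_def herm_diff_right herm_scaleR_right using re[OF w(1) x] w(2)
    by (simp add: scaleR_conv_of_real)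
  have ex': "herm n (e j) x' = 0" if j: "j < m" for j
  proof -
    have "herm n (e j) y = (\<Sum>k<m. if k = j then of_real (qRe (herm n (e j) x)) else 0)"
      unfolding hy by (rule sum.cong) (use j in \<open>auto simp: ee scaleR_conv_of_real\<close>)
    then have "herm n (e j) y = of_real (qRe (herm n (e j) x))" using j by simp
    then have "herm n (e j) y = herm n (e j) x" by (simp only: re[OF eM[OF j] x])
    then show ?thesis
      unfolding x'_def herm_diff_right herm_scaleR_right using herm_zero_sym[OF we[OF j]] by simp
  qed
  have "x' = (\<lambda>i. 0)"
  proof (rule ccontr)
    assume nz: "x' \<noteq> (\<lambda>i. 0)"
    define s where "s = qRe (herm n x' x')"
    have s: "0 < s" unfolding s_def
      by (rule herm_pos_orth[OF M_qvec[OF w(1)] _ M_qvec[OF x'] wx' nz]) (simp add: w(2))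
    define v where "v = (\<lambda>i. (1 / sqrt s) *\<^sub>R x' i)"
    have v: "v \<in> M" unfolding v_def by (intro M_scale x')
    have xx': "herm n x' x' = of_real s" unfolding s_def by (rule herm_self_qRe)
    have "herm n v v = of_real ((1 / sqrt s) * ((1 / sqrt s) * s))"
      unfolding v_def herm_scaleR_left herm_scaleR_right xx' by (simp only: scaleR_conv_of_real of_real_mult)
    also have "(1 / sqrt s) * ((1 / sqrt s) * s) = 1" using s by (simp add: field_simps)
    finally have vv: "herm n v v = 1" by simp
    have wv: "herm n w v = 0" unfolding v_def herm_scaleR_right wx' by simp
    have ev: "herm n (e j) v = 0" if "j < m" for j
      unfolding v_def herm_scaleR_right ex'[OF that] by simp
    have "frame w (Suc m) (e(m := v))"
      unfolding frame_def
    proof (intro allI impI conjI)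
      fix k assume k: "k < Suc m"
      show "(e(m := v)) k \<in> M" using k eM v by (auto simp: less_Suc_eq)
      show "herm n w ((e(m := v)) k) = 0" using k we wv by (auto simp: less_Suc_eq)
      fix l assume l: "l < Suc m"
      show "herm n ((e(m := v)) k) ((e(m := v)) l) = (if k = l then 1 else 0)"
        using k l ee ev vv herm_zero_sym[OF ev] by (auto simp: less_Suc_eq)
    qed
    then show False using max by blast
  qed
  then have "x i - (y i - qRe (herm n w x) *\<^sub>R w i) = 0" for i by (simp add: x'_def fun_eq_iff)
  then show ?thesis unfolding y_def by (intro ext) simp
qed

text \<open>The rank one element attached to \<open>\<xi>\<close> maps \<open>w\<close> to a vector
  of \<open>M\<close> on the line of \<open>\<xi>\<close>, nonzero because an isotropic vector is
  never orthogonal to a negative one.\<close>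

lemma limit_point_in_M:
  assumes \<xi>: "\<xi> \<in> limit_set n \<Gamma>" and w: "w \<in> M" "herm n w w = -1"
  shows "\<exists>s. s \<noteq> 0 \<and> (\<lambda>i. (\<xi>(n := 1)) i * s) \<in> M"
proof -
  obtain y where y: "y \<in> qvec n" "herm n y y = 0" "y n \<noteq> 0" and E: "dyad n (\<xi>(n := 1)) y \<in> alg \<Gamma>"
    by (rule alg_limit_point[OF \<xi>])
  have "herm n y w \<noteq> 0"
  proof
    assume "herm n y w = 0"
    moreover have "y \<noteq> (\<lambda>i. 0)" using y(3) by auto
    ultimately have "0 < qRe (herm n y y)"
      by (intro herm_pos_orth[OF M_qvec[OF w(1)] _ y(1) herm_zero_sym]) (simp_all add: w(2))
    then show False by (simp add: y(2))
  qed
  moreover have "(\<lambda>i. (\<xi>(n := 1)) i * herm n y w) \<in> M"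
    using M_alg[OF E w(1)] unfolding mvec_dyad .
  ultimately show ?thesis by (intro exI[of _ "herm n y w"] conjI)
qed

text \<open>Every limit point has a representative in \<open>M\<close>. For a frame of size 1 the
  isotropic vectors of \<open>M\<close> lie on the lines of \<open>w + e 0\<close> and
  \<open>w - e 0\<close>, and for size 0 only the zero vector is isotropic; either way there are at
  most two limit points.\<close>

lemma frame_size:
  assumes real: "F \<subseteq> \<real>" and w: "w \<in> M" "herm n w w = -1" and e: "frame w m e"
    and max: "\<And>e'. \<not> frame w (Suc m) e'" and nonel: "nonelementary n \<Gamma>"
  shows "2 \<le> m"
proof (rule ccontr)
  assume "\<not> 2 \<le> m"
  then have m: "m = 0 \<or> m = 1" by linarith
  define c where "c \<sigma> = (\<lambda>i. \<sigma> *\<^sub>R e 0 i + w i)" for \<sigma> :: real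
  have two: "\<xi>(n := 1) = (\<lambda>i. c 1 i * inverse (c 1 n)) \<or> \<xi>(n := 1) = (\<lambda>i. c (-1) i * inverse (c (-1) n))"
    if \<xi>: "\<xi> \<in> limit_set n \<Gamma>" for \<xi>
  proof -
    define p' where "p' = \<xi>(n := (1::quat))"
    obtain s where s: "s \<noteq> 0" and z: "(\<lambda>i. p' i * s) \<in> M"
      using limit_point_in_M[OF \<xi> w] unfolding p'_def by blast
    define z where "z = (\<lambda>i. p' i * s)"
    have zM: "z \<in> M" unfolding z_def by (rule z)
    have zz: "herm n z z = 0"
      unfolding z_def p'_def herm_scale_left herm_scale_right limit_set_null(2)[OF \<xi>] by simp
    have zn: "z n = s" by (simp add: z_def p'_def)
    define a where "a = - qRe (herm n w z)"
    define b where "b = qRe (herm n (e 0) z)"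
    have dec: "z = (\<lambda>i. (\<Sum>k<m. qRe (herm n (e k) z) *\<^sub>R e k i) + a *\<^sub>R w i)"
      using maximal_frame_spans[OF real w e max zM] by (simp add: a_def)
    from m show ?thesis
    proof
      assume m0: "m = 0"
      then have z0: "z = (\<lambda>i. a *\<^sub>R w i)" using dec by simp
      have "herm n z z = of_real (- (a * a))"
        unfolding z0 herm_scaleR_left herm_scaleR_right w(2)
        by (simp add: quat_eq_iff del: of_real_mult of_real_minus)
      then have "a = 0" using zz by (simp del: of_real_minus of_real_mult)
      then have "z n = 0" using dec m0 by simp
      then show ?thesis using zn s by simp
    next
      assume m1: "m = 1"
      have e0: "herm n (e 0) (e 0) = 1" "herm n w (e 0) = 0" using e m1 by (simp_all add: frame_def)
      have zab: "z = (\<lambda>i. b *\<^sub>R e 0 i + a *\<^sub>R w i)" using dec m1 by (simp add: b_def)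
      have "herm n z z = of_real (b * b - a * a)"
        unfolding zab herm_add_left herm_add_right herm_scaleR_left herm_scaleR_right w(2) e0
          herm_zero_sym[OF e0(2)] by (simp add: quat_eq_iff del: of_real_mult of_real_diff)
      then have "b * b = a * a" using zz by (simp del: of_real_diff of_real_mult)
      then have ba: "b = a \<or> b = - a" by (metis square_eq_iff)
      define \<sigma> where "\<sigma> = (if b = a then 1 else -1 :: real)"
      have \<sigma>: "b = a * \<sigma>" using ba by (auto simp: \<sigma>_def)
      have zc: "z i = a *\<^sub>R c \<sigma> i" for i unfolding zab c_def \<sigma> by (simp add: scaleR_add_right)
      have a0: "a \<noteq> 0" using zc[of n] zn s by auto
      have cn: "c \<sigma> n \<noteq> 0" using zc[of n] zn s by auto
      have "p' i = c \<sigma> i * inverse (c \<sigma> n)" for i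
      proof -
        have "p' i = z i * inverse s" using s by (simp add: z_def mult.assoc)
        also have "\<dots> = a *\<^sub>R c \<sigma> i * inverse (a *\<^sub>R c \<sigma> n)" by (simp only: zn[symmetric] zc)
        also have "\<dots> = c \<sigma> i * inverse (c \<sigma> n)" using a0 by (simp add: inverse_scaleR_distrib)
        finally show ?thesis .
      qed
      then have "p' = (\<lambda>i. c \<sigma> i * inverse (c \<sigma> n))" ..
      then show ?thesis unfolding p'_def \<sigma>_def by (auto split: if_splits)
    qed
  qed
  obtain x y z where xyz: "x \<in> limit_set n \<Gamma>" "y \<in> limit_set n \<Gamma>" "z \<in> limit_set n \<Gamma>"
    "x \<noteq> y" "x \<noteq> z" "y \<noteq> z" using nonel unfolding nonelementary_def by auto
  have "x(n := 1) = y(n := 1) \<or> x(n := 1) = z(n := 1) \<or> y(n := 1) = z(n := 1)"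
    using two[OF xyz(1)] two[OF xyz(2)] two[OF xyz(3)] by (elim disjE) simp_all
  then show False using xyz limit_set_lift_inj by blast
qed

text \<open>A maximal frame together with \<open>w\<close> spans \<open>M\<close> over the reals and
  is orthonormal for the quaternionic form, so \<open>D\<close> can carry the last
  \<open>m + 1\<close> standard vectors to it. The lower block of a conjugated element then
  consists, up to signs, of form values on \<open>M\<close>.\<close>

lemma real_form_conclusion:
  assumes real: "F \<subseteq> \<real>" and w: "w \<in> M" "herm n w w = -1" and nonel: "nonelementary n \<Gamma>"
  shows "\<exists>D\<in>isom n. \<exists>m. 2 \<le> m \<and> m \<le> n \<and> (\<forall>A\<in>\<Gamma>.
    qmult (Suc n) (qmult (Suc n) (adj n D) A) D \<in> block_sum (n - m) (m + 1) (Sp_k (n - m)) (O_m1 m))"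
proof -
  have ext: "m \<le> n \<and> (\<exists>D\<in>isom n. mvec n D (bvec n) = w \<and> (\<forall>k<m. mvec n D (bvec (n - 1 - k)) = e k))"
    if "frame w m e" for m e
    by (rule orthonormal_extension[OF M_qvec[OF w(1)] w(2)])
      (use that in \<open>auto simp: frame_def intro: M_qvec\<close>)
  define P where "P m \<longleftrightarrow> (\<exists>e. frame w m e)" for m
  have "P 0" by (simp add: P_def frame_def)
  moreover have "\<forall>m. P m \<longrightarrow> m \<le> n" using ext unfolding P_def by blast
  ultimately have "P (Greatest P)" and gr: "\<And>m. P m \<Longrightarrow> m \<le> Greatest P"
    by (blast intro: GreatestI_nat Greatest_le_nat)+
  define m where "m = Greatest P"
  obtain e where e: "frame w m e" using \<open>P (Greatest P)\<close> unfolding P_def m_def by blast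
  have max: "\<not> frame w (Suc m) e'" for e' using gr[of "Suc m"] unfolding P_def m_def by auto
  from ext[OF e] obtain D where m: "m \<le> n" and D: "D \<in> isom n" "mvec n D (bvec n) = w"
    and De: "\<And>k. k < m \<Longrightarrow> mvec n D (bvec (n - 1 - k)) = e k" by blast
  have eM: "e k \<in> M" if "k < m" for k using e that by (simp add: frame_def)
  have DM: "mvec n D (bvec j) \<in> M" if j: "n - m \<le> j" "j \<le> n" for j
  proof (cases "j = n")
    case True
    then show ?thesis using D(2) w(1) by simp
  next
    case False
    then have "n - 1 - j < m" "n - 1 - (n - 1 - j) = j" using j by simp_all
    then show ?thesis using De[of "n - 1 - j"] eM by simp
  qed
  have Dorth: "herm n (mvec n D (bvec i)) (mvec n D (bvec j)) = 0" if "i \<le> n" "i \<noteq> j" for i j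
    unfolding isom_herm[OF D(1)] using that by (simp add: herm_bvec_bvec)
  have orth: "herm n (mvec n D (bvec i)) x = 0" if i: "i < n - m" and x: "x \<in> M" for i x
  proof -
    have "herm n (mvec n D (bvec i)) w = 0" using Dorth[of i n] i D(2) by simp
    moreover have "herm n (mvec n D (bvec i)) (e k) = 0" if "k < m" for k
      using Dorth[of i "n - 1 - k"] i De[OF that] that m by auto
    ultimately show ?thesis
      by (subst maximal_frame_spans[OF real w e max x])
        (simp add: herm_diff_right herm_sum_right herm_scaleR_right)
  qed
  have "qmult (Suc n) (qmult (Suc n) (adj n D) A) D \<in> block_sum (n - m) (m + 1) (Sp_k (n - m)) (O_m1 m)"
    if A: "A \<in> \<Gamma>" for A
  proof (rule conjugate_block_form(3)[OF D(1) m M_group DM orth A])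
    define B where "B = qmult (Suc n) (qmult (Suc n) (adj n D) A) D"
    define L where "L = (\<lambda>i j. if i < m + 1 \<and> j < m + 1 then B (n - m + i) (n - m + j) else 0)"
    note L = conjugate_block_form(1,2)[OF D(1) m M_group DM orth A, folded B_def, folded L_def]
    have "L i j \<in> \<real>" for i j
    proof (cases "i < m + 1 \<and> j < m + 1")
      case True
      then have ij: "n - m + i \<le> n" "n - m + j \<le> n" using m by arith+
      have "herm n (mvec n D (bvec (n - m + i))) (mvec n A (mvec n D (bvec (n - m + j)))) \<in> \<real>"
        using real herm_M[OF DM M_group[OF A DM]] ij by auto
      moreover have "eps n (n - m + i) \<in> \<real>" by (simp add: eps_def)
      ultimately have "B (n - m + i) (n - m + j) \<in> \<real>"
        unfolding B_def conjugate_entry[OF D(1) qmat[OF A] ij] by (intro Reals_mult)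
      then show ?thesis using True by (simp add: L_def)
    next
      case False
      then have "L i j = 0" unfolding L_def by auto
      then show ?thesis by simp
    qed
    then show "(\<lambda>i j. if i < m + 1 \<and> j < m + 1 then
        qmult (Suc n) (qmult (Suc n) (adj n D) A) D (n - m + i) (n - m + j) else 0) \<in> O_m1 m"
      unfolding B_def[symmetric] L_def[symmetric] O_m1_def using L by (simp add: is_real_q_iff)
  qed
  then show ?thesis using D(1) m frame_size[OF real w e max nonel] by blast
qed

end

section \<open>The antisymmetric case\<close>

lemma quat_numeral_sel:
  "qRe (numeral k) = numeral k" "qI (numeral k) = 0" "qJ (numeral k) = 0" "qK (numeral k) = 0"
  using of_real_quat_sel[of "numeral k"] by simp_all

text \<open>Because \<open>h^2 = -|h|^2\<close>, the element \<open>h + |h| i\<close> intertwines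
  \<open>h\<close> with \<open>|h| i\<close>. It vanishes only for \<open>h = -|h| i\<close>, which
  the sign of \<open>qI h\<close> excludes.\<close>

lemma imaginary_conj_to_i:
  fixes h :: quat
  assumes h: "h \<noteq> 0" "qRe h = 0" and hI: "0 \<le> qI h"
  obtains t where "t \<noteq> 0" "h * t = t * (norm h *\<^sub>R Quat 0 1 0 0)"
proof -
  define t where "t = h + norm h *\<^sub>R Quat 0 1 0 0"
  have n: "norm h * norm h = qI h * qI h + qJ h * qJ h + qK h * qK h"
    using norm_quat_sq[of h] h(2) by (simp add: power2_eq_square)
  have "t \<noteq> 0"
  proof
    assume "t = 0"
    then have "qI h + norm h = 0" by (simp add: t_def quat_eq_iff)
    then show False using hI h(1) by (smt (verit) zero_less_norm_iff)
  qed
  moreover have "h * t = t * (norm h *\<^sub>R Quat 0 1 0 0)"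
    using h(2) n by (simp add: t_def quat_eq_iff quat_mult_sel algebra_simps)
  ultimately show thesis by (rule that)
qed

context rank_one_generator
begin

text \<open>Form values on \<open>M\<close> are imaginary but squares are real, so all of
  \<open>M\<close> is isotropic. A vector of \<open>M\<close> orthogonal to \<open>p\<close> and
  \<open>v\<close> is isotropic and orthogonal to a negative vector, hence 0; so \<open>p\<close>
  and \<open>v\<close> span \<open>M\<close> over the reals. Right multiplication by
  \<open>t\<close> commutes with the group and turns the form value \<open>k\<close> into a multiple
  of \<open>i\<close>.\<close>

lemma antisymmetric_plane:
  assumes h: "h \<noteq> 0" "qRe h = 0" "\<And>c. c \<in> F \<Longrightarrow> \<exists>r. c = r *\<^sub>R h"
  obtains U V where "U \<in> qvec n" "V \<in> qvec n" "herm n U U = 0" "herm n V V = 0"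
    "herm n U V = Quat 0 1 0 0"
    "\<And>A. A \<in> \<Gamma> \<Longrightarrow> \<exists>\<alpha> \<gamma>. mvec n A U = (\<lambda>i. \<alpha> *\<^sub>R U i + \<gamma> *\<^sub>R V i)"
    "\<And>A. A \<in> \<Gamma> \<Longrightarrow> \<exists>\<beta> \<delta>. mvec n A V = (\<lambda>i. \<beta> *\<^sub>R U i + \<delta> *\<^sub>R V i)"
proof -
  have imag: "qRe c = 0" if "c \<in> F" for c using h(3)[OF that] h(2) by auto
  have null: "herm n x x = 0" if "x \<in> M" for x
    by (rule herm_self_zero_if_qRe_zero) (rule imag[OF herm_M[OF that that]])
  obtain c where c: "c \<in> F" "c \<noteq> 0" using F_nonzero by blast
  \<comment> \<open>The sign makes \<open>qI k\<close> nonnegative, as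
    \<open>imaginary_conj_to_i\<close> requires.\<close>
  define k where "k = (if 0 \<le> qI c then c else (-1) *\<^sub>R c)"
  have k: "k \<in> F" unfolding k_def using c(1) F_scale[OF c(1), of "-1"] by simp
  have k0: "k \<noteq> 0" using c(2) by (simp add: k_def)
  have kI: "0 \<le> qI k" by (simp add: k_def)
  have kRe: "qRe k = 0" by (rule imag[OF k])
  have kk: "\<exists>r. x = r *\<^sub>R k" if x: "x \<in> F" for x
  proof -
    obtain r where r: "x = r *\<^sub>R h" using h(3)[OF x] by blast
    obtain s where s: "k = s *\<^sub>R h" using h(3)[OF k] by blast
    have "s \<noteq> 0" using s k0 by auto
    then have "x = (r / s) *\<^sub>R k" by (simp add: r s)
    then show ?thesis by (rule exI)
  qed
  have ksq: "k * k = of_real (- (norm k)\<^sup>2)"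
    using kRe unfolding norm_quat_sq by (simp add: quat_eq_iff quat_mult_sel power2_eq_square del: of_real_minus of_real_add of_real_mult)
  obtain v where v: "v \<in> M" "k = herm n p v" using k by (rule F_E)
  have vp: "herm n v p = - k"
    using qcnj_herm[of n p v] kRe by (simp add: v(2)[symmetric] qcnj_eq_minus_iff[symmetric])
  have span: "\<exists>a b. x = (\<lambda>i. a *\<^sub>R p i + b *\<^sub>R v i)" if x: "x \<in> M" for x
  proof -
    obtain r where r: "herm n p x = r *\<^sub>R k" using kk[OF herm_M[OF p_in_M x]] by blast
    obtain s where s: "herm n v x = s *\<^sub>R k" using kk[OF herm_M[OF v(1) x]] by blast
    define x' where "x' = (\<lambda>i. (x i - r *\<^sub>R v i) + s *\<^sub>R p i)"
    have x': "x' \<in> M" unfolding x'_def by (intro M_add M_diff M_scale x v(1) p_in_M)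
    have px': "herm n p x' = 0"
      unfolding x'_def herm_add_right herm_diff_right herm_scaleR_right r p(2) v(2)[symmetric] by simp
    have vx': "herm n v x' = 0"
      unfolding x'_def herm_add_right herm_diff_right herm_scaleR_right s vp null[OF v(1)] by simp
    \<comment> \<open>A negative vector in the quaternionic span of \<open>p\<close> and
      \<open>v\<close>: both cross terms of its square equal \<open>k * k\<close>, a negative real
      number.\<close>
    define z where "z = (\<lambda>i. p i + v i * k)"
    have z: "z \<in> qvec n" unfolding z_def by (intro qvec_add qvec_scale p(1) M_qvec v(1))
    have "herm n z z = k * k + qcnj (k * k)"
      unfolding z_def herm_add_left herm_add_right herm_scale_left herm_scale_right p(2) null[OF v(1)] vp
        v(2)[symmetric] using kRe by (simp add: qcnj_eq_minus_iff[symmetric])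
    then have "qRe (herm n z z) = - 2 * (norm k)\<^sup>2" by (simp add: ksq del: of_real_minus of_real_power)
    then have zneg: "qRe (herm n z z) < 0" using k0 by simp
    have zx': "herm n z x' = 0" unfolding z_def herm_add_left herm_scale_left px' vx' by simp
    have "x' = (\<lambda>i. 0)"
    proof (rule ccontr)
      assume "x' \<noteq> (\<lambda>i. 0)"
      from herm_pos_orth[OF z zneg M_qvec[OF x'] zx' this] show False by (simp add: null[OF x'])
    qed
    then have "x i - r *\<^sub>R v i + s *\<^sub>R p i = 0" for i by (simp add: x'_def fun_eq_iff)
    then have "x i = (- s) *\<^sub>R p i + r *\<^sub>R v i" for i
      by (metis (no_types, opaque_lifting) add.commute add.inverse_unique add_diff_cancel_left' diff_add_cancel
          eq_neg_iff_add_eq_0 scaleR_minus_left uminus_add_conv_diff)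
    then have "x = (\<lambda>i. (- s) *\<^sub>R p i + r *\<^sub>R v i)" ..
    then show ?thesis by blast
  qed
  obtain t where t: "t \<noteq> 0" "k * t = t * (norm k *\<^sub>R Quat 0 1 0 0)"
    by (rule imaginary_conj_to_i[OF k0 kRe kI])
  \<comment> \<open>Cancels the factor in \<open>cnj t * k * t = |t|^2 |k| i\<close>, so that the
    form value of \<open>U\<close> and \<open>V\<close> is exactly \<open>i\<close>.\<close>
  define s where "s = 1 / ((norm t)\<^sup>2 * norm k)"
  have s0: "s \<noteq> 0" using t(1) k0 by (simp add: s_def)
  define U where "U = (\<lambda>i. p i * t)"
  define V where "V = (\<lambda>i. s *\<^sub>R (v i * t))"
  have UV: "herm n U V = Quat 0 1 0 0"
  proof -
    have "herm n U V = s *\<^sub>R (qcnj t * (k * t))"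
      unfolding U_def V_def herm_scaleR_right herm_scale_right herm_scale_left v(2)[symmetric]
      by (simp add: mult.assoc)
    also have "\<dots> = s *\<^sub>R ((qcnj t * t) * (norm k *\<^sub>R Quat 0 1 0 0))" unfolding t(2) by (simp only: mult.assoc)
    also have "\<dots> = (s * ((norm t)\<^sup>2 * norm k)) *\<^sub>R Quat 0 1 0 0"
      unfolding qcnj_mult_self by (simp add: quat_eq_iff quat_mult_sel del: of_real_power)
    also have "s * ((norm t)\<^sup>2 * norm k) = 1" using t(1) k0 by (simp add: s_def)
    finally show ?thesis by simp
  qed
  have image: "\<exists>a b. mvec n A (\<lambda>i. x i * t) = (\<lambda>i. a *\<^sub>R U i + b *\<^sub>R V i)"
    if A: "A \<in> \<Gamma>" and x: "x \<in> M" for A x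
  proof -
    obtain a b where ab: "mvec n A x = (\<lambda>i. a *\<^sub>R p i + b *\<^sub>R v i)"
      using span[OF M_group[OF A x]] by blast
    have "mvec n A (\<lambda>i. x i * t) = (\<lambda>i. a *\<^sub>R U i + (b / s) *\<^sub>R V i)"
      unfolding mvec_scale ab U_def V_def using s0 by (simp add: distrib_right)
    then show ?thesis by blast
  qed
  show thesis
  proof (rule that)
    show "U \<in> qvec n" "V \<in> qvec n" unfolding U_def V_def
      by (intro qvec_scale qvec_scaleR p(1) M_qvec v(1))+
    show "herm n U U = 0" unfolding U_def herm_scale_left herm_scale_right p(2) by simp
    show "herm n V V = 0"
      unfolding V_def herm_scaleR_left herm_scaleR_right herm_scale_left herm_scale_right null[OF v(1)] by simp
    show "herm n U V = Quat 0 1 0 0" by (rule UV)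
    fix A assume A: "A \<in> \<Gamma>"
    show "\<exists>\<alpha> \<gamma>. mvec n A U = (\<lambda>i. \<alpha> *\<^sub>R U i + \<gamma> *\<^sub>R V i)"
      using image[OF A p_in_M] unfolding U_def .
    obtain a b where "mvec n A (\<lambda>i. v i * t) = (\<lambda>i. a *\<^sub>R U i + b *\<^sub>R V i)"
      using image[OF A v(1)] by blast
    then have "mvec n A V = (\<lambda>i. (s * a) *\<^sub>R U i + (s * b) *\<^sub>R V i)"
      by (subst V_def) (simp add: mvec_scaleR scaleR_add_right)
    then show "\<exists>\<beta> \<delta>. mvec n A V = (\<lambda>i. \<beta> *\<^sub>R U i + \<delta> *\<^sub>R V i)" by blast
  qed
qed

end

text \<open>The group acts on \<open>U\<close> and \<open>V\<close> by real 2x2 matrices. The Cayley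
  transform, to \<open>(U - V i) / sqrt 2\<close> and \<open>(U + V i) / sqrt 2\<close>, yields a
  positive and a negative unit vector orthogonal to each other, and turns real matrices into complex
  ones with columns \<open>(X, Y)\<close> and \<open>(cnj Y, cnj X)\<close>.\<close>

lemma (in isom_group) hyperbolic_plane_conclusion:
  assumes U: "U \<in> qvec n" "herm n U U = 0" and V: "V \<in> qvec n" "herm n V V = 0"
    and UV: "herm n U V = Quat 0 1 0 0"
    and AU: "\<And>A. A \<in> \<Gamma> \<Longrightarrow> \<exists>\<alpha> \<gamma>. mvec n A U = (\<lambda>i. \<alpha> *\<^sub>R U i + \<gamma> *\<^sub>R V i)"
    and AV: "\<And>A. A \<in> \<Gamma> \<Longrightarrow> \<exists>\<beta> \<delta>. mvec n A V = (\<lambda>i. \<beta> *\<^sub>R U i + \<delta> *\<^sub>R V i)"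
  shows "\<exists>D\<in>isom n. \<forall>A\<in>\<Gamma>.
    qmult (Suc n) (qmult (Suc n) (adj n D) A) D \<in> block_sum (n - 1) 2 (Sp_k (n - 1)) SU11"
proof -
  define \<iota> where "\<iota> = Quat 0 1 0 0"
  have ii: "\<iota> * \<iota> = -1" and qi: "qcnj \<iota> = - \<iota>" and [simp]: "qRe \<iota> = 0" "qI \<iota> = 1" "qJ \<iota> = 0" "qK \<iota> = 0"
    by (simp_all add: \<iota>_def quat_eq_iff quat_mult_sel)
  have VU: "herm n V U = - \<iota>" using qcnj_herm[of n U V] UV qi by (simp add: \<iota>_def)
  note UV = UV[folded \<iota>_def]
  define \<sigma> where "\<sigma> = 1 / sqrt 2"
  have ss: "\<sigma> * \<sigma> = 1 / 2" by (simp add: \<sigma>_def)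
  define a where "a = (\<lambda>j. \<sigma> *\<^sub>R (U j - V j * \<iota>))"
  define b where "b = (\<lambda>j. \<sigma> *\<^sub>R (U j + V j * \<iota>))"
  have ab: "a \<in> qvec n" "b \<in> qvec n"
    unfolding a_def b_def by (intro qvec_scaleR qvec_add qvec_diff qvec_scale U V)+
  have forms: "herm n a a = 1" "herm n b b = -1" "herm n b a = 0"
    unfolding a_def b_def herm_scaleR_left herm_scaleR_right herm_lin scaleR_scaleR ss
    by (simp_all add: U(2) V(2) UV VU qi ii) (simp_all add: quat_eq_iff quat_numeral_sel)
  have ab0: "herm n a b = 0" by (rule herm_zero_sym[OF forms(3)])
  from orthonormal_extension[OF ab(2) forms(2), of 1 "\<lambda>k. a"] forms(1,3) ab(1)
  have n1: "1 \<le> n" and "\<exists>D\<in>isom n. mvec n D (bvec n) = b \<and> (\<forall>k<1. mvec n D (bvec (n - 1 - k)) = a)"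
    by simp_all
  then obtain D where D: "D \<in> isom n" "mvec n D (bvec n) = b" "mvec n D (bvec (n - 1)) = a" by auto
  define S where "S = {x. \<exists>s t. x = (\<lambda>j. a j * s + b j * t)}"
  have action: "\<exists>X Y. is_complex_q X \<and> is_complex_q Y \<and> mvec n A a = (\<lambda>j. a j * X + b j * Y) \<and>
      mvec n A b = (\<lambda>j. a j * qcnj Y + b j * qcnj X)" if A: "A \<in> \<Gamma>" for A
  proof -
    obtain \<alpha> \<gamma> where u: "mvec n A U = (\<lambda>i. \<alpha> *\<^sub>R U i + \<gamma> *\<^sub>R V i)" using AU[OF A] by blast
    obtain \<beta> \<delta> where v: "mvec n A V = (\<lambda>i. \<beta> *\<^sub>R U i + \<delta> *\<^sub>R V i)" using AV[OF A] by blast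
    \<comment> \<open>Comparing coefficients of \<open>U\<close> and \<open>V\<close> in the images
      of \<open>a\<close> and \<open>b\<close> gives the four equations \<open>XY\<close>; these
      complex numbers solve them.\<close>
    define X where "X = Quat ((\<alpha> + \<delta>) / 2) ((\<gamma> - \<beta>) / 2) 0 0"
    define Y where "Y = Quat ((\<alpha> - \<delta>) / 2) (- (\<gamma> + \<beta>) / 2) 0 0"
    have XY: "X + Y = of_real \<alpha> - of_real \<beta> * \<iota>" "\<iota> * (Y - X) = of_real \<gamma> - of_real \<delta> * \<iota>"
      "qcnj Y + qcnj X = of_real \<alpha> + of_real \<beta> * \<iota>" "\<iota> * (qcnj X - qcnj Y) = of_real \<gamma> + of_real \<delta> * \<iota>"
      unfolding X_def Y_def by (simp_all add: quat_eq_iff quat_mult_sel field_simps)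
    have "mvec n A a j = a j * X + b j * Y" for j
    proof -
      have "mvec n A a j = \<sigma> *\<^sub>R (U j * (of_real \<alpha> - of_real \<beta> * \<iota>) + V j * (of_real \<gamma> - of_real \<delta> * \<iota>))"
        unfolding a_def mvec_scaleR mvec_diff mvec_scale u v
        by (simp add: quat_eq_iff quat_mult_sel algebra_simps)
      also have "\<dots> = a j * X + b j * Y"
        unfolding XY[symmetric] a_def b_def by (simp add: algebra_simps)
      finally show ?thesis .
    qed
    moreover have "mvec n A b j = a j * qcnj Y + b j * qcnj X" for j
    proof -
      have "mvec n A b j = \<sigma> *\<^sub>R (U j * (of_real \<alpha> + of_real \<beta> * \<iota>) + V j * (of_real \<gamma> + of_real \<delta> * \<iota>))"
        unfolding b_def mvec_scaleR mvec_add mvec_scale u v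
        by (simp add: quat_eq_iff quat_mult_sel algebra_simps)
      also have "\<dots> = a j * qcnj Y + b j * qcnj X"
        unfolding XY[symmetric] a_def b_def by (simp add: algebra_simps)
      finally show ?thesis .
    qed
    moreover have "is_complex_q X" "is_complex_q Y" by (simp_all add: is_complex_q_def X_def Y_def)
    ultimately show ?thesis by (intro exI[of _ X] exI[of _ Y]) (simp add: fun_eq_iff)
  qed
  have S_inv: "mvec n A x \<in> S" if A: "A \<in> \<Gamma>" and x: "x \<in> S" for A x
  proof -
    obtain s t where st: "x = (\<lambda>j. a j * s + b j * t)" using x unfolding S_def by blast
    obtain X Y where XY: "mvec n A a = (\<lambda>j. a j * X + b j * Y)"
      "mvec n A b = (\<lambda>j. a j * qcnj Y + b j * qcnj X)" using action[OF A] by blast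
    have "mvec n A x = (\<lambda>j. a j * (X * s + qcnj Y * t) + b j * (Y * s + qcnj X * t))"
      unfolding st mvec_add mvec_scale XY by (simp add: algebra_simps)
    then show ?thesis unfolding S_def by blast
  qed
  have D_S: "mvec n D (bvec j) \<in> S" if "n - 1 \<le> j" "j \<le> n" for j
  proof -
    have "a = (\<lambda>j. a j * 1 + b j * 0)" "b = (\<lambda>j. a j * 0 + b j * 1)" by simp_all
    then have "a \<in> S" "b \<in> S" unfolding S_def by blast+
    moreover have "j = n - 1 \<or> j = n" using that by linarith
    ultimately show ?thesis using D(2,3) by auto
  qed
  have orth: "herm n (mvec n D (bvec i)) x = 0" if i: "i < n - 1" and x: "x \<in> S" for i x
  proof -
    obtain s t where st: "x = (\<lambda>j. a j * s + b j * t)" using x unfolding S_def by blast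
    have "herm n (mvec n D (bvec i)) (mvec n D (bvec n)) = 0"
      "herm n (mvec n D (bvec i)) (mvec n D (bvec (n - 1))) = 0"
      unfolding isom_herm[OF D(1)] using i by (auto simp: herm_bvec_bvec)
    then show ?thesis unfolding st herm_add_right herm_scale_right D(2,3) by simp
  qed
  have "qmult (Suc n) (qmult (Suc n) (adj n D) A) D \<in> block_sum (n - 1) (1 + 1) (Sp_k (n - 1)) SU11"
    if A: "A \<in> \<Gamma>" for A
  proof (rule conjugate_block_form(3)[OF D(1) n1 S_inv D_S orth A])
    define B where "B = qmult (Suc n) (qmult (Suc n) (adj n D) A) D"
    define L where "L = (\<lambda>i j. if i < 1 + 1 \<and> j < 1 + 1 then B (n - 1 + i) (n - 1 + j) else 0)"
    note L = conjugate_block_form(1,2)[OF D(1) n1 S_inv D_S orth A, folded B_def, folded L_def]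
    obtain X Y where XY: "is_complex_q X" "is_complex_q Y" "mvec n A a = (\<lambda>j. a j * X + b j * Y)"
      "mvec n A b = (\<lambda>j. a j * qcnj Y + b j * qcnj X)" using action[OF A] by blast
    have e: "eps n (n - 1) = 1" "eps n n = -1" using n1 by (simp_all add: eps_def)
    note entry = conjugate_entry[OF D(1) qmat[OF A], folded B_def]
    have n1': "n - 1 + 1 = n" "n - 1 \<le> n" using n1 by simp_all
    have L00: "L 0 0 = X"
      using entry[of "n - 1" "n - 1"] unfolding L_def D(2,3) XY(3,4) herm_add_right herm_scale_right forms ab0 e
      by simp
    have L01: "L 0 1 = qcnj Y"
      using entry[of "n - 1" n] n1' unfolding L_def D(2,3) XY(3,4) herm_add_right herm_scale_right forms ab0 e
      by simp
    have L10: "L 1 0 = Y"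
      using entry[of n "n - 1"] n1' unfolding L_def D(2,3) XY(3,4) herm_add_right herm_scale_right forms ab0 e
      by simp
    have L11: "L 1 1 = qcnj X"
      using entry[of n n] n1' unfolding L_def D(2,3) XY(3,4) herm_add_right herm_scale_right forms ab0 e
      by simp
    have cplx: "is_complex_q (L i j)" for i j
    proof (cases "i < 2 \<and> j < 2")
      case True
      then have "(i = 0 \<or> i = 1) \<and> (j = 0 \<or> j = 1)" by auto
      then show ?thesis using L00 L01 L10 L11 XY(1,2) by (auto simp: is_complex_q_def)
    next
      case False
      then have "L i j = 0" unfolding L_def by auto
      then show ?thesis by (simp add: is_complex_q_def)
    qed
    \<comment> \<open>The determinant is \<open>|X|^2 - |Y|^2\<close>, the square of the image of
      \<open>a\<close>; so it is 1 by invariance of the form.\<close>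
    have "herm n (mvec n A a) (mvec n A a) = 1" by (simp only: isom_herm[OF isom[OF A]] forms)
    then have "qcnj X * X - qcnj Y * Y = 1"
      unfolding XY(3) herm_add_left herm_add_right herm_scale_left herm_scale_right by (simp add: forms ab0)
    then have det: "L 0 0 * L 1 1 - L 0 1 * L 1 0 = 1"
      unfolding L00 L01 L10 L11 by (simp only: qcnj_mult_self)
    have "L \<in> SU11"
      unfolding SU11_def using L cplx det by (simp add: numeral_2_eq_2)
    then show "(\<lambda>i j. if i < 1 + 1 \<and> j < 1 + 1 then
        qmult (Suc n) (qmult (Suc n) (adj n D) A) D (n - 1 + i) (n - 1 + j) else 0) \<in> SU11"
      unfolding L_def B_def .
  qed
  then show ?thesis using D(1) unfolding one_add_one by blast
qed

section \<open>Translation of the hypotheses and the final case distinction\<close>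

lemma Sp_n1_subgroup_isom_group:
  assumes "is_subgroup (Suc n) \<Gamma> (Sp_n1 n)"
  shows "isom_group n \<Gamma>"
proof
  have sub: "\<Gamma> \<subseteq> isom n" using assms unfolding is_subgroup_def Sp_n1_eq_isom by simp
  show iso: "A \<in> isom n" if "A \<in> \<Gamma>" for A using sub that by (rule subsetD)
  show "qid (Suc n) \<in> \<Gamma>" using assms unfolding is_subgroup_def by simp
  show "qmult (Suc n) A B \<in> \<Gamma>" if "A \<in> \<Gamma>" "B \<in> \<Gamma>" for A B
    using assms that unfolding is_subgroup_def by simp
  fix A assume A: "A \<in> \<Gamma>"
  then obtain B where B: "B \<in> \<Gamma>" and AB: "qmult (Suc n) A B = qid (Suc n)"
    using assms unfolding is_subgroup_def by blast
  have Aq: "A \<in> qmat (Suc n)" and Bq: "B \<in> qmat (Suc n)" by (rule isom_qmat[OF iso[OF A]], rule isom_qmat[OF iso[OF B]])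
  have adjA: "qmult (Suc n) (adj n A) A = qid (Suc n)" using iso[OF A] by (simp only: isom_def mem_Collect_eq)
  have "adj n A = qmult (Suc n) (adj n A) (qmult (Suc n) A B)" by (simp only: AB qmult_qid adj_in_qmat)
  also have "\<dots> = B" by (simp only: qmult_assoc[OF adj_in_qmat Aq, symmetric] adjA qmult_qid Bq)
  finally show "adj n A \<in> \<Gamma>" using B by simp
qed

lemma trace_in_Reals:
  assumes "trace_field N \<Gamma> \<subseteq> range qreal" "A \<in> \<Gamma>"
  shows "qtrace N A \<in> \<real>"
proof -
  have "qtrace N A \<in> trace_field N \<Gamma>" unfolding trace_field_def using assms(2) by blast
  then obtain r where "qtrace N A = qreal r" using assms(1) by blast
  then show ?thesis by (simp add: Reals_quat_iff qreal_def quat_eq_iff)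
qed

theorem theorem4p14:
  fixes n :: nat and \<Gamma> :: "qmatrix set"
  assumes "is_subgroup (n+1) \<Gamma> (Sp_n1 n)"
    and "discrete_set (n+1) \<Gamma>"
    and "nonelementary n \<Gamma>"
    and "trace_field (n+1) \<Gamma> \<subseteq> range qreal"
  shows "\<exists>C\<in>Sp_n1 n. \<exists>D\<in>Sp_n1 n. qmult (n+1) C D = qid (n+1) \<and> qmult (n+1) D C = qid (n+1) \<and>
     ((\<exists>m. 2 \<le> m \<and> m \<le> n \<and>
         (\<forall>A\<in>\<Gamma>. qmult (n+1) (qmult (n+1) C A) D \<in> block_sum (n-m) (m+1) (Sp_k (n-m)) (O_m1 m)))
      \<or> (\<forall>A\<in>\<Gamma>. qmult (n+1) (qmult (n+1) C A) D \<in> block_sum (n-1) 2 (Sp_k (n-1)) SU11))"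
proof -
  note sub = assms(1)[folded Suc_eq_plus1] and disc = assms(2)[folded Suc_eq_plus1]
    and tr = trace_in_Reals[OF assms(4)[folded Suc_eq_plus1]]
  interpret isom_group n \<Gamma> by (rule Sp_n1_subgroup_isom_group[OF sub])
  obtain p where "rank_one_generator n \<Gamma> p"
    using rank_one_generator_exists[OF disc assms(3) tr] by blast
  then interpret rank_one_generator n \<Gamma> p .
  have "\<exists>D\<in>isom n. (\<exists>m. 2 \<le> m \<and> m \<le> n \<and>
         (\<forall>A\<in>\<Gamma>. qmult (Suc n) (qmult (Suc n) (adj n D) A) D \<in> block_sum (n-m) (m+1) (Sp_k (n-m)) (O_m1 m)))
      \<or> (\<forall>A\<in>\<Gamma>. qmult (Suc n) (qmult (Suc n) (adj n D) A) D \<in> block_sum (n-1) 2 (Sp_k (n-1)) SU11)"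
  \<comment> \<open>A coefficient with nonzero real part yields a real one by conjugation symmetry
    of \<open>Q\<close>; this is the orthogonal case, and purely imaginary coefficients give the
    symplectic one.\<close>
  proof (cases "\<exists>d\<in>Q. qRe d \<noteq> 0")
    case True
    then obtain d where d: "d \<in> Q" "qRe d \<noteq> 0" by blast
    obtain w where w: "w \<in> M" "herm n w w = -1" using symmetric_case(2)[OF d] by blast
    show ?thesis using real_form_conclusion[OF symmetric_case(1)[OF d] w assms(3)] by blast
  next
    case False
    then have imag: "qRe d = 0" if "d \<in> Q" for d using that by blast
    show ?thesis
    proof (rule antisymmetric_case[OF imag])
      fix h assume h: "h \<noteq> 0" "qRe h = 0" "\<And>c. c \<in> F \<Longrightarrow> \<exists>r. c = r *\<^sub>R h"
      show ?thesis
      proof (rule antisymmetric_plane[OF h])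
        fix U V
        assume "U \<in> qvec n" "V \<in> qvec n" "herm n U U = 0" "herm n V V = 0" "herm n U V = Quat 0 1 0 0"
          "\<And>A. A \<in> \<Gamma> \<Longrightarrow> \<exists>\<alpha> \<gamma>. mvec n A U = (\<lambda>i. \<alpha> *\<^sub>R U i + \<gamma> *\<^sub>R V i)"
          "\<And>A. A \<in> \<Gamma> \<Longrightarrow> \<exists>\<beta> \<delta>. mvec n A V = (\<lambda>i. \<beta> *\<^sub>R U i + \<delta> *\<^sub>R V i)"
        from hyperbolic_plane_conclusion[OF this(1,3,2,4-7)] show ?thesis by blast
      qed
    qed
  qed
  then obtain D where D: "D \<in> isom n" and concl: "(\<exists>m. 2 \<le> m \<and> m \<le> n \<and>
         (\<forall>A\<in>\<Gamma>. qmult (Suc n) (qmult (Suc n) (adj n D) A) D \<in> block_sum (n-m) (m+1) (Sp_k (n-m)) (O_m1 m)))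
      \<or> (\<forall>A\<in>\<Gamma>. qmult (Suc n) (qmult (Suc n) (adj n D) A) D \<in> block_sum (n-1) 2 (Sp_k (n-1)) SU11)"
    by (rule bexE)
  have inv: "qmult (Suc n) (adj n D) D = qid (Suc n)" "qmult (Suc n) D (adj n D) = qid (Suc n)"
    using D by (simp_all only: isom_def mem_Collect_eq)
  show ?thesis
    unfolding Suc_eq_plus1[symmetric, of n] Sp_n1_eq_isom
    by (intro bexI[of _ "adj n D"] bexI[of _ D] conjI inv concl D isom_adj)
qed

end
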